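(* Let $\Gamma$ be a nonlinear connection on $E=J^1(\mathbb{R},M)$ and let $\nabla$ be a $\Gamma$-linear connection on $E$. The curvature tensor $\mathbf{R}(X,Y)Z=\nabla_X\nabla_YZ-\nabla_Y\nabla_XZ-\nabla_{[X,Y]}Z$ of $\nabla$ is determined by fifteen effective adapted local curvature d-tensors $$\bar R_{11k}^1,\;R_{i1k}^l,\;R_{(1)(i)1k}^{(l)(1)},\;\bar R_{1jk}^1,\;R_{ijk}^l,\;R_{(1)(i)jk}^{(l)(1)},\;\bar P_{11(k)}^{1\;\;(1)},\;P_{i1(k)}^{l\;\;(1)},\;P_{(1)(i)1(k)}^{(l)(1)\;(1)},$$ $$\bar P_{1j(k)}^{1\;\;(1)},\;P_{ij(k)}^{l\;\;(1)},\;P_{(1)(i)j(k)}^{(l)(1)\;(1)},\;\bar S_{1(j)(k)}^{1(1)(1)},\;S_{i(j)(k)}^{l(1)(1)},\;S_{(1)(i)(j)(k)}^{(l)(1)(1)(1)},$$ through the relations $$\mathbf{R}\left(\tfrac{\delta}{\delta t},\tfrac{\delta}{\delta t}\right)\tfrac{\delta}{\delta t}=0,\quad \mathbf{R}\left(\tfrac{\delta}{\delta t},\tfrac{\delta}{\delta t}\right)\tfrac{\delta}{\delta x^i}=0,\quad \mathbf{R}\left(\tfrac{\delta}{\delta t},\tfrac{\delta}{\delta t}\right)\tfrac{\partial}{\partial y_1^i}=0,$$ $$\mathbf{R}\left(\tfrac{\delta}{\delta x^k},\tfrac{\delta}{\delta t}\right)\tfrac{\delta}{\delta t}=\bar R_{11k}^1\tfrac{\delta}{\delta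 t},\quad \mathbf{R}\left(\tfrac{\delta}{\delta x^k},\tfrac{\delta}{\delta t}\right)\tfrac{\delta}{\delta x^i}=R_{i1k}^l\tfrac{\delta}{\delta x^l},\quad \mathbf{R}\left(\tfrac{\delta}{\delta x^k},\tfrac{\delta}{\delta t}\right)\tfrac{\partial}{\partial y_1^i}=R_{(1)(i)1k}^{(l)(1)}\tfrac{\partial}{\partial y_1^l},$$ $$\mathbf{R}\left(\tfrac{\delta}{\delta x^k},\tfrac{\delta}{\delta x^j}\right)\tfrac{\delta}{\delta t}=\bar R_{1jk}^1\tfrac{\delta}{\delta t},\quad \mathbf{R}\left(\tfrac{\delta}{\delta x^k},\tfrac{\delta}{\delta x^j}\right)\tfrac{\delta}{\delta x^i}=R_{ijk}^l\tfrac{\delta}{\delta x^l},\quad \mathbf{R}\left(\tfrac{\delta}{\delta x^k},\tfrac{\delta}{\delta x^j}\right)\tfrac{\partial}{\partial y_1^i}=R_{(1)(i)jk}^{(l)(1)}\tfrac{\partial}{\partial y_1^l},$$ $$\mathbf{R}\left(\tfrac{\partial}{\partial y_1^k},\tfrac{\delta}{\delta t}\right)\tfrac{\delta}{\delta t}=\bar P_{11(k)}^{1\;\;(1)}\tfrac{\delta}{\delta t},\quad \mathbf{R}\left(\tfrac{\partial}{\partial y_1^k},\tfrac{\delta}{\delta t}\right)\tfrac{\delta}{\delta x^i}=P_{i1(k)}^{l\;\;(1)}\tfrac{\delta}{\delta x^l},\quad \mathbf{R}\left(\tfrac{\partial}{\partial y_1^k},\tfrac{\delta}{\delta t}\right)\tfrac{\partial}{\partial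 y_1^i}=P_{(1)(i)1(k)}^{(l)(1)\;(1)}\tfrac{\partial}{\partial y_1^l},$$ $$\mathbf{R}\left(\tfrac{\partial}{\partial y_1^k},\tfrac{\delta}{\delta x^j}\right)\tfrac{\delta}{\delta t}=\bar P_{1j(k)}^{1\;\;(1)}\tfrac{\delta}{\delta t},\quad \mathbf{R}\left(\tfrac{\partial}{\partial y_1^k},\tfrac{\delta}{\delta x^j}\right)\tfrac{\delta}{\delta x^i}=P_{ij(k)}^{l\;\;(1)}\tfrac{\delta}{\delta x^l},\quad \mathbf{R}\left(\tfrac{\partial}{\partial y_1^k},\tfrac{\delta}{\delta x^j}\right)\tfrac{\partial}{\partial y_1^i}=P_{(1)(i)j(k)}^{(l)(1)\;(1)}\tfrac{\partial}{\partial y_1^l},$$ $$\mathbf{R}\left(\tfrac{\partial}{\partial y_1^k},\tfrac{\partial}{\partial y_1^j}\right)\tfrac{\delta}{\delta t}=\bar S_{1(j)(k)}^{1(1)(1)}\tfrac{\delta}{\delta t},\quad \mathbf{R}\left(\tfrac{\partial}{\partial y_1^k},\tfrac{\partial}{\partial y_1^j}\right)\tfrac{\delta}{\delta x^i}=S_{i(j)(k)}^{l(1)(1)}\tfrac{\delta}{\delta x^l},\quad \mathbf{R}\left(\tfrac{\partial}{\partial y_1^k},\tfrac{\partial}{\partial y_1^j}\right)\tfrac{\partial}{\partial y_1^i}=S_{(1)(i)(j)(k)}^{(l)(1)(1)(1)}\tfrac{\partial}{\partial y_1^l}.$$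
   Context: $M$ is a smooth $n$-dimensional manifold with local coordinates $(x^i)_{i=\overline{1,n}}$, $\mathbb{R}$ is the time manifold with coordinate $t$, and $E=J^1(\mathbb{R},M)\to\mathbb{R}\times M$ is the 1-jet vector bundle, with local coordinates $(t,x^i,y_1^i)$ transforming by $$\tilde t=\tilde t(t),\quad \tilde x^i=\tilde x^i(x^j),\quad \tilde y_1^i=\frac{\partial\tilde x^i}{\partial x^j}\frac{dt}{d\tilde t}\,y_1^j .$$ Latin indices run over $1,\dots,n$ and repeated Latin indices are summed; the index $1$ refers to the single time direction. A nonlinear connection $\Gamma=\left(M_{(1)1}^{(i)},N_{(1)j}^{(i)}\right)$ on $E$ is a family of local functions on the charts of $E$ transforming by $$\tilde M_{(1)1}^{(k)}=M_{(1)1}^{(j)}\left(\frac{dt}{d\tilde t}\right)^2\frac{\partial\tilde x^k}{\partial x^j}-\frac{dt}{d\tilde t}\frac{\partial\tilde y_1^k}{\partial t},\qquad \tilde N_{(1)l}^{(k)}=N_{(1)i}^{(j)}\frac{dt}{d\tilde t}\frac{\partial x^i}{\partial\tilde x^l}\frac{\partial\tilde x^k}{\partial x^j}-\frac{\partial x^i}{\partial\tilde x^l}\frac{\partial\tilde y_1^k}{\partial x^i}.$$ The adapted basis of vector fields is $$\frac{\delta}{\delta t}=\frac{\partial}{\partial t}-M_{(1)1}^{(j)}\frac{\partial}{\partial y_1^j},\quad \frac{\delta}{\delta x^i}=\frac{\partial}{\partial x^i}-N_{(1)i}^{(j)}\frac{\partial}{\partial y_1^j},\quad \frac{\partial}{\partial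 y_1^i}.$$ $h_{\mathbb{R}}$, $h_M$, $v$ denote the projections of $\mathcal{X}(E)$ onto the summands locally spanned respectively by $\frac{\delta}{\delta t}$, by the $\frac{\delta}{\delta x^i}$, by the $\frac{\partial}{\partial y_1^i}$. A $\Gamma$-linear connection on $E$ is a linear connection $\nabla$ on $E$ with $\nabla h_{\mathbb{R}}=0$, $\nabla h_M=0$, $\nabla v=0$, i.e. $\nabla_X(hY)=h(\nabla_XY)$ for $h\in\{h_{\mathbb{R}},h_M,v\}$. A d-tensor field on $E$ is a geometrical object $D=\left(D_{1k(1)(l)\ldots}^{1i(j)(1)\ldots}\right)$ whose local components transform by $$D_{1k(1)(l)\ldots}^{1i(j)(1)\ldots}=\tilde D_{1r(1)(s)\ldots}^{1p(m)(1)\ldots}\frac{dt}{d\tilde t}\frac{\partial x^i}{\partial\tilde x^p}\left(\frac{\partial x^j}{\partial\tilde x^m}\frac{d\tilde t}{dt}\right)\frac{d\tilde t}{dt}\frac{\partial\tilde x^r}{\partial x^k}\left(\frac{\partial\tilde x^s}{\partial x^l}\frac{dt}{d\tilde t}\right)\cdots,$$ where an upper $(j)$ paired with a lower $(1)$ is a vertical contravariant index and a lower $(l)$ paired with an upper $(1)$ is a vertical covariant index. *)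

theory Defs
  imports "HOL-Analysis.Analysis"
begin

section \<open>Smooth maps and smooth manifolds\<close>

text \<open>\<open>Ck_on\<close> and \<open>smooth_on\<close> are only applied to open sets \<open>S\<close>.\<close>

fun Ck_on :: "nat \<Rightarrow> ('a::euclidean_space \<Rightarrow> 'b::real_normed_vector) \<Rightarrow> 'a set \<Rightarrow> bool" where
  "Ck_on 0 f S \<longleftrightarrow> continuous_on S f"
| "Ck_on (Suc k) f S \<longleftrightarrow>
     (\<forall>x\<in>S. f differentiable (at x)) \<and> (\<forall>v. Ck_on k (\<lambda>x. frechet_derivative f (at x) v) S)"

definition smooth_on :: "('a::euclidean_space \<Rightarrow> 'b::real_normed_vector) \<Rightarrow> 'a set \<Rightarrow> bool" where
  "smooth_on f S \<longleftrightarrow> (\<forall>k. Ck_on k f S)"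

text \<open>A chart is a pair (domain, coordinate map); the values of the map outside its domain are
  irrelevant. A manifold is a pair (topology, smooth structure), the smooth structure being a
  maximal atlas. Its dimension is \<open>CARD('n)\<close>.\<close>

type_synonym ('a, 'n) mchart = "'a set \<times> ('a \<Rightarrow> real ^ 'n)"
type_synonym ('a, 'n) manifold = "'a topology \<times> ('a, 'n) mchart set"

definition is_chart :: "'a topology \<Rightarrow> ('a, 'n::finite) mchart \<Rightarrow> bool" where
  "is_chart T = (\<lambda>(U, \<phi>). openin T U \<and> open (\<phi> ` U) \<and>
     homeomorphic_map (subtopology T U) (top_of_set (\<phi> ` U)) \<phi>)"

definition smooth_transition :: "('a, 'n::finite) mchart \<Rightarrow> ('a, 'n) mchart \<Rightarrow> bool" where
  "smooth_transition = (\<lambda>(U, \<phi>) (V, \<psi>). smooth_on (\<psi> \<circ> inv_into U \<phi>) (\<phi> ` (U \<inter> V)))"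

definition smooth_manifold :: "('a, 'n::finite) manifold \<Rightarrow> bool" where
  "smooth_manifold = (\<lambda>(T, A). Hausdorff_space T \<and> second_countable T \<and>
     (\<forall>a\<in>A. is_chart T a) \<and> \<Union> (fst ` A) = topspace T \<and>
     (\<forall>a\<in>A. \<forall>b\<in>A. smooth_transition a b) \<and>
     (\<forall>b. is_chart T b \<and> (\<forall>a\<in>A. smooth_transition a b \<and> smooth_transition b a) \<longrightarrow> b \<in> A))"

text \<open>The charts of the time manifold: all charts of the standard smooth structure of the real
  line.\<close>

definition time_charts :: "(real set \<times> (real \<Rightarrow> real)) set" where
  "time_charts = {(I, \<tau>). open I \<and> inj_on \<tau> I \<and> open (\<tau> ` I) \<and>
     smooth_on \<tau> I \<and> smooth_on (inv_into I \<tau>) (\<tau> ` I)}"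

section \<open>The 1-jet space and its charts\<close>

definition smooth_curve_at :: "('a, 'n::finite) manifold \<Rightarrow> (real \<Rightarrow> 'a) \<Rightarrow> real \<Rightarrow> bool" where
  "smooth_curve_at M \<gamma> s \<longleftrightarrow> (\<exists>J. open J \<and> s \<in> J \<and> continuous_map (top_of_set J) (fst M) \<gamma> \<and>
     (\<forall>(U, \<phi>)\<in>snd M. smooth_on (\<phi> \<circ> \<gamma>) (J \<inter> \<gamma> -` U)))"

definition first_order_contact ::
  "('a, 'n::finite) manifold \<Rightarrow> real \<Rightarrow> (real \<Rightarrow> 'a) \<Rightarrow> (real \<Rightarrow> 'a) \<Rightarrow> bool" where
  "first_order_contact M s \<gamma> \<delta> \<longleftrightarrow> \<gamma> s = \<delta> s \<and>
     (\<forall>(U, \<phi>)\<in>snd M. \<gamma> s \<in> U \<longrightarrow>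
        vector_derivative (\<phi> \<circ> \<gamma>) (at s) = vector_derivative (\<phi> \<circ> \<delta>) (at s))"

type_synonym 'a jet = "real \<times> (real \<Rightarrow> 'a) set"

definition jet_of :: "('a, 'n::finite) manifold \<Rightarrow> real \<Rightarrow> (real \<Rightarrow> 'a) \<Rightarrow> 'a jet" where
  "jet_of M s \<gamma> = (s, {\<delta>. smooth_curve_at M \<delta> s \<and> first_order_contact M s \<gamma> \<delta>})"

definition jet_space :: "('a, 'n::finite) manifold \<Rightarrow> 'a jet set" where
  "jet_space M = {jet_of M s \<gamma> | s \<gamma>. smooth_curve_at M \<gamma> s}"

definition jet_curve :: "'a jet \<Rightarrow> real \<Rightarrow> 'a" where
  "jet_curve p = (SOME \<gamma>. \<gamma> \<in> snd p)"

text \<open>A chart of the jet space is induced by a chart of the time manifold and a chart of \<open>M\<close>; the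
  local coordinates are \<open>(t, x, y)\<close> with \<open>y = dx/dt\<close>.\<close>

type_synonym ('a, 'n) jchart = "(real set \<times> (real \<Rightarrow> real)) \<times> ('a, 'n) mchart"
type_synonym 'n jcoords = "real \<times> (real ^ 'n) \<times> (real ^ 'n)"

definition jcharts :: "('a, 'n::finite) manifold \<Rightarrow> ('a, 'n) jchart set" where
  "jcharts M = time_charts \<times> snd M"

definition jdom :: "('a, 'n::finite) manifold \<Rightarrow> ('a, 'n) jchart \<Rightarrow> 'a jet set" where
  "jdom M c = {p \<in> jet_space M. fst p \<in> fst (fst c) \<and> jet_curve p (fst p) \<in> fst (snd c)}"

definition jcoord :: "('a, 'n::finite) jchart \<Rightarrow> 'a jet \<Rightarrow> 'n jcoords" where
  "jcoord = (\<lambda>((I, \<tau>), (U, \<phi>)) p.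
     (\<tau> (fst p), \<phi> (jet_curve p (fst p)),
      vector_derivative (\<lambda>t. \<phi> (jet_curve p (inv_into I \<tau> t))) (at (\<tau> (fst p)))))"

definition jinv :: "('a, 'n::finite) manifold \<Rightarrow> ('a, 'n) jchart \<Rightarrow> 'n jcoords \<Rightarrow> 'a jet" where
  "jinv M c = inv_into (jdom M c) (jcoord c)"

definition charts_at :: "('a, 'n::finite) manifold \<Rightarrow> 'a jet \<Rightarrow> ('a, 'n) jchart set" where
  "charts_at M p = {c \<in> jcharts M. p \<in> jdom M c}"

definition jet_open :: "('a, 'n::finite) manifold \<Rightarrow> 'a jet set \<Rightarrow> bool" where
  "jet_open M W \<longleftrightarrow> W \<subseteq> jet_space M \<and> (\<forall>c\<in>jcharts M. open (jcoord c ` (W \<inter> jdom M c)))"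

definition smooth_fun :: "('a, 'n::finite) manifold \<Rightarrow> 'a jet set \<Rightarrow> ('a jet \<Rightarrow> real) \<Rightarrow> bool" where
  "smooth_fun M W f \<longleftrightarrow> (\<forall>c\<in>jcharts M. smooth_on (f \<circ> jinv M c) (jcoord c ` (W \<inter> jdom M c)))"

text \<open>The Jacobian at \<open>p\<close> of the change of jet coordinates from \<open>c\<close> to \<open>c'\<close>, and its blocks, where
  \<open>(t, x, y)\<close> are the coordinates of \<open>c\<close> and \<open>(t', x', y')\<close> those of \<open>c'\<close>.\<close>

definition jac :: "('a, 'n::finite) manifold \<Rightarrow> ('a, 'n) jchart \<Rightarrow> ('a, 'n) jchart \<Rightarrow> 'a jet
    \<Rightarrow> 'n jcoords \<Rightarrow> 'n jcoords" where
  "jac M c c' p = frechet_derivative (jcoord c' \<circ> jinv M c) (at (jcoord c p))"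

definition dt'_dt :: "('a, 'n::finite) manifold \<Rightarrow> ('a, 'n) jchart \<Rightarrow> ('a, 'n) jchart \<Rightarrow> 'a jet
    \<Rightarrow> real" where
  "dt'_dt M c c' p = fst (jac M c c' p (1, 0, 0))"

definition dx'_dx :: "('a, 'n::finite) manifold \<Rightarrow> ('a, 'n) jchart \<Rightarrow> ('a, 'n) jchart \<Rightarrow> 'a jet
    \<Rightarrow> 'n \<Rightarrow> 'n \<Rightarrow> real" where
  "dx'_dx M c c' p k j = fst (snd (jac M c c' p (0, axis j 1, 0))) $ k"

definition dy'_dt :: "('a, 'n::finite) manifold \<Rightarrow> ('a, 'n) jchart \<Rightarrow> ('a, 'n) jchart \<Rightarrow> 'a jet
    \<Rightarrow> 'n \<Rightarrow> real" where
  "dy'_dt M c c' p k = snd (snd (jac M c c' p (1, 0, 0))) $ k"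

definition dy'_dx :: "('a, 'n::finite) manifold \<Rightarrow> ('a, 'n) jchart \<Rightarrow> ('a, 'n) jchart \<Rightarrow> 'a jet
    \<Rightarrow> 'n \<Rightarrow> 'n \<Rightarrow> real" where
  "dy'_dx M c c' p k i = snd (snd (jac M c c' p (0, axis i 1, 0))) $ k"

section \<open>Tangent vectors, vector fields, Lie bracket\<close>

text \<open>A tangent vector of the jet space at \<open>p\<close> is the family of its components in the jet charts
  around \<open>p\<close>, which transform by the Jacobian; the entries at all other charts are set to 0, so that
  equality of families is equality of tangent vectors. Vector fields are set to 0 off the jet space
  for the same reason.\<close>

type_synonym ('a, 'n) tvec = "('a, 'n) jchart \<Rightarrow> 'n jcoords"
type_synonym ('a, 'n) vfield = "'a jet \<Rightarrow> ('a, 'n) tvec"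

definition tangent_space :: "('a, 'n::finite) manifold \<Rightarrow> 'a jet \<Rightarrow> ('a, 'n) tvec set" where
  "tangent_space M p = {v.
     (\<forall>c\<in>charts_at M p. \<forall>c'\<in>charts_at M p. v c' = jac M c c' p (v c)) \<and>
     (\<forall>c. c \<notin> charts_at M p \<longrightarrow> v c = 0)}"

definition vector_fields :: "('a, 'n::finite) manifold \<Rightarrow> ('a, 'n) vfield set" where
  "vector_fields M = {X.
     (\<forall>p\<in>jet_space M. X p \<in> tangent_space M p) \<and>
     (\<forall>p. p \<notin> jet_space M \<longrightarrow> X p = (\<lambda>c. 0)) \<and>
     (\<forall>c\<in>jcharts M. smooth_on (\<lambda>z. X (jinv M c z) c) (jcoord c ` jdom M c))}"

text \<open>The tangent vector at \<open>p\<close> whose components in the chart \<open>c\<close> are \<open>w\<close>.\<close>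

definition tvec_of :: "('a, 'n::finite) manifold \<Rightarrow> ('a, 'n) jchart \<Rightarrow> 'a jet \<Rightarrow> 'n jcoords
    \<Rightarrow> ('a, 'n) tvec" where
  "tvec_of M c p w = (\<lambda>c'. if c' \<in> charts_at M p then jac M c c' p w else 0)"

text \<open>\<open>(X f)(p)\<close>, computed in a chart \<open>c\<close> around \<open>p\<close>.\<close>

definition vf_apply :: "('a, 'n::finite) manifold \<Rightarrow> ('a, 'n) jchart \<Rightarrow> ('a, 'n) vfield
    \<Rightarrow> ('a jet \<Rightarrow> real) \<Rightarrow> 'a jet \<Rightarrow> real" where
  "vf_apply M c X f p = frechet_derivative (f \<circ> jinv M c) (at (jcoord c p)) (X p c)"

text \<open>In every chart, the components of the bracket are \<open>X(Y\<^sup>a) - Y(X\<^sup>a)\<close>.\<close>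

definition lie_bracket :: "('a, 'n::finite) manifold \<Rightarrow> ('a, 'n) vfield \<Rightarrow> ('a, 'n) vfield
    \<Rightarrow> ('a, 'n) vfield" where
  "lie_bracket M X Y = (\<lambda>p c. if c \<in> charts_at M p then
       frechet_derivative (\<lambda>z. Y (jinv M c z) c) (at (jcoord c p)) (X p c)
     - frechet_derivative (\<lambda>z. X (jinv M c z) c) (at (jcoord c p)) (Y p c)
     else 0)"

section \<open>Nonlinear connections and the adapted basis\<close>

text \<open>\<open>fst \<Gamma> c p k\<close> is \<open>M\<close> with upper index \<open>k\<close>, and \<open>snd \<Gamma> c p k l\<close> is \<open>N\<close> with upper index \<open>k\<close> and
  lower index \<open>l\<close>, in the chart \<open>c\<close> at the point \<open>p\<close>.\<close>

type_synonym ('a, 'n) nlconn =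
  "(('a, 'n) jchart \<Rightarrow> 'a jet \<Rightarrow> 'n \<Rightarrow> real) \<times> (('a, 'n) jchart \<Rightarrow> 'a jet \<Rightarrow> 'n \<Rightarrow> 'n \<Rightarrow> real)"

definition nonlinear_connection :: "('a, 'n::finite) manifold \<Rightarrow> ('a, 'n) nlconn \<Rightarrow> bool" where
  "nonlinear_connection M \<Gamma> \<longleftrightarrow>
     (\<forall>c\<in>jcharts M. \<forall>k l. smooth_fun M (jdom M c) (\<lambda>p. fst \<Gamma> c p k) \<and>
                          smooth_fun M (jdom M c) (\<lambda>p. snd \<Gamma> c p k l)) \<and>
     (\<forall>c\<in>jcharts M. \<forall>c'\<in>jcharts M. \<forall>p\<in>jdom M c \<inter> jdom M c'. \<forall>k l.
        fst \<Gamma> c' p k =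
          (\<Sum>j\<in>UNIV. fst \<Gamma> c p j * (dt'_dt M c' c p)\<^sup>2 * dx'_dx M c c' p k j)
          - dt'_dt M c' c p * dy'_dt M c c' p k \<and>
        snd \<Gamma> c' p k l =
          (\<Sum>i\<in>UNIV. \<Sum>j\<in>UNIV. snd \<Gamma> c p j i * dt'_dt M c' c p
              * dx'_dx M c' c p i l * dx'_dx M c c' p k j)
          - (\<Sum>i\<in>UNIV. dx'_dx M c' c p i l * dy'_dx M c c' p k i))"

definition delta_t :: "('a, 'n::finite) manifold \<Rightarrow> ('a, 'n) nlconn \<Rightarrow> ('a, 'n) jchart
    \<Rightarrow> ('a, 'n) vfield" where
  "delta_t M \<Gamma> c = (\<lambda>p. tvec_of M c p (1, 0, - (\<chi> j. fst \<Gamma> c p j)))"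

definition delta_x :: "('a, 'n::finite) manifold \<Rightarrow> ('a, 'n) nlconn \<Rightarrow> ('a, 'n) jchart
    \<Rightarrow> 'n \<Rightarrow> ('a, 'n) vfield" where
  "delta_x M \<Gamma> c i = (\<lambda>p. tvec_of M c p (0, axis i 1, - (\<chi> j. snd \<Gamma> c p j i)))"

definition partial_y :: "('a, 'n::finite) manifold \<Rightarrow> ('a, 'n) jchart \<Rightarrow> 'n \<Rightarrow> ('a, 'n) vfield" where
  "partial_y M c i = (\<lambda>p. tvec_of M c p (0, 0, axis i 1))"

text \<open>The projections: with \<open>X = (a, b, w)\<close> in the natural basis of a chart, the coefficients of \<open>X\<close>
  along the horizontal part of the adapted basis are again \<open>a\<close> and \<open>b\<close>, because only those basis
  vectors have components along the partial derivatives with respect to \<open>t\<close> and \<open>x\<close>; the rest of \<open>X\<close>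
  is vertical.\<close>

definition proj_R :: "('a, 'n::finite) manifold \<Rightarrow> ('a, 'n) nlconn \<Rightarrow> ('a, 'n) vfield
    \<Rightarrow> ('a, 'n) vfield" where
  "proj_R M \<Gamma> X = (\<lambda>p c. fst (X p c) *\<^sub>R delta_t M \<Gamma> c p c)"

definition proj_M :: "('a, 'n::finite) manifold \<Rightarrow> ('a, 'n) nlconn \<Rightarrow> ('a, 'n) vfield
    \<Rightarrow> ('a, 'n) vfield" where
  "proj_M M \<Gamma> X = (\<lambda>p c. \<Sum>i\<in>UNIV. (fst (snd (X p c)) $ i) *\<^sub>R delta_x M \<Gamma> c i p c)"

definition proj_v :: "('a, 'n::finite) manifold \<Rightarrow> ('a, 'n) nlconn \<Rightarrow> ('a, 'n) vfield
    \<Rightarrow> ('a, 'n) vfield" where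
  "proj_v M \<Gamma> X = (\<lambda>p c. X p c - proj_R M \<Gamma> X p c - proj_M M \<Gamma> X p c)"

section \<open>Linear connections and curvature\<close>

definition linear_connection :: "('a, 'n::finite) manifold
    \<Rightarrow> (('a, 'n) vfield \<Rightarrow> ('a, 'n) vfield \<Rightarrow> ('a, 'n) vfield) \<Rightarrow> bool" where
  "linear_connection M nab \<longleftrightarrow>
     (\<forall>X\<in>vector_fields M. \<forall>Y\<in>vector_fields M. nab X Y \<in> vector_fields M) \<and>
     (\<forall>X\<in>vector_fields M. \<forall>Y\<in>vector_fields M. \<forall>Z\<in>vector_fields M.
        nab (\<lambda>p c. X p c + Y p c) Z = (\<lambda>p c. nab X Z p c + nab Y Z p c) \<and>
        nab X (\<lambda>p c. Y p c + Z p c) = (\<lambda>p c. nab X Y p c + nab X Z p c)) \<and>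
     (\<forall>f. smooth_fun M (jet_space M) f \<longrightarrow>
        (\<forall>X\<in>vector_fields M. \<forall>Y\<in>vector_fields M.
           nab (\<lambda>p c. f p *\<^sub>R X p c) Y = (\<lambda>p c. f p *\<^sub>R nab X Y p c) \<and>
           nab X (\<lambda>p c. f p *\<^sub>R Y p c) =
             (\<lambda>p c. f p *\<^sub>R nab X Y p c + vf_apply M c X f p *\<^sub>R Y p c)))"

definition Gamma_linear_connection :: "('a, 'n::finite) manifold \<Rightarrow> ('a, 'n) nlconn
    \<Rightarrow> (('a, 'n) vfield \<Rightarrow> ('a, 'n) vfield \<Rightarrow> ('a, 'n) vfield) \<Rightarrow> bool" where
  "Gamma_linear_connection M \<Gamma> nab \<longleftrightarrow> linear_connection M nab \<and>
     (\<forall>h\<in>{proj_R M \<Gamma>, proj_M M \<Gamma>, proj_v M \<Gamma>}.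
        \<forall>X\<in>vector_fields M. \<forall>Y\<in>vector_fields M. nab X (h Y) = h (nab X Y))"

definition curvature :: "('a, 'n::finite) manifold
    \<Rightarrow> (('a, 'n) vfield \<Rightarrow> ('a, 'n) vfield \<Rightarrow> ('a, 'n) vfield)
    \<Rightarrow> ('a, 'n) vfield \<Rightarrow> ('a, 'n) vfield \<Rightarrow> ('a, 'n) vfield \<Rightarrow> ('a, 'n) vfield" where
  "curvature M nab X Y Z =
     (\<lambda>p c. nab X (nab Y Z) p c - nab Y (nab X Z) p c - nab (lie_bracket M X Y) Z p c)"

text \<open>The adapted basis is only defined on a chart domain. As usual, a linear connection is applied
  to local vector fields by locality: the value at \<open>p\<close> is computed with any global fields that
  coincide with the given ones near \<open>p\<close>.\<close>

definition eq_near :: "('a, 'n::finite) manifold \<Rightarrow> 'a jet \<Rightarrow> ('a, 'n) vfield \<Rightarrow> ('a, 'n) vfield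
    \<Rightarrow> bool" where
  "eq_near M p X Y \<longleftrightarrow> (\<exists>W. jet_open M W \<and> p \<in> W \<and> (\<forall>q\<in>W. X q = Y q))"

definition localize :: "('a, 'n::finite) manifold
    \<Rightarrow> (('a, 'n) vfield \<Rightarrow> ('a, 'n) vfield \<Rightarrow> ('a, 'n) vfield)
    \<Rightarrow> ('a, 'n) vfield \<Rightarrow> ('a, 'n) vfield \<Rightarrow> ('a, 'n) vfield" where
  "localize M nab X Y = (\<lambda>p. THE v. \<forall>X'\<in>vector_fields M. \<forall>Y'\<in>vector_fields M.
     eq_near M p X' X \<and> eq_near M p Y' Y \<longrightarrow> nab X' Y' p = v)"

section \<open>d-tensors\<close>

text \<open>The kinds of indices of a d-tensor. A vertical contravariant slot stands for a pair of an upper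
  \<open>(j)\<close> and a lower \<open>(1)\<close>, a vertical covariant slot for a pair of a lower \<open>(l)\<close> and an upper \<open>(1)\<close>.
  The index value \<open>None\<close> is the time index 1.\<close>

datatype slot = Time_up | Time_down | Space_up | Space_down | Vert_up | Vert_down

fun slot_range :: "slot \<Rightarrow> 'n option set" where
  "slot_range Time_up = {None}"
| "slot_range Time_down = {None}"
| "slot_range _ = range Some"

definition index_set :: "slot list \<Rightarrow> 'n option list set" where
  "index_set ks = listset (map slot_range ks)"

type_synonym ('a, 'n) local_comps = "('a, 'n) jchart \<Rightarrow> 'a jet \<Rightarrow> 'n option list \<Rightarrow> real"

text \<open>The factor by which one slot contributes to the expression of the components in \<open>c\<close> (index
  value \<open>a\<close>) through those in \<open>c'\<close> (index value \<open>b\<close>).\<close>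

fun slot_factor :: "('a, 'n::finite) manifold \<Rightarrow> ('a, 'n) jchart \<Rightarrow> ('a, 'n) jchart \<Rightarrow> 'a jet
    \<Rightarrow> slot \<Rightarrow> 'n option \<Rightarrow> 'n option \<Rightarrow> real" where
  "slot_factor M c c' p Time_up a b = dt'_dt M c' c p"
| "slot_factor M c c' p Time_down a b = dt'_dt M c c' p"
| "slot_factor M c c' p Space_up a b = dx'_dx M c' c p (the a) (the b)"
| "slot_factor M c c' p Space_down a b = dx'_dx M c c' p (the b) (the a)"
| "slot_factor M c c' p Vert_up a b = dx'_dx M c' c p (the a) (the b) * dt'_dt M c c' p"
| "slot_factor M c c' p Vert_down a b = dx'_dx M c c' p (the b) (the a) * dt'_dt M c' c p"

definition d_tensor :: "('a, 'n::finite) manifold \<Rightarrow> slot list \<Rightarrow> ('a, 'n) local_comps \<Rightarrow> bool" where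
  "d_tensor M ks D \<longleftrightarrow>
     (\<forall>c\<in>jcharts M. \<forall>a\<in>index_set ks. smooth_fun M (jdom M c) (\<lambda>p. D c p a)) \<and>
     (\<forall>c\<in>jcharts M. \<forall>c'\<in>jcharts M. \<forall>p\<in>jdom M c \<inter> jdom M c'. \<forall>a\<in>index_set ks.
        D c p a = (\<Sum>b\<in>index_set ks. D c' p b *
                     (\<Prod>m<length ks. slot_factor M c c' p (ks ! m) (a ! m) (b ! m))))"

section \<open>The adapted components of the curvature\<close>

text \<open>The suffix \<open>bar\<close>, \<open>x\<close>, \<open>y\<close> says whether the last argument of the curvature is the time,
  spatial or vertical part of the adapted basis. \<open>Rt\<close>, \<open>Rx\<close>, \<open>Pt\<close>, \<open>Px\<close>, \<open>S\<close> stand for the components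
  R with lower indices 1k, R with lower indices jk, P with lower indices 1(k), P with lower indices
  j(k), and S. Indices are listed in the order: upper index of the first pair, lower index of the
  first pair, then the remaining two.\<close>

record ('a, 'n) curv_comps =
  Rt_bar :: "('a, 'n::finite) local_comps"
  Rt_x :: "('a, 'n) local_comps"
  Rt_y :: "('a, 'n) local_comps"
  Rx_bar :: "('a, 'n) local_comps"
  Rx_x :: "('a, 'n) local_comps"
  Rx_y :: "('a, 'n) local_comps"
  Pt_bar :: "('a, 'n) local_comps"
  Pt_x :: "('a, 'n) local_comps"
  Pt_y :: "('a, 'n) local_comps"
  Px_bar :: "('a, 'n) local_comps"
  Px_x :: "('a, 'n) local_comps"
  Px_y :: "('a, 'n) local_comps"
  S_bar :: "('a, 'n) local_comps"
  S_x :: "('a, 'n) local_comps"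
  S_y :: "('a, 'n) local_comps"

definition typed_comps :: "('a, 'n::finite) curv_comps \<Rightarrow> (slot list \<times> ('a, 'n) local_comps) list" where
  "typed_comps K =
    [([Time_up, Time_down, Time_down, Space_down], Rt_bar K),
     ([Space_up, Space_down, Time_down, Space_down], Rt_x K),
     ([Vert_up, Vert_down, Time_down, Space_down], Rt_y K),
     ([Time_up, Time_down, Space_down, Space_down], Rx_bar K),
     ([Space_up, Space_down, Space_down, Space_down], Rx_x K),
     ([Vert_up, Vert_down, Space_down, Space_down], Rx_y K),
     ([Time_up, Time_down, Time_down, Vert_down], Pt_bar K),
     ([Space_up, Space_down, Time_down, Vert_down], Pt_x K),
     ([Vert_up, Vert_down, Time_down, Vert_down], Pt_y K),
     ([Time_up, Time_down, Space_down, Vert_down], Px_bar K),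
     ([Space_up, Space_down, Space_down, Vert_down], Px_x K),
     ([Vert_up, Vert_down, Space_down, Vert_down], Px_y K),
     ([Time_up, Time_down, Vert_down, Vert_down], S_bar K),
     ([Space_up, Space_down, Vert_down, Vert_down], S_x K),
     ([Vert_up, Vert_down, Vert_down, Vert_down], S_y K)]"

definition curvature_relations :: "('a, 'n::finite) manifold \<Rightarrow> ('a, 'n) nlconn
    \<Rightarrow> (('a, 'n) vfield \<Rightarrow> ('a, 'n) vfield \<Rightarrow> ('a, 'n) vfield) \<Rightarrow> ('a, 'n) curv_comps \<Rightarrow> bool" where
  "curvature_relations M \<Gamma> nab K \<longleftrightarrow>
    (\<forall>c\<in>jcharts M. \<forall>p\<in>jdom M c. \<forall>i j k.
      let \<R> = (\<lambda>X Y Z. curvature M (localize M nab) X Y Z p);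
          \<delta>t = delta_t M \<Gamma> c; \<delta>x = delta_x M \<Gamma> c; dy = partial_y M c
      in
       \<R> \<delta>t \<delta>t \<delta>t = (\<lambda>_. 0) \<and>
       \<R> \<delta>t \<delta>t (\<delta>x i) = (\<lambda>_. 0) \<and>
       \<R> \<delta>t \<delta>t (dy i) = (\<lambda>_. 0) \<and>

       \<R> (\<delta>x k) \<delta>t \<delta>t = (\<lambda>b. Rt_bar K c p [None, None, None, Some k] *\<^sub>R \<delta>t p b) \<and>
       \<R> (\<delta>x k) \<delta>t (\<delta>x i) =
         (\<lambda>b. \<Sum>l\<in>UNIV. Rt_x K c p [Some l, Some i, None, Some k] *\<^sub>R \<delta>x l p b) \<and>
       \<R> (\<delta>x k) \<delta>t (dy i) =
         (\<lambda>b. \<Sum>l\<in>UNIV. Rt_y K c p [Some l, Some i, None, Some k] *\<^sub>R dy l p b) \<and>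

       \<R> (\<delta>x k) (\<delta>x j) \<delta>t = (\<lambda>b. Rx_bar K c p [None, None, Some j, Some k] *\<^sub>R \<delta>t p b) \<and>
       \<R> (\<delta>x k) (\<delta>x j) (\<delta>x i) =
         (\<lambda>b. \<Sum>l\<in>UNIV. Rx_x K c p [Some l, Some i, Some j, Some k] *\<^sub>R \<delta>x l p b) \<and>
       \<R> (\<delta>x k) (\<delta>x j) (dy i) =
         (\<lambda>b. \<Sum>l\<in>UNIV. Rx_y K c p [Some l, Some i, Some j, Some k] *\<^sub>R dy l p b) \<and>

       \<R> (dy k) \<delta>t \<delta>t = (\<lambda>b. Pt_bar K c p [None, None, None, Some k] *\<^sub>R \<delta>t p b) \<and>
       \<R> (dy k) \<delta>t (\<delta>x i) =
         (\<lambda>b. \<Sum>l\<in>UNIV. Pt_x K c p [Some l, Some i, None, Some k] *\<^sub>R \<delta>x l p b) \<and>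
       \<R> (dy k) \<delta>t (dy i) =
         (\<lambda>b. \<Sum>l\<in>UNIV. Pt_y K c p [Some l, Some i, None, Some k] *\<^sub>R dy l p b) \<and>

       \<R> (dy k) (\<delta>x j) \<delta>t = (\<lambda>b. Px_bar K c p [None, None, Some j, Some k] *\<^sub>R \<delta>t p b) \<and>
       \<R> (dy k) (\<delta>x j) (\<delta>x i) =
         (\<lambda>b. \<Sum>l\<in>UNIV. Px_x K c p [Some l, Some i, Some j, Some k] *\<^sub>R \<delta>x l p b) \<and>
       \<R> (dy k) (\<delta>x j) (dy i) =
         (\<lambda>b. \<Sum>l\<in>UNIV. Px_y K c p [Some l, Some i, Some j, Some k] *\<^sub>R dy l p b) \<and>

       \<R> (dy k) (dy j) \<delta>t = (\<lambda>b. S_bar K c p [None, None, Some j, Some k] *\<^sub>R \<delta>t p b) \<and>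
       \<R> (dy k) (dy j) (\<delta>x i) =
         (\<lambda>b. \<Sum>l\<in>UNIV. S_x K c p [Some l, Some i, Some j, Some k] *\<^sub>R \<delta>x l p b) \<and>
       \<R> (dy k) (dy j) (dy i) =
         (\<lambda>b. \<Sum>l\<in>UNIV. S_y K c p [Some l, Some i, Some j, Some k] *\<^sub>R dy l p b))"

text \<open>Equality of the local components at all charts, points and index values where they have a
  meaning.\<close>

definition same_comps :: "('a, 'n::finite) manifold \<Rightarrow> ('a, 'n) curv_comps \<Rightarrow> ('a, 'n) curv_comps
    \<Rightarrow> bool" where
  "same_comps M K K' \<longleftrightarrow>
     (\<forall>m<length (typed_comps K). \<forall>c\<in>jcharts M. \<forall>p\<in>jdom M c.
        \<forall>a\<in>index_set (fst (typed_comps K ! m)).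
          snd (typed_comps K ! m) c p a = snd (typed_comps K' ! m) c p a)"

end

theory Submission
  imports Defs
begin

text \<open>The argument has an algebraic half and an analytic half.

Algebra. The curvature of a linear connection is linear over the smooth functions in each of its
three arguments. Hence its value at a jet depends only on the values of the arguments at that jet
(\<open>tensorial_pointwise\<close>), and it is a trilinear map \<open>curv_at\<close> on each tangent space. Since the
connection commutes with the three projections, \<open>R(X, Y)\<close> maps each of the three summands of the
tangent space into itself (\<open>curv_at_frame_block\<close>); so \<open>R(X, Y)\<close> applied to a vector of the adapted
frame is a combination of frame vectors of the same kind. The curvature is antisymmetric in \<open>X\<close> and
\<open>Y\<close>: the pair \<open>(\<delta>/\<delta>t, \<delta>/\<delta>t)\<close> gives zero, and up to order there remain five pairs of kinds for \<open>X\<close>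
and \<open>Y\<close>. With three kinds for the last argument they make the fifteen families of components.
The transformation laws of \<open>\<Gamma>\<close> say exactly that the adapted frame changes from one chart to another
by the block diagonal factors of a d-tensor (\<open>frame_transform\<close>), so trilinearity turns the
components into d-tensors. They are unique because the frame is a basis, and they determine the
curvature by trilinearity and antisymmetry.

Analysis. A connection acts on global vector fields, whereas the adapted frame lives on the domain
of a chart. The passage between the two rests on bump functions on the jet space. They exist because
the jet space is a Hausdorff manifold: the jet coordinates are bijections onto open sets
(\<open>jcoord_inj\<close>, \<open>jcoord_overlap_image\<close>), the changes of coordinates are smooth
(\<open>transition_smooth\<close>), and compact sets inside a chart are closed (\<open>compact_image_closed\<close>).
Bump functions give local extensions of the frame, the locality of the connection and the
pointwise nature of tensorial maps. The symmetry of second derivatives enters twice: the bracket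
of two vector fields transforms as a vector field, and \<open>[X, Y] f = X (Y f) - Y (X f)\<close>.\<close>

section \<open>Calculus of smooth maps\<close>

abbreviation FD :: "('a::real_normed_vector \<Rightarrow> 'b::real_normed_vector) \<Rightarrow> 'a \<Rightarrow> 'a \<Rightarrow> 'b" where
  "FD f x \<equiv> frechet_derivative f (at x)"

lemma FD_eqI: "(f has_derivative f') (at x) \<Longrightarrow> FD f x = f'"
  by (metis frechet_derivative_at)

lemma FD_has: "f differentiable (at x) \<Longrightarrow> (f has_derivative FD f x) (at x)"
  by (simp add: frechet_derivative_works)

lemma FD_cong_open:
  assumes "open S" "x \<in> S" "\<And>y. y \<in> S \<Longrightarrow> f y = g y"
  shows "FD f x = FD g x"
proof -
  have "(f has_derivative D) (at x) \<longleftrightarrow> (g has_derivative D) (at x)" for D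
    using has_derivative_transform_within_open[OF _ assms(1,2)] assms(3) by (metis (no_types, lifting))
  then show ?thesis
    unfolding frechet_derivative_def by presburger
qed

lemma Ck_on_subset: "Ck_on k f S \<Longrightarrow> T \<subseteq> S \<Longrightarrow> Ck_on k f T"
  by (induction k arbitrary: f) (auto intro: continuous_on_subset)

text \<open>The hypothesis that the set is open makes the values outside it irrelevant to the derivatives.\<close>

lemma Ck_on_cong:
  assumes "open S" "\<And>x. x \<in> S \<Longrightarrow> f x = g x" "Ck_on k f S"
  shows "Ck_on k g S"
  using assms(2,3)
proof (induction k arbitrary: f g)
  case 0
  then show ?case by (metis Ck_on.simps(1) continuous_on_cong)
next
  case (Suc k)
  have "FD g x = FD f x" if "x \<in> S" for x
    using FD_cong_open[OF assms(1) that, of g f] Suc.prems(1) by metis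
  moreover have "g differentiable (at x)" if "x \<in> S" for x
  proof -
    have "(f has_derivative FD f x) (at x)"
      using Suc.prems(2) that by (simp add: FD_has)
    then show ?thesis
      using has_derivative_transform_within_open[OF _ assms(1) that] Suc.prems(1)
        differentiableI by metis
  qed
  ultimately show ?case
    using Suc by (auto intro!: Suc.IH[of "\<lambda>x. FD f x v" "\<lambda>x. FD g x v" for v])
qed

lemma Ck_on_SucD: "Ck_on (Suc k) f S \<Longrightarrow> Ck_on k f S"
proof (induction k arbitrary: f)
  case 0
  then show ?case
    by (metis Ck_on.simps differentiable_imp_continuous_within continuous_at_imp_continuous_on)
next
  case (Suc k)
  then show ?case by (metis Ck_on.simps(2))
qed

lemma Ck_on_local:
  assumes "\<And>x. x \<in> S \<Longrightarrow> \<exists>T. open T \<and> x \<in> T \<and> Ck_on k f T"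
  shows "Ck_on k f S"
  using assms
proof (induction k arbitrary: f)
  case 0
  then show ?case
    by (metis Ck_on.simps(1) continuous_at_imp_continuous_on continuous_on_eq_continuous_at)
next
  case (Suc k)
  show ?case
    unfolding Ck_on.simps
  proof (intro conjI ballI allI)
    show "f differentiable (at x)" if "x \<in> S" for x
      using Suc.prems[OF that] by auto
    show "Ck_on k (\<lambda>x. FD f x v) S" for v
      using Suc.prems by (intro Suc.IH) (metis Ck_on.simps(2))
  qed
qed

lemma Ck_on_const: "Ck_on k (\<lambda>x. c) S"
  by (induction k arbitrary: c) auto

lemma Ck_on_add: "Ck_on k f S \<Longrightarrow> Ck_on k g S \<Longrightarrow> open S \<Longrightarrow> Ck_on k (\<lambda>x. f x + g x) S"
proof (induction k arbitrary: f g)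
  case 0
  then show ?case by (auto intro: continuous_on_add)
next
  case (Suc k)
  have D: "((\<lambda>x. f x + g x) has_derivative (\<lambda>v. FD f x v + FD g x v)) (at x)" if "x \<in> S" for x
    using Suc.prems that by (auto intro!: has_derivative_add FD_has)
  have "Ck_on k (\<lambda>x. FD f x v + FD g x v) S" for v
    by (rule Suc.IH) (use Suc.prems in auto)
  then have "Ck_on k (\<lambda>x. FD (\<lambda>x. f x + g x) x v) S" for v
    by (rule Ck_on_cong[OF \<open>open S\<close>, rotated]) (auto simp: FD_eqI[OF D])
  then show ?case
    using D by (auto intro: differentiableI)
qed

lemma Ck_on_sum:
  assumes "open S" "\<And>i. i \<in> I \<Longrightarrow> Ck_on k (f i) S"
  shows "Ck_on k (\<lambda>x. \<Sum>i\<in>I. f i x) S"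
  using assms(2)
  by (induction I rule: infinite_finite_induct) (auto intro!: Ck_on_const Ck_on_add assms(1))

lemma Ck_on_bounded_linear:
  assumes L: "bounded_linear L" and "open S" "Ck_on k f S"
  shows "Ck_on k (\<lambda>x. L (f x)) S"
  using assms(3)
proof (induction k arbitrary: f)
  case 0
  then show ?case using L by (auto intro: bounded_linear.continuous_on)
next
  case (Suc k)
  have D: "((\<lambda>x. L (f x)) has_derivative (\<lambda>v. L (FD f x v))) (at x)" if "x \<in> S" for x
    using Suc.prems that by (auto intro!: bounded_linear.has_derivative[OF L] FD_has)
  have "Ck_on k (\<lambda>x. L (FD f x v)) S" for v
    by (rule Suc.IH) (use Suc.prems in auto)
  then have "Ck_on k (\<lambda>x. FD (\<lambda>x. L (f x)) x v) S" for v
    by (rule Ck_on_cong[OF \<open>open S\<close>, rotated]) (auto simp: FD_eqI[OF D])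
  then show ?case
    using D by (auto intro: differentiableI)
qed

text \<open>By the product rule the derivative is a sum of two products of the same shape, one factor of
  each being a derivative; this is why the induction runs over both maps at once.\<close>

lemma Ck_on_bounded_bilinear:
  assumes B: "bounded_bilinear B" and S: "open S" and "Ck_on k f S" "Ck_on k g S"
  shows "Ck_on k (\<lambda>x. B (f x) (g x)) S"
  using assms(3,4)
proof (induction k arbitrary: f g)
  case 0
  then show ?case using B by (auto intro: bounded_bilinear.continuous_on)
next
  case (Suc k)
  have D: "((\<lambda>x. B (f x) (g x)) has_derivative (\<lambda>v. B (f x) (FD g x v) + B (FD f x v) (g x))) (at x)"
    if "x \<in> S" for x
    using Suc.prems that by (auto intro!: bounded_bilinear.FDERIV[OF B] FD_has)
  have "Ck_on k (\<lambda>x. B (f x) (FD g x v) + B (FD f x v) (g x)) S" for v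
    by (rule Ck_on_add[OF Suc.IH Suc.IH S])
       (use Suc.prems Ck_on_SucD[OF Suc.prems(1)] Ck_on_SucD[OF Suc.prems(2)] in auto)
  then have "Ck_on k (\<lambda>x. FD (\<lambda>x. B (f x) (g x)) x v) S" for v
    by (rule Ck_on_cong[OF S, rotated]) (auto simp: FD_eqI[OF D])
  then show ?case
    using D by (auto intro: differentiableI)
qed

lemma linear_Basis_expand:
  fixes L :: "'a::euclidean_space \<Rightarrow> 'b::real_vector"
  assumes "linear L"
  shows "L w = (\<Sum>b\<in>Basis. (w \<bullet> b) *\<^sub>R L b)"
  by (metis (no_types, lifting) assms euclidean_representation linear_cmul linear_sum sum.cong)

text \<open>The chain rule \<open>D(f \<circ> g)(x) v = Df(g x)(Dg(x) v)\<close> is not yet an expression to which the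
  induction hypothesis applies, because the direction of \<open>Df\<close> varies with \<open>x\<close>. Expanding the
  direction in the standard basis leaves finitely many compositions with the partial derivatives
  of \<open>f\<close>, which are of lower order.\<close>

lemma Ck_on_compose:
  fixes f :: "'b::euclidean_space \<Rightarrow> 'c::real_normed_vector" and g :: "'a::euclidean_space \<Rightarrow> 'b"
  assumes "open S" "open T" "g ` S \<subseteq> T" "Ck_on k f T" "Ck_on k g S"
  shows "Ck_on k (\<lambda>x. f (g x)) S"
  using assms(4,5)
proof (induction k arbitrary: f)
  case 0
  then show ?case using continuous_on_compose2[OF _ _ assms(3)] by auto
next
  case (Suc k)
  have D: "((\<lambda>x. f (g x)) has_derivative (\<lambda>v. FD f (g x) (FD g x v))) (at x)" if "x \<in> S" for x
    using Suc.prems that assms(3)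
    by (auto intro!: has_derivative_compose[where f = g and g = f] FD_has)
  have "Ck_on k (\<lambda>x. \<Sum>b\<in>Basis. (FD g x v \<bullet> b) *\<^sub>R FD f (g x) b) S" for v
    by (rule Ck_on_sum[OF assms(1)], rule Ck_on_bounded_bilinear[OF bounded_bilinear_scaleR assms(1)],
        rule Ck_on_bounded_linear[OF bounded_linear_inner_left assms(1)])
       (use Suc.prems Ck_on_SucD[OF Suc.prems(2)] in \<open>auto intro: Suc.IH[of "\<lambda>y. FD f y b" for b]\<close>)
  moreover have "(\<Sum>b\<in>Basis. (FD g x v \<bullet> b) *\<^sub>R FD f (g x) b) = FD (\<lambda>x. f (g x)) x v" if "x \<in> S" for x v
    using FD_eqI[OF D[OF that]] linear_Basis_expand[of "FD f (g x)" "FD g x v"] that Suc.prems(1) assms(3)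
    by (auto simp: linear_frechet_derivative)
  ultimately have "Ck_on k (\<lambda>x. FD (\<lambda>x. f (g x)) x v) S" for v
    by (rule Ck_on_cong[OF assms(1), rotated])
  then show ?case
    using D by (auto intro: differentiableI)
qed

lemma Ck_on_bounded_linear_self:
  assumes "bounded_linear L"
  shows "Ck_on k L S"
proof (cases k)
  case 0
  then show ?thesis using assms by (simp add: linear_continuous_on)
next
  case (Suc m)
  have "FD L x = L" for x
    by (metis FD_eqI assms bounded_linear_imp_has_derivative)
  then show ?thesis
    using Suc assms by (auto simp: Ck_on_const bounded_linear_imp_differentiable)
qed

lemma Ck_on_inverse: "Ck_on k (inverse :: real \<Rightarrow> real) (- {0})"
proof (induction k)
  case 0
  then show ?case by (auto intro!: continuous_intros)
next
  case (Suc k)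
  have D: "(inverse has_derivative (\<lambda>v. - (inverse x * v * inverse x))) (at (x::real))" if "x \<noteq> 0" for x
    using that by (rule has_derivative_inverse')
  have "Ck_on k (\<lambda>x. (- v) *\<^sub>R (inverse x * inverse x)) (- {0::real})" for v :: real
    by (rule Ck_on_bounded_linear[OF bounded_linear_scaleR_right _ Ck_on_bounded_bilinear[OF bounded_bilinear_mult]])
       (auto intro: Suc)
  then have "Ck_on k (\<lambda>x. FD inverse x v) (- {0::real})" for v
    by (rule Ck_on_cong[rotated 2]) (auto simp: FD_eqI[OF D])
  then show ?case
    using D by (auto intro: differentiableI)
qed

lemma smooth_on_subset: "smooth_on f S \<Longrightarrow> T \<subseteq> S \<Longrightarrow> smooth_on f T"
  unfolding smooth_on_def using Ck_on_subset by blast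

lemma smooth_on_cong: "open S \<Longrightarrow> (\<And>x. x \<in> S \<Longrightarrow> f x = g x) \<Longrightarrow> smooth_on f S \<Longrightarrow> smooth_on g S"
  unfolding smooth_on_def using Ck_on_cong by blast

lemma smooth_on_local:
  "(\<And>x. x \<in> S \<Longrightarrow> \<exists>T. open T \<and> x \<in> T \<and> smooth_on f T) \<Longrightarrow> smooth_on f S"
  unfolding smooth_on_def by (intro allI Ck_on_local) metis

lemma smooth_on_const: "smooth_on (\<lambda>x. c) S"
  by (simp add: smooth_on_def Ck_on_const)

lemma smooth_on_add: "smooth_on f S \<Longrightarrow> smooth_on g S \<Longrightarrow> open S \<Longrightarrow> smooth_on (\<lambda>x. f x + g x) S"
  by (simp add: smooth_on_def Ck_on_add)

lemma smooth_on_sum: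
  "open S \<Longrightarrow> (\<And>i. i \<in> I \<Longrightarrow> smooth_on (f i) S) \<Longrightarrow> smooth_on (\<lambda>x. \<Sum>i\<in>I. f i x) S"
  by (simp add: smooth_on_def Ck_on_sum)

lemma smooth_on_linear_comp:
  "bounded_linear L \<Longrightarrow> smooth_on f S \<Longrightarrow> open S \<Longrightarrow> smooth_on (\<lambda>x. L (f x)) S"
  by (simp add: smooth_on_def Ck_on_bounded_linear)

lemma smooth_on_linear: "bounded_linear L \<Longrightarrow> smooth_on L S"
  by (simp add: smooth_on_def Ck_on_bounded_linear_self)

lemma smooth_on_bilinear:
  "bounded_bilinear B \<Longrightarrow> smooth_on f S \<Longrightarrow> smooth_on g S \<Longrightarrow> open S \<Longrightarrow> smooth_on (\<lambda>x. B (f x) (g x)) S"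
  by (simp add: smooth_on_def Ck_on_bounded_bilinear)

lemmas smooth_on_scaleR = smooth_on_bilinear[OF bounded_bilinear_scaleR]
lemmas smooth_on_mult = smooth_on_bilinear[OF bounded_bilinear_mult]
lemmas smooth_on_inner_left = smooth_on_linear_comp[OF bounded_linear_inner_left]

lemma smooth_on_minus: "smooth_on f S \<Longrightarrow> open S \<Longrightarrow> smooth_on (\<lambda>x. - f x) S"
  by (rule smooth_on_linear_comp[OF bounded_linear_minus[OF bounded_linear_ident]])

lemma smooth_on_diff: "smooth_on f S \<Longrightarrow> smooth_on g S \<Longrightarrow> open S \<Longrightarrow> smooth_on (\<lambda>x. f x - g x) S"
  using smooth_on_add[OF _ smooth_on_minus, of f S g] by simp

lemma smooth_on_Pair:
  assumes "smooth_on f S" "smooth_on g S" "open S"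
  shows "smooth_on (\<lambda>x. (f x, g x)) S"
proof -
  have 1: "bounded_linear (\<lambda>a. (a, 0))" "bounded_linear (\<lambda>b. (0, b))"
    by (intro bounded_linear_Pair bounded_linear_ident bounded_linear_zero)+
  show ?thesis
    using smooth_on_add[OF smooth_on_linear_comp[OF 1(1) assms(1,3)] smooth_on_linear_comp[OF 1(2) assms(2,3)] assms(3)]
    by simp
qed

lemma smooth_on_fst: "smooth_on f S \<Longrightarrow> open S \<Longrightarrow> smooth_on (\<lambda>x. fst (f x)) S"
  by (rule smooth_on_linear_comp[OF bounded_linear_fst])

lemma smooth_on_snd: "smooth_on f S \<Longrightarrow> open S \<Longrightarrow> smooth_on (\<lambda>x. snd (f x)) S"
  by (rule smooth_on_linear_comp[OF bounded_linear_snd])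

lemma smooth_on_nth: "smooth_on f S \<Longrightarrow> open S \<Longrightarrow> smooth_on (\<lambda>x. f x $ i) S"
  by (rule smooth_on_linear_comp[OF bounded_linear_vec_nth])

lemma mult_delta_right: "(a::real) * (if Q then 1 else 0) = (if Q then a else 0)"
  by simp

lemma smooth_on_vec_lambda:
  fixes f :: "'a::euclidean_space \<Rightarrow> 'n::finite \<Rightarrow> real"
  assumes "\<And>i. smooth_on (\<lambda>x. f x i) S" "open S"
  shows "smooth_on (\<lambda>x. \<chi> i. f x i) S"
proof -
  have "smooth_on (\<lambda>x. \<Sum>i\<in>UNIV. f x i *\<^sub>R axis i 1) S"
    by (intro smooth_on_sum smooth_on_scaleR smooth_on_const assms)
  then show ?thesis
    by (rule smooth_on_cong[OF assms(2), rotated]) (simp add: vec_eq_iff axis_def mult_delta_right)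
qed

lemma smooth_on_compose:
  fixes f :: "'b::euclidean_space \<Rightarrow> 'c::real_normed_vector" and g :: "'a::euclidean_space \<Rightarrow> 'b"
  shows "smooth_on f T \<Longrightarrow> smooth_on g S \<Longrightarrow> g ` S \<subseteq> T \<Longrightarrow> open S \<Longrightarrow> open T \<Longrightarrow> smooth_on (\<lambda>x. f (g x)) S"
  by (simp add: smooth_on_def Ck_on_compose)

lemma smooth_on_inverse:
  fixes f :: "'a::euclidean_space \<Rightarrow> real"
  assumes "smooth_on f S" "open S" "\<And>x. x \<in> S \<Longrightarrow> f x \<noteq> 0"
  shows "smooth_on (\<lambda>x. inverse (f x)) S"
  by (rule smooth_on_compose[of inverse "- {0}" f])
     (use assms in \<open>auto simp: smooth_on_def Ck_on_inverse\<close>)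

lemma smooth_on_differentiable: "smooth_on f S \<Longrightarrow> x \<in> S \<Longrightarrow> f differentiable (at x)"
  unfolding smooth_on_def by (metis Ck_on.simps(2))

lemma smooth_on_continuous_on: "smooth_on f S \<Longrightarrow> continuous_on S f"
  unfolding smooth_on_def by (metis Ck_on.simps(1))

lemma smooth_on_has_derivative: "smooth_on f S \<Longrightarrow> x \<in> S \<Longrightarrow> (f has_derivative FD f x) (at x)"
  by (simp add: FD_has smooth_on_differentiable)

lemma smooth_on_FD_linear: "smooth_on f S \<Longrightarrow> x \<in> S \<Longrightarrow> linear (FD f x)"
  by (simp add: linear_frechet_derivative smooth_on_differentiable)

lemma smooth_on_FD_const: "smooth_on f S \<Longrightarrow> smooth_on (\<lambda>x. FD f x v) S"
  unfolding smooth_on_def by (metis Ck_on.simps(2))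

lemma smooth_on_FD:
  fixes f :: "'b::euclidean_space \<Rightarrow> 'c::real_normed_vector" and a w :: "'a::euclidean_space \<Rightarrow> 'b"
  assumes f: "smooth_on f T" and "smooth_on a S" "smooth_on w S" "a ` S \<subseteq> T" "open S" "open T"
  shows "smooth_on (\<lambda>x. FD f (a x) (w x)) S"
proof -
  have "smooth_on (\<lambda>x. \<Sum>b\<in>Basis. (w x \<bullet> b) *\<^sub>R FD f (a x) b) S"
    by (intro smooth_on_sum smooth_on_scaleR smooth_on_inner_left assms
        smooth_on_compose[OF smooth_on_FD_const[OF f]])
  then show ?thesis
    by (rule smooth_on_cong[OF assms(5), rotated])
       (metis assms(4) image_subset_iff linear_Basis_expand[OF smooth_on_FD_linear[OF f]])
qed

section \<open>Second derivatives and their symmetry\<close>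

lemma has_derivative_FD_const:
  fixes f :: "'a::euclidean_space \<Rightarrow> 'b::real_normed_vector"
  assumes f: "smooth_on f T" and "open T" "z \<in> T"
  shows "((\<lambda>y. FD f y v) has_derivative (\<lambda>u. \<Sum>b\<in>Basis. (v \<bullet> b) *\<^sub>R FD (\<lambda>y. FD f y b) z u)) (at z)"
proof -
  have "((\<lambda>y. \<Sum>b\<in>Basis. (v \<bullet> b) *\<^sub>R FD f y b) has_derivative
      (\<lambda>u. \<Sum>b\<in>Basis. (v \<bullet> b) *\<^sub>R FD (\<lambda>y. FD f y b) z u)) (at z)"
    using smooth_on_has_derivative[OF smooth_on_FD_const[OF f] \<open>z \<in> T\<close>]
    by (intro has_derivative_sum has_derivative_scaleR_right) auto
  then show ?thesis
    by (rule has_derivative_transform_within_open[OF _ assms(2,3)])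
       (simp add: linear_Basis_expand[OF smooth_on_FD_linear[OF f], symmetric])
qed

text \<open>The derivative of \<open>y \<mapsto> Df(y)(w y)\<close>: one term from the point, one from the direction. This is
  the formula behind the transformation law of the Lie bracket and behind \<open>X (Y f)\<close>.\<close>

lemma has_derivative_FD:
  fixes f :: "'a::euclidean_space \<Rightarrow> 'b::real_normed_vector"
  assumes f: "smooth_on f T" and "open T" "z \<in> T" and w: "(w has_derivative w') (at z)"
  shows "((\<lambda>y. FD f y (w y)) has_derivative (\<lambda>u. FD (\<lambda>y. FD f y (w z)) z u + FD f z (w' u))) (at z)"
proof -
  have "((\<lambda>y. \<Sum>b\<in>Basis. (w y \<bullet> b) *\<^sub>R FD f y b) has_derivative
      (\<lambda>u. \<Sum>b\<in>Basis. (w z \<bullet> b) *\<^sub>R FD (\<lambda>y. FD f y b) z u + (w' u \<bullet> b) *\<^sub>R FD f z b)) (at z)"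
    using smooth_on_has_derivative[OF smooth_on_FD_const[OF f] \<open>z \<in> T\<close>]
    by (intro has_derivative_sum has_derivative_scaleR has_derivative_inner_left w) auto
  then have "((\<lambda>y. FD f y (w y)) has_derivative
      (\<lambda>u. \<Sum>b\<in>Basis. (w z \<bullet> b) *\<^sub>R FD (\<lambda>y. FD f y b) z u + (w' u \<bullet> b) *\<^sub>R FD f z b)) (at z)"
    by (rule has_derivative_transform_within_open[OF _ assms(2,3)])
       (simp add: linear_Basis_expand[OF smooth_on_FD_linear[OF f], symmetric])
  moreover have "(\<Sum>b\<in>Basis. (w z \<bullet> b) *\<^sub>R FD (\<lambda>y. FD f y b) z u + (w' u \<bullet> b) *\<^sub>R FD f z b)
      = FD (\<lambda>y. FD f y (w z)) z u + FD f z (w' u)" for u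
    using FD_eqI[OF has_derivative_FD_const[OF assms(1-3), of "w z"]]
      linear_Basis_expand[OF smooth_on_FD_linear[OF f assms(3)], of "w' u"]
    by (simp add: sum.distrib)
  ultimately show ?thesis by simp
qed

text \<open>Two applications of the mean value theorem write the second difference as \<open>h\<^sup>2\<close> times the mixed
  second derivative at an intermediate point, which tends to \<open>x\<close>. The second difference is
  symmetric in \<open>u\<close> and \<open>v\<close>, and so is therefore its limit.\<close>

lemma second_difference_tendsto:
  fixes f :: "'a::euclidean_space \<Rightarrow> real"
  assumes f: "smooth_on f S" and S: "open S" "x \<in> S"
  shows "((\<lambda>h. (f (x + h *\<^sub>R u + h *\<^sub>R v) - f (x + h *\<^sub>R u) - f (x + h *\<^sub>R v) + f x) / h\<^sup>2)
     \<longlongrightarrow> FD (\<lambda>y. FD f y u) x v) (at_right 0)"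
proof (rule tendstoI)
  fix e :: real assume "e > 0"
  let ?G = "\<lambda>y. FD (\<lambda>y. FD f y u) y v"
  have Df: "(f has_derivative FD f y) (at y)" if "y \<in> S" for y
    by (rule smooth_on_has_derivative[OF f that])
  have DDf: "((\<lambda>y. FD f y u) has_derivative FD (\<lambda>y. FD f y u) y) (at y)" if "y \<in> S" for y
    by (rule smooth_on_has_derivative[OF smooth_on_FD_const[OF f] that])
  have "continuous (at x) ?G"
    using smooth_on_continuous_on[OF smooth_on_FD_const[OF smooth_on_FD_const[OF f]]] S
    by (simp add: continuous_on_eq_continuous_at)
  then obtain r1 where r1: "r1 > 0" "\<And>y. dist y x < r1 \<Longrightarrow> dist (?G y) (?G x) < e"
    using \<open>e > 0\<close> unfolding continuous_at_eps_delta by blast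
  obtain r2 where r2: "r2 > 0" "ball x r2 \<subseteq> S"
    using S openE by blast
  (* the summand 1 keeps the denominator positive when both directions vanish *)
  define d where "d = min r1 r2 / (norm u + norm v + 1)"
  have "d > 0" using r1 r2 by (simp add: d_def add_nonneg_pos)
  have near: "dist (x + s *\<^sub>R u + t *\<^sub>R v) x < min r1 r2" if "0 \<le> s" "s \<le> h" "0 \<le> t" "t \<le> h" "h < d" for s t h
  proof -
    have "norm (s *\<^sub>R u + t *\<^sub>R v) \<le> h * (norm u + norm v)"
      using that by (smt (verit, best) norm_triangle_ineq norm_scaleR mult_right_mono norm_ge_zero distrib_left)
    also have "\<dots> \<le> h * (norm u + norm v + 1)" using that by (simp add: mult_left_mono)
    also have "\<dots> < d * (norm u + norm v + 1)" using that
      by (intro mult_strict_right_mono) (auto simp: add_nonneg_pos)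
    also have "\<dots> = min r1 r2" unfolding d_def
      by (smt (verit) norm_ge_zero nonzero_eq_divide_eq)
    finally show ?thesis by (simp add: dist_norm add.assoc)
  qed
  then have inS: "x + s *\<^sub>R u + t *\<^sub>R v \<in> S" if "0 \<le> s" "s \<le> h" "0 \<le> t" "t \<le> h" "h < d" for s t h
    using r2 that by (metis dist_commute in_mono mem_ball min_less_iff_conj)
  have "dist ((f (x + h *\<^sub>R u + h *\<^sub>R v) - f (x + h *\<^sub>R u) - f (x + h *\<^sub>R v) + f x) / h\<^sup>2) (?G x) < e"
    if h: "0 < h" "h < d" for h
  proof -
    define g where "g s = f (x + s *\<^sub>R u + h *\<^sub>R v) - f (x + s *\<^sub>R u)" for s
    have "(g has_derivative (\<lambda>r. r * (FD f (x + s *\<^sub>R u + h *\<^sub>R v) u - FD f (x + s *\<^sub>R u) u))) (at s)"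
      if "0 \<le> s" "s \<le> h" for s
    proof -
      have "x + s *\<^sub>R u + h *\<^sub>R v \<in> S" "x + s *\<^sub>R u \<in> S"
        using inS[of s h h] inS[of s h 0] that h by auto
      note Ds = Df[OF this(1)] Df[OF this(2)] smooth_on_FD_linear[OF f this(1)] smooth_on_FD_linear[OF f this(2)]
      have "((\<lambda>s. x + s *\<^sub>R u + h *\<^sub>R v) has_derivative (\<lambda>r. r *\<^sub>R u)) (at s)"
        "((\<lambda>s. x + s *\<^sub>R u) has_derivative (\<lambda>r. r *\<^sub>R u)) (at s)"
        by (auto intro!: derivative_eq_intros)
      from has_derivative_diff[OF has_derivative_compose[OF this(1) Ds(1)] has_derivative_compose[OF this(2) Ds(2)]]
      show ?thesis
        unfolding g_def using Ds(3,4) by (simp add: linear_cmul right_diff_distrib)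
    qed
    then have "\<exists>z>0. z < h \<and> g h - g 0 = (h - 0) * (FD f (x + z *\<^sub>R u + h *\<^sub>R v) u - FD f (x + z *\<^sub>R u) u)"
      using h by (intro MVT2) (auto simp: has_field_derivative_def mult_commute_abs)
    then obtain \<xi> where \<xi>: "0 < \<xi>" "\<xi> < h"
      "g h - g 0 = h * (FD f (x + \<xi> *\<^sub>R u + h *\<^sub>R v) u - FD f (x + \<xi> *\<^sub>R u) u)" by auto
    define k where "k t = FD f (x + \<xi> *\<^sub>R u + t *\<^sub>R v) u" for t
    have "(k has_derivative (\<lambda>r. r * ?G (x + \<xi> *\<^sub>R u + t *\<^sub>R v))) (at t)" if "0 \<le> t" "t \<le> h" for t
    proof -
      have i: "x + \<xi> *\<^sub>R u + t *\<^sub>R v \<in> S" using inS[of \<xi> h t] that h \<xi> by auto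
      have "((\<lambda>t. x + \<xi> *\<^sub>R u + t *\<^sub>R v) has_derivative (\<lambda>r. r *\<^sub>R v)) (at t)"
        by (auto intro!: derivative_eq_intros)
      from has_derivative_compose[OF this DDf[OF i]] show ?thesis
        unfolding k_def using smooth_on_FD_linear[OF smooth_on_FD_const[OF f] i] by (simp add: linear_cmul)
    qed
    then have "\<exists>z>0. z < h \<and> k h - k 0 = (h - 0) * ?G (x + \<xi> *\<^sub>R u + z *\<^sub>R v)"
      using h by (intro MVT2) (auto simp: has_field_derivative_def mult_commute_abs)
    then obtain \<eta> where \<eta>: "0 < \<eta>" "\<eta> < h" "k h - k 0 = h * ?G (x + \<xi> *\<^sub>R u + \<eta> *\<^sub>R v)" by auto
    have "f (x + h *\<^sub>R u + h *\<^sub>R v) - f (x + h *\<^sub>R u) - f (x + h *\<^sub>R v) + f x = h\<^sup>2 * ?G (x + \<xi> *\<^sub>R u + \<eta> *\<^sub>R v)"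
      using \<xi>(3) \<eta>(3) unfolding g_def k_def by (simp add: power2_eq_square algebra_simps)
    then have "(f (x + h *\<^sub>R u + h *\<^sub>R v) - f (x + h *\<^sub>R u) - f (x + h *\<^sub>R v) + f x) / h\<^sup>2 = ?G (x + \<xi> *\<^sub>R u + \<eta> *\<^sub>R v)"
      using h by simp
    then show ?thesis
      using r1(2) near[of \<xi> h \<eta>] \<xi> \<eta> h by auto
  qed
  then show "\<forall>\<^sub>F h in at_right 0. dist ((f (x + h *\<^sub>R u + h *\<^sub>R v) - f (x + h *\<^sub>R u) - f (x + h *\<^sub>R v) + f x) / h\<^sup>2) (?G x) < e"
    unfolding eventually_at_right_field using \<open>d > 0\<close> by blast
qed

lemma FD_symmetric:
  fixes f :: "'a::euclidean_space \<Rightarrow> 'b::euclidean_space"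
  assumes f: "smooth_on f S" and S: "open S" "x \<in> S"
  shows "FD (\<lambda>y. FD f y u) x v = FD (\<lambda>y. FD f y v) x u"
proof (rule euclidean_eqI)
  fix b :: 'b assume "b \<in> Basis"
  let ?g = "\<lambda>y. f y \<bullet> b"
  have g: "smooth_on ?g S" by (rule smooth_on_inner_left[OF f S(1)])
  have 1: "FD ?g y u = FD f y u \<bullet> b" if "y \<in> S" for y u
    using FD_eqI[OF has_derivative_inner_left[OF smooth_on_has_derivative[OF f that]]] by metis
  have 2: "FD (\<lambda>y. FD ?g y u) x v = FD (\<lambda>y. FD f y u) x v \<bullet> b" for u v
  proof -
    have "FD (\<lambda>y. FD ?g y u) x = FD (\<lambda>y. FD f y u \<bullet> b) x"
      by (rule FD_cong_open[OF S]) (use 1 in auto)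
    then show ?thesis
      using FD_eqI[OF has_derivative_inner_left[OF smooth_on_has_derivative[OF smooth_on_FD_const[OF f] S(2)]]] by metis
  qed
  have sw: "(\<lambda>h. (?g (x + h *\<^sub>R v + h *\<^sub>R u) - ?g (x + h *\<^sub>R v) - ?g (x + h *\<^sub>R u) + ?g x) / h\<^sup>2)
     = (\<lambda>h. (?g (x + h *\<^sub>R u + h *\<^sub>R v) - ?g (x + h *\<^sub>R u) - ?g (x + h *\<^sub>R v) + ?g x) / h\<^sup>2)"
    by (intro ext) (simp add: algebra_simps)
  have "FD (\<lambda>y. FD ?g y u) x v = FD (\<lambda>y. FD ?g y v) x u"
    using second_difference_tendsto[OF g S, of u v] second_difference_tendsto[OF g S, of v u, unfolded sw]
    by (rule tendsto_unique[rotated]) (rule trivial_limit_at_right_real)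
  then show "FD (\<lambda>y. FD f y u) x v \<bullet> b = FD (\<lambda>y. FD f y v) x u \<bullet> b"
    by (simp add: 2)
qed

section \<open>Smooth bump functions on Euclidean space\<close>

text \<open>For \<open>P = 1\<close> this is the standard flat function \<open>exp (-1/x)\<close>. The polynomial factor makes the
  family closed under differentiation (\<open>flat_deriv\<close>), which is what smoothness at \<open>0\<close> needs.\<close>

definition flat :: "real poly \<Rightarrow> real \<Rightarrow> real" where
  "flat P x = (if x > 0 then poly P (inverse x) * exp (- inverse x) else 0)"

lemma flat_tendsto_0: "(flat P \<longlongrightarrow> 0) (at 0)"
proof -
  have "((\<lambda>y. \<Sum>i\<le>degree P. coeff P i * (y ^ i / exp y)) \<longlongrightarrow> (\<Sum>i\<le>degree P. coeff P i * 0)) at_top"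
    by (intro tendsto_intros tendsto_power_div_exp_0)
  then have "((\<lambda>y. poly P y * exp (- y)) \<longlongrightarrow> 0) at_top"
    by (simp add: poly_altdef sum_divide_distrib exp_minus divide_inverse[symmetric])
  then have "((\<lambda>x. poly P (inverse x) * exp (- inverse x)) \<longlongrightarrow> 0) (at_right 0)"
    by (rule filterlim_compose) (rule filterlim_inverse_at_top_right)
  then have "(flat P \<longlongrightarrow> 0) (at_right 0)"
    by (rule tendsto_cong[THEN iffD1, rotated])
       (auto simp: flat_def eventually_at_right_field intro!: exI[of _ 1])
  moreover have "(flat P \<longlongrightarrow> 0) (at_left 0)"
    by (rule tendsto_eventually) (auto simp: flat_def eventually_at_left_field intro!: exI[of _ "-1"])
  ultimately show ?thesis
    by (simp add: filterlim_at_split)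
qed

lemma flat_deriv:
  "(flat P has_field_derivative flat ([:0, 0, 1:] * (P - pderiv P)) x) (at x)"
proof -
  consider "x > 0" | "x < 0" | "x = 0" by linarith
  then show ?thesis
  proof cases
    case 1
    have "((\<lambda>x. poly P (inverse x) * exp (- inverse x)) has_field_derivative
        flat ([:0, 0, 1:] * (P - pderiv P)) x) (at x)"
      using 1 by (auto intro!: derivative_eq_intros DERIV_chain2[OF poly_DERIV]
          simp: flat_def algebra_simps power2_eq_square)
    then show ?thesis
      by (rule has_field_derivative_transform_within_open[where S = "{0<..}"]) (use 1 in \<open>auto simp: flat_def\<close>)
  next
    case 2
    have "((\<lambda>x. 0) has_field_derivative flat ([:0, 0, 1:] * (P - pderiv P)) x) (at x)"
      using 2 by (auto simp: flat_def)
    then show ?thesis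
      by (rule has_field_derivative_transform_within_open[where S = "{..<0}"]) (use 2 in \<open>auto simp: flat_def\<close>)
  next
    case 3
    (* the difference quotient at 0 belongs to the same family, so its limit is known *)
    have "flat P y / y = flat ([:0, 1:] * P) y" for y
      by (auto simp: flat_def field_simps)
    then have "((\<lambda>y. (flat P y - flat P 0) / (y - 0)) \<longlongrightarrow> 0) (at 0)"
      using flat_tendsto_0[of "[:0, 1:] * P"] by (simp add: flat_def[of P 0])
    then show ?thesis
      using 3 by (simp add: has_field_derivative_iff flat_def)
  qed
qed

lemma smooth_on_flat: "smooth_on (flat P) UNIV"
proof -
  have "Ck_on k (flat P) UNIV" for k
  proof (induction k arbitrary: P)
    case 0
    show ?case
      by (auto intro!: continuous_at_imp_continuous_on DERIV_isCont flat_deriv)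
  next
    case (Suc k)
    have D: "(flat P has_derivative (\<lambda>v. flat ([:0, 0, 1:] * (P - pderiv P)) x * v)) (at x)" for x
      using flat_deriv[of P x] by (simp add: has_field_derivative_def)
    have "Ck_on k (\<lambda>x. v *\<^sub>R flat ([:0, 0, 1:] * (P - pderiv P)) x) UNIV" for v :: real
      by (rule Ck_on_bounded_linear[OF bounded_linear_scaleR_right _ Suc]) simp
    then show ?case
      using D by (auto simp: FD_eqI[OF D] mult.commute intro: differentiableI)
  qed
  then show ?thesis by (simp add: smooth_on_def)
qed

text \<open>The quotient \<open>F(a) / (F(a) + F(b))\<close> with \<open>F = flat 1\<close>, where \<open>a > 0\<close> describes the ball of radius
  \<open>r\<close> and \<open>b \<le> 0\<close> the closed ball of radius \<open>r/2\<close>. The denominator never vanishes because one of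
  \<open>a\<close>, \<open>b\<close> is always positive.\<close>

lemma smooth_bump:
  fixes z0 :: "'a::euclidean_space"
  assumes "r > 0"
  obtains \<rho> :: "'a \<Rightarrow> real" where "smooth_on \<rho> UNIV" "\<And>z. z \<in> ball z0 (r/2) \<Longrightarrow> \<rho> z = 1"
    "\<And>z. z \<notin> ball z0 r \<Longrightarrow> \<rho> z = 0"
proof -
  define a where "a z = r\<^sup>2 - (z - z0) \<bullet> (z - z0)" for z
  define b where "b z = (z - z0) \<bullet> (z - z0) - r\<^sup>2/4" for z
  let ?F = "flat 1"
  have sm: "smooth_on (\<lambda>z. z - z0) UNIV"
    by (intro smooth_on_diff smooth_on_const smooth_on_linear bounded_linear_ident) auto
  have sq: "smooth_on (\<lambda>z. (z - z0) \<bullet> (z - z0)) UNIV"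
    by (rule smooth_on_bilinear[OF bounded_bilinear_inner sm sm]) simp
  have sab: "smooth_on a UNIV" "smooth_on b UNIV"
    unfolding a_def b_def by (intro smooth_on_diff smooth_on_const sq open_UNIV)+
  have sF: "smooth_on (\<lambda>z. ?F (a z)) UNIV" "smooth_on (\<lambda>z. ?F (b z)) UNIV"
    by (rule smooth_on_compose[OF smooth_on_flat]; simp add: sab)+
  have pos: "?F (a z) + ?F (b z) > 0" for z
  proof -
    have "r\<^sup>2 > 0" using assms by simp
    then have "a z > 0 \<or> b z > 0" unfolding a_def b_def by linarith
    then show ?thesis by (auto simp: flat_def add_pos_nonneg)
  qed
  show thesis
  proof
    show "smooth_on (\<lambda>z. ?F (a z) * inverse (?F (a z) + ?F (b z))) UNIV"
      by (intro smooth_on_mult smooth_on_inverse smooth_on_add sF open_UNIV)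
         (use pos in \<open>auto simp: less_le\<close>)
    show "?F (a z) * inverse (?F (a z) + ?F (b z)) = 1" if "z \<in> ball z0 (r/2)" for z
    proof -
      have "(norm (z - z0))\<^sup>2 < (r/2)\<^sup>2"
        using that by (intro power_strict_mono) (auto simp: dist_norm norm_minus_commute)
      then have "b z \<le> 0" by (simp add: b_def power2_norm_eq_inner power_divide)
      then show ?thesis using pos[of z] by (simp add: flat_def)
    qed
    show "?F (a z) * inverse (?F (a z) + ?F (b z)) = 0" if "z \<notin> ball z0 r" for z
    proof -
      have "r\<^sup>2 \<le> (norm (z - z0))\<^sup>2"
        using that assms by (intro power_mono) (auto simp: dist_norm norm_minus_commute)
      then show ?thesis by (simp add: a_def flat_def power2_norm_eq_inner)
    qed
  qed
qed

section \<open>Changes of the time coordinate\<close>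

lemma real_smooth_vector_derivative:
  assumes "smooth_on f S" "s \<in> S"
  shows "(f has_vector_derivative vector_derivative f (at s)) (at s)"
  using smooth_on_differentiable[OF assms] by (simp add: vector_derivative_works)

lemma FD_vector_derivative:
  assumes "f differentiable (at s)"
  shows "FD f s r = r *\<^sub>R vector_derivative f (at s)"
  using assms frechet_derivative_eq_vector_derivative by metis

lemma vector_derivative_cong_open:
  assumes "open S" "s \<in> S" "\<And>y. y \<in> S \<Longrightarrow> f y = g y"
  shows "vector_derivative f (at s) = vector_derivative g (at s)"
  unfolding vector_derivative_def has_vector_derivative_def
  using has_derivative_transform_within_open[OF _ assms(1,2)] assms(3)
  by (metis (no_types, lifting))

lemma vector_derivative_eq_near:
  assumes "(f has_vector_derivative d) (at s)" "open S" "s \<in> S" "\<And>y. y \<in> S \<Longrightarrow> f y = g y"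
  shows "vector_derivative g (at s) = d"
  using vector_derivative_cong_open[OF assms(2-4)] vector_derivative_at[OF assms(1)] by simp

lemma time_chartD:
  assumes "(I, \<tau>) \<in> time_charts"
  shows "open I" "inj_on \<tau> I" "open (\<tau> ` I)" "smooth_on \<tau> I" "smooth_on (inv_into I \<tau>) (\<tau> ` I)"
  using assms by (auto simp: time_charts_def)

lemma inv_into_UNIV_ident: "inv_into UNIV (\<lambda>t::real. t) = (\<lambda>t. t)"
  by (rule ext) (meson UNIV_I image_eqI f_inv_into_f)

lemma time_chart_UNIV: "(UNIV, \<lambda>t. t) \<in> time_charts"
  by (auto simp: time_charts_def inv_into_UNIV_ident intro: smooth_on_linear)

lemma time_overlap_open:
  assumes "(I, \<tau>) \<in> time_charts" "(I', \<tau>') \<in> time_charts"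
  shows "open (\<tau> ` (I \<inter> I'))"
proof -
  note c = time_chartD[OF assms(1)] and c' = time_chartD[OF assms(2)]
  have "\<tau> ` (I \<inter> I') = \<tau> ` I \<inter> inv_into I \<tau> -` I'"
    using c(2) by auto
  then show ?thesis
    using continuous_open_preimage[OF smooth_on_continuous_on[OF c(5)] c(3) c'(1)] by simp
qed

lemma time_transition_smooth:
  assumes "(I, \<tau>) \<in> time_charts" "(I', \<tau>') \<in> time_charts"
  shows "smooth_on (\<lambda>t. \<tau>' (inv_into I \<tau> t)) (\<tau> ` (I \<inter> I'))"
proof -
  note c = time_chartD[OF assms(1)] and c' = time_chartD[OF assms(2)]
  show ?thesis
    by (rule smooth_on_compose[OF c'(4) smooth_on_subset[OF c(5)] _ time_overlap_open[OF assms] c'(1)])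
       (use c(2) in auto)
qed

text \<open>With \<open>\<sigma>\<close>, \<open>\<sigma>'\<close> the inverses of two time charts, this is the chain rule for
  \<open>\<sigma> = \<sigma>' \<circ> (\<tau>' \<circ> \<sigma>)\<close>. It gives the factor \<open>dt/dt'\<close> in the change of the velocity coordinates.\<close>

lemma time_inv_derivative:
  assumes "(I, \<tau>) \<in> time_charts" "(I', \<tau>') \<in> time_charts" "s \<in> I \<inter> I'"
  shows "vector_derivative (inv_into I \<tau>) (at (\<tau> s)) =
    FD (\<lambda>t. \<tau>' (inv_into I \<tau> t)) (\<tau> s) 1 * vector_derivative (inv_into I' \<tau>') (at (\<tau>' s))"
proof -
  note c = time_chartD[OF assms(1)] and c' = time_chartD[OF assms(2)]
  let ?\<theta> = "\<lambda>t. \<tau>' (inv_into I \<tau> t)"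
  have s: "\<tau> s \<in> \<tau> ` (I \<inter> I')" "?\<theta> (\<tau> s) = \<tau>' s" using assms(3) c(2) by auto
  have \<theta>: "(?\<theta> has_vector_derivative FD ?\<theta> (\<tau> s) 1) (at (\<tau> s))"
    using real_smooth_vector_derivative[OF time_transition_smooth[OF assms(1,2)] s(1)]
      FD_vector_derivative[OF smooth_on_differentiable[OF time_transition_smooth[OF assms(1,2)] s(1)], of 1]
    by simp
  have \<sigma>: "(inv_into I' \<tau>' has_vector_derivative vector_derivative (inv_into I' \<tau>') (at (\<tau>' s))) (at (?\<theta> (\<tau> s)))"
    unfolding s(2) by (rule real_smooth_vector_derivative[OF c'(5)]) (use assms(3) in auto)
  have "((inv_into I' \<tau>' \<circ> ?\<theta>) has_vector_derivative
      FD ?\<theta> (\<tau> s) 1 * vector_derivative (inv_into I' \<tau>') (at (\<tau>' s))) (at (\<tau> s))"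
    using vector_diff_chain_at[OF \<theta> \<sigma>] by simp
  moreover have "(inv_into I' \<tau>' \<circ> ?\<theta>) t = inv_into I \<tau> t" if "t \<in> \<tau> ` (I \<inter> I')" for t
    using that c(2) c'(2) by auto
  ultimately show ?thesis
    by (rule vector_derivative_eq_near[OF _ time_overlap_open[OF assms(1,2)] s(1)])
qed

lemma time_derivative_inverse:
  assumes "(I, \<tau>) \<in> time_charts" "s \<in> I"
  shows "vector_derivative \<tau> (at s) * vector_derivative (inv_into I \<tau>) (at (\<tau> s)) = 1"
proof -
  note c = time_chartD[OF assms(1)]
  have 1: "vector_derivative (inv_into UNIV (\<lambda>t::real. t)) (at s) = 1"
    by (simp add: inv_into_UNIV_ident vector_derivative_at)
  have "FD (\<lambda>t. \<tau> (inv_into UNIV (\<lambda>t::real. t) t)) s 1 = vector_derivative \<tau> (at s)"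
    using FD_vector_derivative[OF smooth_on_differentiable[OF c(4) assms(2)], of 1]
    by (simp add: inv_into_UNIV_ident)
  then show ?thesis
    using time_inv_derivative[OF time_chart_UNIV assms(1), of s] assms(2) 1 by simp
qed

section \<open>The jet space as a Hausdorff manifold\<close>

locale jets =
  fixes M :: "('a, 'n::finite) manifold"
  assumes smooth_manifold: "smooth_manifold M"
begin

lemma manifold_facts:
  shows Hausdorff: "Hausdorff_space (fst M)"
    and manifold_chart: "\<forall>a\<in>snd M. is_chart (fst M) a"
    and manifold_cover: "\<Union> (fst ` snd M) = topspace (fst M)"
    and manifold_transition: "\<forall>a\<in>snd M. \<forall>b\<in>snd M. smooth_transition a b"
  using smooth_manifold unfolding smooth_manifold_def case_prod_beta by - ((elim conjE, assumption)+)

lemma chartD: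
  assumes "(U, \<phi>) \<in> snd M"
  shows "openin (fst M) U" "open (\<phi> ` U)"
    "homeomorphic_map (subtopology (fst M) U) (top_of_set (\<phi> ` U)) \<phi>" "inj_on \<phi> U"
proof -
  have "is_chart (fst M) (U, \<phi>)"
    using manifold_chart assms by blast
  then show 1: "openin (fst M) U" "open (\<phi> ` U)"
    "homeomorphic_map (subtopology (fst M) U) (top_of_set (\<phi> ` U)) \<phi>"
    by (auto simp: is_chart_def)
  have "U \<subseteq> topspace (fst M)" using 1(1) by (rule openin_subset)
  then show "inj_on \<phi> U"
    using homeomorphic_imp_injective_map[OF 1(3)] by (simp add: inf.absorb2)
qed

lemma charts_cover: "m \<in> topspace (fst M) \<Longrightarrow> \<exists>(U, \<phi>)\<in>snd M. m \<in> U"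
  using manifold_cover[symmetric] by force

lemma chart_inv_continuous:
  assumes "(U, \<phi>) \<in> snd M"
  shows "continuous_map (top_of_set (\<phi> ` U)) (fst M) (inv_into U \<phi>)"
proof -
  note c = chartD[OF assms]
  obtain g where g: "homeomorphic_maps (subtopology (fst M) U) (top_of_set (\<phi> ` U)) \<phi> g"
    using c(3) by (auto simp: homeomorphic_map_maps)
  have U: "topspace (subtopology (fst M) U) = U"
    using openin_subset[OF c(1)] by auto
  have "continuous_map (top_of_set (\<phi> ` U)) (subtopology (fst M) U) g"
    using g by (simp add: homeomorphic_maps_def)
  then have "continuous_map (top_of_set (\<phi> ` U)) (fst M) g"
    by (simp add: continuous_map_in_subtopology)
  moreover have "g x = inv_into U \<phi> x" if "x \<in> \<phi> ` U" for x
    using that g c(4) unfolding homeomorphic_maps_def U by auto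
  ultimately show ?thesis
    by (elim continuous_map_eq) auto
qed

lemma chart_overlap_open:
  assumes "(U, \<phi>) \<in> snd M" "(V, \<psi>) \<in> snd M"
  shows "open (\<phi> ` (U \<inter> V))"
proof -
  note c = chartD[OF assms(1)] and c' = chartD[OF assms(2)]
  have "openin (subtopology (fst M) U) (U \<inter> V)"
    using c'(1) by (auto simp: openin_subtopology)
  then have "openin (top_of_set (\<phi> ` U)) (\<phi> ` (U \<inter> V))"
    using homeomorphic_imp_open_map[OF c(3)] by (simp add: open_map_def)
  then show ?thesis
    using c(2) by (meson openin_open_trans)
qed

lemma chart_transition_smooth:
  assumes "(U, \<phi>) \<in> snd M" "(V, \<psi>) \<in> snd M"
  shows "smooth_on (\<lambda>x. \<psi> (inv_into U \<phi> x)) (\<phi> ` (U \<inter> V))"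
proof -
  have "smooth_transition (U, \<phi>) (V, \<psi>)"
    using manifold_transition assms by blast
  then show ?thesis by (simp add: smooth_transition_def comp_def)
qed

lemma smooth_curve_near:
  assumes "smooth_curve_at M \<gamma> s" "(U, \<phi>) \<in> snd M" "\<gamma> s \<in> U"
  obtains J where "open J" "s \<in> J" "\<gamma> ` J \<subseteq> U" "smooth_on (\<phi> \<circ> \<gamma>) J"
proof -
  obtain J where J: "open J" "s \<in> J" "continuous_map (top_of_set J) (fst M) \<gamma>"
    "smooth_on (\<phi> \<circ> \<gamma>) (J \<inter> \<gamma> -` U)"
    using assms unfolding smooth_curve_at_def by auto
  have "openin (top_of_set J) {r \<in> topspace (top_of_set J). \<gamma> r \<in> U}"
    by (rule openin_continuous_map_preimage[OF J(3) chartD(1)[OF assms(2)]])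
  then have "openin (top_of_set J) (J \<inter> \<gamma> -` U)"
    by (simp add: Int_def vimage_def)
  then have "open (J \<inter> \<gamma> -` U)"
    using J(1) by (meson openin_open_trans)
  then show thesis
    using that[of "J \<inter> \<gamma> -` U"] J assms(3) by auto
qed

lemma curve_differentiable:
  assumes "smooth_curve_at M \<gamma> s" "(U, \<phi>) \<in> snd M" "\<gamma> s \<in> U"
  shows "((\<phi> \<circ> \<gamma>) has_vector_derivative vector_derivative (\<phi> \<circ> \<gamma>) (at s)) (at s)"
  using smooth_curve_near[OF assms] real_smooth_vector_derivative by metis

text \<open>Curves with equal velocities in one chart have equal velocities in all charts, so first-order
  contact can be tested in a single chart.\<close>

lemma curve_velocity_transition:
  assumes "smooth_curve_at M \<gamma> s" "(U, \<phi>) \<in> snd M" "(V, \<psi>) \<in> snd M" "\<gamma> s \<in> U" "\<gamma> s \<in> V"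
  shows "vector_derivative (\<psi> \<circ> \<gamma>) (at s)
    = FD (\<lambda>x. \<psi> (inv_into U \<phi> x)) (\<phi> (\<gamma> s)) (vector_derivative (\<phi> \<circ> \<gamma>) (at s))"
proof -
  obtain J where J: "open J" "s \<in> J" "\<gamma> ` J \<subseteq> U"
    using smooth_curve_near[OF assms(1,2,4)] by metis
  let ?h = "\<lambda>x. \<psi> (inv_into U \<phi> x)"
  have "(?h has_derivative FD ?h (\<phi> (\<gamma> s))) (at ((\<phi> \<circ> \<gamma>) s))"
    using smooth_on_has_derivative[OF chart_transition_smooth[OF assms(2,3)], of "\<phi> (\<gamma> s)"] assms(4,5) by auto
  from vector_derivative_diff_chain_within[of "\<phi> \<circ> \<gamma>" _ s UNIV ?h, OF _ has_derivative_at_withinI[OF this]]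
  have "((?h \<circ> (\<phi> \<circ> \<gamma>)) has_vector_derivative FD ?h (\<phi> (\<gamma> s)) (vector_derivative (\<phi> \<circ> \<gamma>) (at s))) (at s)"
    using curve_differentiable[OF assms(1,2,4)] by simp
  moreover have "(?h \<circ> (\<phi> \<circ> \<gamma>)) r = (\<psi> \<circ> \<gamma>) r" if "r \<in> J" for r
    using J(3) that chartD(4)[OF assms(2)] by auto
  ultimately show ?thesis
    by (rule vector_derivative_eq_near[OF _ J(1,2)])
qed

lemma first_order_contact_iff:
  assumes "smooth_curve_at M \<gamma> s" "smooth_curve_at M \<delta> s" "(U, \<phi>) \<in> snd M" "\<gamma> s \<in> U"
  shows "first_order_contact M s \<gamma> \<delta> \<longleftrightarrow> \<gamma> s = \<delta> s \<and>
    vector_derivative (\<phi> \<circ> \<gamma>) (at s) = vector_derivative (\<phi> \<circ> \<delta>) (at s)"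
proof
  assume "first_order_contact M s \<gamma> \<delta>"
  then show "\<gamma> s = \<delta> s \<and> vector_derivative (\<phi> \<circ> \<gamma>) (at s) = vector_derivative (\<phi> \<circ> \<delta>) (at s)"
    using assms(3,4) unfolding first_order_contact_def by auto
next
  assume *: "\<gamma> s = \<delta> s \<and> vector_derivative (\<phi> \<circ> \<gamma>) (at s) = vector_derivative (\<phi> \<circ> \<delta>) (at s)"
  have "vector_derivative (\<psi> \<circ> \<gamma>) (at s) = vector_derivative (\<psi> \<circ> \<delta>) (at s)"
    if "(V, \<psi>) \<in> snd M" "\<gamma> s \<in> V" for V \<psi>
    using curve_velocity_transition[OF assms(1,3) that(1) assms(4) that(2)]
      curve_velocity_transition[OF assms(2,3) that(1)] assms(4) that(2) * by simp
  then show "first_order_contact M s \<gamma> \<delta>"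
    using * unfolding first_order_contact_def by auto
qed

abbreviation base_point :: "'a jet \<Rightarrow> 'a" where
  "base_point p \<equiv> jet_curve p (fst p)"

text \<open>The chosen representative of a jet need not be the curve that the jet was formed from, but it
  is in first-order contact with it, and jets only depend on contact classes.\<close>

lemma jet_curve_of:
  assumes "smooth_curve_at M \<gamma> s"
  shows "smooth_curve_at M (jet_curve (jet_of M s \<gamma>)) s"
    "first_order_contact M s \<gamma> (jet_curve (jet_of M s \<gamma>))"
proof -
  have "\<gamma> \<in> snd (jet_of M s \<gamma>)"
    using assms by (auto simp: jet_of_def first_order_contact_def)
  then have "jet_curve (jet_of M s \<gamma>) \<in> snd (jet_of M s \<gamma>)"
    unfolding jet_curve_def by (rule someI[of "\<lambda>x. x \<in> snd (jet_of M s \<gamma>)"])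
  then show "smooth_curve_at M (jet_curve (jet_of M s \<gamma>)) s"
    "first_order_contact M s \<gamma> (jet_curve (jet_of M s \<gamma>))"
    by (auto simp: jet_of_def)
qed

lemma jet_spaceD:
  assumes "p \<in> jet_space M"
  shows "smooth_curve_at M (jet_curve p) (fst p)" "jet_of M (fst p) (jet_curve p) = p"
proof -
  obtain s \<gamma> where p: "p = jet_of M s \<gamma>" "smooth_curve_at M \<gamma> s"
    using assms by (auto simp: jet_space_def)
  have s: "fst p = s" by (simp add: p jet_of_def)
  show "smooth_curve_at M (jet_curve p) (fst p)"
    using jet_curve_of[OF p(2)] by (simp add: s) (simp add: p)
  have "first_order_contact M s \<gamma> (jet_curve p)" using jet_curve_of[OF p(2)] by (simp add: p)
  then have "first_order_contact M s (jet_curve p) \<delta> \<longleftrightarrow> first_order_contact M s \<gamma> \<delta>" for \<delta>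
    unfolding first_order_contact_def case_prod_beta by metis
  then show "jet_of M (fst p) (jet_curve p) = p"
    unfolding s by (auto simp: p jet_of_def)
qed

lemma base_point_in_topspace:
  assumes "p \<in> jet_space M"
  shows "base_point p \<in> topspace (fst M)"
proof -
  obtain J where "fst p \<in> J" "continuous_map (top_of_set J) (fst M) (jet_curve p)"
    using jet_spaceD(1)[OF assms] unfolding smooth_curve_at_def by auto
  then show ?thesis
    by (simp add: continuous_map_def Pi_iff)
qed

lemma charts_at_nonempty:
  assumes "p \<in> jet_space M"
  obtains c where "c \<in> charts_at M p"
proof -
  obtain U \<phi> where "(U, \<phi>) \<in> snd M" "base_point p \<in> U"
    using charts_cover[OF base_point_in_topspace[OF assms]] by auto
  then have "((UNIV, \<lambda>t. t), (U, \<phi>)) \<in> charts_at M p"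
    using assms time_chart_UNIV by (auto simp: charts_at_def jcharts_def jdom_def)
  then show thesis by (rule that)
qed

lemma jdom_iff:
  "p \<in> jdom M ((I, \<tau>), (U, \<phi>)) \<longleftrightarrow> p \<in> jet_space M \<and> fst p \<in> I \<and> base_point p \<in> U"
  by (simp add: jdom_def)

lemma jdom_subset: "jdom M c \<subseteq> jet_space M"
  by (auto simp: jdom_def)

lemma jcoord_eq:
  assumes "(I, \<tau>) \<in> time_charts" "(U, \<phi>) \<in> snd M" "p \<in> jdom M ((I, \<tau>), (U, \<phi>))"
  shows "jcoord ((I, \<tau>), (U, \<phi>)) p = (\<tau> (fst p), \<phi> (base_point p),
    vector_derivative (inv_into I \<tau>) (at (\<tau> (fst p))) *\<^sub>R vector_derivative (\<phi> \<circ> jet_curve p) (at (fst p)))"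
proof -
  note c = time_chartD[OF assms(1)]
  have p: "p \<in> jet_space M" "fst p \<in> I" "base_point p \<in> U" using assms(3) by (auto simp: jdom_iff)
  have 1: "(inv_into I \<tau> has_vector_derivative vector_derivative (inv_into I \<tau>) (at (\<tau> (fst p)))) (at (\<tau> (fst p)))"
    by (rule real_smooth_vector_derivative[OF c(5)]) (use p in auto)
  have 2: "((\<phi> \<circ> jet_curve p) has_vector_derivative vector_derivative (\<phi> \<circ> jet_curve p) (at (fst p)))
    (at (inv_into I \<tau> (\<tau> (fst p))))"
    using curve_differentiable[OF jet_spaceD(1)[OF p(1)] assms(2) p(3)] c(2) p(2) by simp
  show ?thesis
    using vector_derivative_at[OF vector_diff_chain_at[OF 1 2]] by (simp add: jcoord_def comp_def)
qed

text \<open>The change of jet coordinates in closed form: the velocity coordinates transform by the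
  derivative of the change of coordinates on \<open>M\<close> and by \<open>dt/dt'\<close>.\<close>

definition transition :: "('a, 'n) jchart \<Rightarrow> ('a, 'n) jchart \<Rightarrow> 'n jcoords \<Rightarrow> 'n jcoords" where
  "transition = (\<lambda>((I, \<tau>), (U, \<phi>)) ((I', \<tau>'), (V, \<psi>)) z.
     (\<tau>' (inv_into I \<tau> (fst z)), \<psi> (inv_into U \<phi> (fst (snd z))),
      inverse (FD (\<lambda>t. \<tau>' (inv_into I \<tau> t)) (fst z) 1) *\<^sub>R
        FD (\<lambda>x. \<psi> (inv_into U \<phi> x)) (fst (snd z)) (snd (snd z))))"

lemma time_transition_nonzero:
  assumes "(I, \<tau>) \<in> time_charts" "(I', \<tau>') \<in> time_charts" "t \<in> \<tau> ` (I \<inter> I')"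
  shows "FD (\<lambda>t. \<tau>' (inv_into I \<tau> t)) t 1 \<noteq> 0"
proof -
  obtain s where s: "s \<in> I \<inter> I'" "t = \<tau> s" using assms(3) by auto
  then have "vector_derivative (inv_into I \<tau>) (at (\<tau> s)) \<noteq> 0"
    using time_derivative_inverse[OF assms(1), of s] by auto
  then show ?thesis using time_inv_derivative[OF assms(1,2) s(1)] s(2) by auto
qed

lemma jcoord_transition:
  assumes "c \<in> jcharts M" "c' \<in> jcharts M" "p \<in> jdom M c \<inter> jdom M c'"
  shows "jcoord c' p = transition c c' (jcoord c p)"
proof -
  obtain I \<tau> U \<phi> I' \<tau>' V \<psi> where c: "c = ((I, \<tau>), (U, \<phi>))" "c' = ((I', \<tau>'), (V, \<psi>))"
    by (metis prod.exhaust)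
  have t: "(I, \<tau>) \<in> time_charts" "(I', \<tau>') \<in> time_charts" and u: "(U, \<phi>) \<in> snd M" "(V, \<psi>) \<in> snd M"
    using assms by (auto simp: c jcharts_def)
  have p: "p \<in> jet_space M" "fst p \<in> I" "fst p \<in> I'" "base_point p \<in> U" "base_point p \<in> V"
    using assms(3) by (auto simp: c jdom_iff)
  let ?h = "\<lambda>x. \<psi> (inv_into U \<phi> x)" and ?\<theta> = "\<lambda>t. \<tau>' (inv_into I \<tau> t)"
  have nz: "FD ?\<theta> (\<tau> (fst p)) 1 \<noteq> 0"
    by (rule time_transition_nonzero[OF t]) (use p in auto)
  have d: "vector_derivative (inv_into I' \<tau>') (at (\<tau>' (fst p)))
      = inverse (FD ?\<theta> (\<tau> (fst p)) 1) * vector_derivative (inv_into I \<tau>) (at (\<tau> (fst p)))"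
    using time_inv_derivative[OF t, of "fst p"] p nz by simp
  have lin: "linear (FD ?h (\<phi> (base_point p)))"
    by (rule smooth_on_FD_linear[OF chart_transition_smooth[OF u]]) (use p in auto)
  show ?thesis
    using p assms(3) time_chartD(2)[OF t(1)] chartD(4)[OF u(1)]
      curve_velocity_transition[OF jet_spaceD(1)[OF p(1)] u p(4,5)]
    by (simp add: c transition_def jcoord_eq[OF t(1) u(1)] jcoord_eq[OF t(2) u(2)] d linear_cmul[OF lin])
qed

lemma jcoord_inj: "c \<in> jcharts M \<Longrightarrow> inj_on (jcoord c) (jdom M c)"
proof (rule inj_onI)
  fix p q assume c: "c \<in> jcharts M" and pq: "p \<in> jdom M c" "q \<in> jdom M c" and eq: "jcoord c p = jcoord c q"
  obtain I \<tau> U \<phi> where ce: "c = ((I, \<tau>), (U, \<phi>))" by (metis prod.exhaust)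
  have t: "(I, \<tau>) \<in> time_charts" and u: "(U, \<phi>) \<in> snd M"
    using c by (auto simp: ce jcharts_def)
  have p: "p \<in> jet_space M" "fst p \<in> I" "base_point p \<in> U" and q: "q \<in> jet_space M" "fst q \<in> I" "base_point q \<in> U"
    using pq by (auto simp: ce jdom_iff)
  note E = eq[unfolded ce jcoord_eq[OF t u pq(1)[unfolded ce]] jcoord_eq[OF t u pq(2)[unfolded ce]] prod.inject]
  have s: "fst p = fst q" using E p q time_chartD(2)[OF t] by (auto dest: inj_onD)
  have b: "base_point p = base_point q" using E p q chartD(4)[OF u] by (auto dest: inj_onD)
  have "vector_derivative (\<phi> \<circ> jet_curve p) (at (fst p)) = vector_derivative (\<phi> \<circ> jet_curve q) (at (fst q))"
    using E time_derivative_inverse[OF t p(2)] s by auto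
  then have "first_order_contact M (fst p) (jet_curve p) (jet_curve q)"
    using first_order_contact_iff[OF jet_spaceD(1)[OF p(1)] _ u p(3)] jet_spaceD(1)[OF q(1)] s b by simp
  then have "jet_of M (fst p) (jet_curve p) = jet_of M (fst q) (jet_curve q)"
    unfolding jet_of_def s[symmetric] first_order_contact_def case_prod_beta by (metis (mono_tags, lifting))
  then show "p = q"
    using jet_spaceD(2)[OF p(1)] jet_spaceD(2)[OF q(1)] by simp
qed

text \<open>The witness is the curve that is affine in the coordinates of the chart when parametrised by
  the time coordinate \<open>\<tau>\<close>.\<close>

lemma jet_with_coordinates:
  assumes t: "(I, \<tau>) \<in> time_charts" and u: "(U, \<phi>) \<in> snd M" and "s \<in> I" "x \<in> \<phi> ` U"
  shows "\<exists>p\<in>jdom M ((I, \<tau>), (U, \<phi>)). fst p = s \<and> jcoord ((I, \<tau>), (U, \<phi>)) p = (\<tau> s, x, y)"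
proof -
  note c = time_chartD[OF t] and m = chartD[OF u]
  define f where "f r = x + (\<tau> r - \<tau> s) *\<^sub>R y" for r
  define \<gamma> where "\<gamma> r = inv_into U \<phi> (f r)" for r
  define J where "J = I \<inter> f -` (\<phi> ` U)"
  have fsm: "smooth_on f I"
    unfolding f_def by (intro smooth_on_add smooth_on_const smooth_on_scaleR smooth_on_diff c(1,4))
  have J: "open J"
    unfolding J_def by (rule continuous_open_preimage[OF smooth_on_continuous_on[OF fsm] c(1) m(2)])
  have s: "s \<in> J" using assms(3,4) by (simp add: J_def f_def)
  have \<phi>\<gamma>: "\<phi> (\<gamma> r) = f r" "\<gamma> r \<in> U" if "r \<in> J" for r
    using that by (auto simp: \<gamma>_def J_def f_inv_into_f inv_into_into)
  have "continuous_map (top_of_set J) (top_of_set (\<phi> ` U)) f"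
    using smooth_on_continuous_on[OF fsm] by (auto simp: J_def intro: continuous_on_subset)
  from continuous_map_compose[OF this chart_inv_continuous[OF u]]
  have cont: "continuous_map (top_of_set J) (fst M) \<gamma>"
    by (simp add: \<gamma>_def[abs_def] comp_def)
  have "smooth_on (\<psi> \<circ> \<gamma>) (J \<inter> \<gamma> -` V)" if v: "(V, \<psi>) \<in> snd M" for V \<psi>
  proof -
    have eq: "J \<inter> \<gamma> -` V = I \<inter> f -` (\<phi> ` (U \<inter> V))"
      using m(4) by (auto simp: J_def \<gamma>_def f_inv_into_f inv_into_into)
    have op: "open (J \<inter> \<gamma> -` V)"
      unfolding eq by (rule continuous_open_preimage[OF smooth_on_continuous_on[OF fsm] c(1) chart_overlap_open[OF u v]])
    have "smooth_on (\<lambda>r. \<psi> (inv_into U \<phi> (f r))) (J \<inter> \<gamma> -` V)"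
      by (rule smooth_on_compose[OF chart_transition_smooth[OF u v] smooth_on_subset[OF fsm] _ op chart_overlap_open[OF u v]])
         (auto simp: eq)
    then show ?thesis by (simp add: comp_def \<gamma>_def)
  qed
  then have \<gamma>: "smooth_curve_at M \<gamma> s"
    unfolding smooth_curve_at_def using J s cont by blast
  define p where "p = jet_of M s \<gamma>"
  have p: "p \<in> jet_space M" "fst p = s" using \<gamma> by (auto simp: p_def jet_space_def) (simp add: jet_of_def)
  have \<gamma>s: "\<gamma> s \<in> U" using \<phi>\<gamma>[OF s] by simp
  have ct: "\<gamma> s = jet_curve p s" "vector_derivative (\<phi> \<circ> \<gamma>) (at s) = vector_derivative (\<phi> \<circ> jet_curve p) (at s)"
    using first_order_contact_iff[OF \<gamma> jet_curve_of(1)[OF \<gamma>] u \<gamma>s] jet_curve_of(2)[OF \<gamma>] by (auto simp: p_def)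
  have pd: "p \<in> jdom M ((I, \<tau>), (U, \<phi>))"
    using p ct \<gamma>s assms(3) by (simp add: jdom_iff)
  have "(f has_vector_derivative vector_derivative \<tau> (at s) *\<^sub>R y) (at s)"
    unfolding f_def using real_smooth_vector_derivative[OF c(4) assms(3)]
    by (auto intro!: derivative_eq_intros simp: has_real_derivative_iff_has_vector_derivative)
  moreover have "vector_derivative (\<phi> \<circ> \<gamma>) (at s) = vector_derivative f (at s)"
    by (rule vector_derivative_cong_open[OF J s]) (simp add: \<phi>\<gamma>)
  ultimately have "vector_derivative (\<phi> \<circ> jet_curve p) (at s) = vector_derivative \<tau> (at s) *\<^sub>R y"
    using ct vector_derivative_at by metis
  then have "jcoord ((I, \<tau>), (U, \<phi>)) p = (\<tau> s, x, y)"
    using jcoord_eq[OF t u pd] p ct \<phi>\<gamma>[OF s] time_derivative_inverse[OF t assms(3)]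
    by (simp add: f_def mult.commute)
  then show ?thesis using pd p by blast
qed

text \<open>The velocity coordinates are unrestricted; the overlap is a product of the overlap in time, the
  overlap in \<open>M\<close> and the whole vector space.\<close>

lemma jcoord_overlap_image:
  assumes "((I, \<tau>), (U, \<phi>)) \<in> jcharts M" "((I', \<tau>'), (V, \<psi>)) \<in> jcharts M"
  shows "jcoord ((I, \<tau>), (U, \<phi>)) ` (jdom M ((I, \<tau>), (U, \<phi>)) \<inter> jdom M ((I', \<tau>'), (V, \<psi>)))
    = \<tau> ` (I \<inter> I') \<times> \<phi> ` (U \<inter> V) \<times> UNIV" (is "?L = ?R")
proof
  have t: "(I, \<tau>) \<in> time_charts" and u: "(U, \<phi>) \<in> snd M"
    using assms by (auto simp: jcharts_def)
  show "?L \<subseteq> ?R"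
    by (auto simp: jcoord_eq[OF t u] jdom_iff)
  show "?R \<subseteq> ?L"
  proof
    fix z assume "z \<in> ?R"
    then obtain s m y where z: "s \<in> I" "s \<in> I'" "m \<in> U" "m \<in> V" "z = (\<tau> s, \<phi> m, y)" by auto
    obtain p where p: "p \<in> jdom M ((I, \<tau>), (U, \<phi>))" "fst p = s" "jcoord ((I, \<tau>), (U, \<phi>)) p = (\<tau> s, \<phi> m, y)"
      using jet_with_coordinates[OF t u z(1), of "\<phi> m" y] z by auto
    have "\<phi> (base_point p) = \<phi> m" using p jcoord_eq[OF t u p(1)] by simp
    then have "base_point p = m"
      using p z chartD(4)[OF u] by (auto simp: jdom_iff dest: inj_onD)
    then have "p \<in> jdom M ((I', \<tau>'), (V, \<psi>))" using p z by (simp add: jdom_iff)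
    then show "z \<in> ?L" using p z by force
  qed
qed

lemma open_overlap:
  assumes "c \<in> jcharts M" "c' \<in> jcharts M"
  shows "open (jcoord c ` (jdom M c \<inter> jdom M c'))"
proof -
  obtain I \<tau> U \<phi> I' \<tau>' V \<psi> where c: "c = ((I, \<tau>), (U, \<phi>))" "c' = ((I', \<tau>'), (V, \<psi>))"
    by (metis prod.exhaust)
  then show ?thesis
    using assms jcoord_overlap_image[of I \<tau> U \<phi> I' \<tau>' V \<psi>]
    by (auto simp: jcharts_def intro!: open_Times time_overlap_open chart_overlap_open)
qed


lemma open_jcoord_image: "c \<in> jcharts M \<Longrightarrow> open (jcoord c ` jdom M c)"
  using open_overlap[of c c] by simp

lemma jinv_jcoord [simp]: "c \<in> jcharts M \<Longrightarrow> p \<in> jdom M c \<Longrightarrow> jinv M c (jcoord c p) = p"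
  unfolding jinv_def by (simp add: jcoord_inj)

lemma jcoord_jinv [simp]: "z \<in> jcoord c ` jdom M c \<Longrightarrow> jcoord c (jinv M c z) = z"
  unfolding jinv_def by (simp add: f_inv_into_f)

lemma jinv_in_jdom: "z \<in> jcoord c ` jdom M c \<Longrightarrow> jinv M c z \<in> jdom M c"
  unfolding jinv_def by (rule inv_into_into)

text \<open>Smoothness and derivatives of a change of jet coordinates are computed from its closed form.\<close>

lemma transition_eq:
  assumes "c \<in> jcharts M" "c' \<in> jcharts M" "z \<in> jcoord c ` (jdom M c \<inter> jdom M c')"
  shows "jcoord c' (jinv M c z) = transition c c' z"
  using assms by (auto simp: jcoord_transition[symmetric])

lemma transition_smooth:
  assumes "c \<in> jcharts M" "c' \<in> jcharts M"
  shows "smooth_on (transition c c') (jcoord c ` (jdom M c \<inter> jdom M c'))"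
proof -
  obtain I \<tau> U \<phi> I' \<tau>' V \<psi> where c: "c = ((I, \<tau>), (U, \<phi>))" "c' = ((I', \<tau>'), (V, \<psi>))"
    by (metis prod.exhaust)
  have t: "(I, \<tau>) \<in> time_charts" "(I', \<tau>') \<in> time_charts" and u: "(U, \<phi>) \<in> snd M" "(V, \<psi>) \<in> snd M"
    using assms by (auto simp: c jcharts_def)
  define Q where "Q = jcoord c ` (jdom M c \<inter> jdom M c')"
  have Q: "open Q" unfolding Q_def by (rule open_overlap[OF assms])
  have Qe: "Q = \<tau> ` (I \<inter> I') \<times> \<phi> ` (U \<inter> V) \<times> UNIV"
    unfolding Q_def c by (rule jcoord_overlap_image) (use assms c in auto)
  have f: "smooth_on fst Q" "smooth_on (\<lambda>z. fst (snd z)) Q" "smooth_on (\<lambda>z. snd (snd z)) Q"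
    by (intro smooth_on_linear smooth_on_fst smooth_on_snd bounded_linear_fst bounded_linear_snd Q)+
  note \<theta> = time_transition_smooth[OF t] and h = chart_transition_smooth[OF u]
  note op = time_overlap_open[OF t] chart_overlap_open[OF u]
  have 1: "smooth_on (\<lambda>z. \<tau>' (inv_into I \<tau> (fst z))) Q"
    by (rule smooth_on_compose[OF \<theta> f(1) _ Q op(1)]) (auto simp: Qe)
  have 2: "smooth_on (\<lambda>z. \<psi> (inv_into U \<phi> (fst (snd z)))) Q"
    by (rule smooth_on_compose[OF h f(2) _ Q op(2)]) (auto simp: Qe)
  have 3: "smooth_on (\<lambda>z. FD (\<lambda>t. \<tau>' (inv_into I \<tau> t)) (fst z) 1) Q"
    by (rule smooth_on_FD[OF \<theta> f(1) smooth_on_const _ Q op(1)]) (auto simp: Qe)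
  have 4: "smooth_on (\<lambda>z. FD (\<lambda>x. \<psi> (inv_into U \<phi> x)) (fst (snd z)) (snd (snd z))) Q"
    by (rule smooth_on_FD[OF h f(2,3) _ Q op(2)]) (auto simp: Qe)
  have "smooth_on (transition c c') Q"
    unfolding c transition_def prod.case
    by (intro smooth_on_Pair smooth_on_scaleR smooth_on_inverse 1 2 3 4 Q)
       (use time_transition_nonzero[OF t] in \<open>auto simp: Qe\<close>)
  then show ?thesis by (simp add: Q_def)
qed

lemma has_derivative_transition:
  assumes "c \<in> jcharts M" "c' \<in> jcharts M" "p \<in> jdom M c \<inter> jdom M c'"
  shows "(transition c c' has_derivative jac M c c' p) (at (jcoord c p))"
    and "((jcoord c' \<circ> jinv M c) has_derivative jac M c c' p) (at (jcoord c p))"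
proof -
  have i: "jcoord c p \<in> jcoord c ` (jdom M c \<inter> jdom M c')" using assms by auto
  have D: "(transition c c' has_derivative FD (transition c c') (jcoord c p)) (at (jcoord c p))"
    by (rule smooth_on_has_derivative[OF transition_smooth[OF assms(1,2)] i])
  have "((jcoord c' \<circ> jinv M c) has_derivative FD (transition c c') (jcoord c p)) (at (jcoord c p))"
    by (rule has_derivative_transform_within_open[OF D open_overlap[OF assms(1,2)] i])
       (simp add: transition_eq[OF assms(1,2)])
  moreover from this have "jac M c c' p = FD (transition c c') (jcoord c p)"
    unfolding jac_def by (rule FD_eqI)
  ultimately show "(transition c c' has_derivative jac M c c' p) (at (jcoord c p))"
    and "((jcoord c' \<circ> jinv M c) has_derivative jac M c c' p) (at (jcoord c p))"
    using D by simp_all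
qed

lemma jac_eq_FD:
  assumes "c \<in> jcharts M" "c' \<in> jcharts M" "p \<in> jdom M c \<inter> jdom M c'"
  shows "jac M c c' p = FD (transition c c') (jcoord c p)"
  using FD_eqI[OF has_derivative_transition(1)[OF assms]] by simp

lemma linear_jac:
  assumes "c \<in> jcharts M" "c' \<in> jcharts M" "p \<in> jdom M c \<inter> jdom M c'"
  shows "linear (jac M c c' p)"
  using has_derivative_transition(1)[OF assms] by (rule has_derivative_linear)

lemma jac_self:
  assumes "c \<in> jcharts M" "p \<in> jdom M c"
  shows "jac M c c p w = w"
proof -
  have "((\<lambda>z. z) has_derivative (\<lambda>w. w)) (at (jcoord c p))" by simp
  then have "((jcoord c \<circ> jinv M c) has_derivative (\<lambda>w. w)) (at (jcoord c p))"
    by (rule has_derivative_transform_within_open[OF _ open_jcoord_image[OF assms(1)]])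
       (use assms in auto)
  then show ?thesis
    unfolding jac_def by (simp add: FD_eqI)
qed

lemma jac_compose:
  assumes "c \<in> jcharts M" "c' \<in> jcharts M" "c'' \<in> jcharts M" "p \<in> jdom M c \<inter> jdom M c' \<inter> jdom M c''"
  shows "jac M c' c'' p (jac M c c' p w) = jac M c c'' p w"
proof -
  let ?O = "jcoord c ` (jdom M c \<inter> jdom M c') \<inter> jcoord c ` (jdom M c \<inter> jdom M c'')"
  have T: "(transition c c' has_derivative jac M c c' p) (at (jcoord c p))"
    by (rule has_derivative_transition) (use assms in auto)
  have "(transition c' c'' has_derivative jac M c' c'' p) (at (jcoord c' p))"
    by (rule has_derivative_transition) (use assms in auto)
  then have "(transition c' c'' has_derivative jac M c' c'' p) (at (transition c c' (jcoord c p)))"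
    using jcoord_transition[of c c' p] assms by simp
  from has_derivative_compose[OF T this]
  have "((\<lambda>z. transition c' c'' (transition c c' z)) has_derivative (\<lambda>w. jac M c' c'' p (jac M c c' p w))) (at (jcoord c p))" .
  then have "(transition c c'' has_derivative (\<lambda>w. jac M c' c'' p (jac M c c' p w))) (at (jcoord c p))"
  proof (rule has_derivative_transform_within_open)
    show "open ?O" using assms by (intro open_Int open_overlap)
    show "jcoord c p \<in> ?O" using assms by auto
    fix z assume z: "z \<in> ?O"
    then obtain q where q: "q \<in> jdom M c" "q \<in> jdom M c'" "q \<in> jdom M c''" "z = jcoord c q"
      using inj_onD[OF jcoord_inj[OF assms(1)]] by (smt (verit) IntE imageE)
    then show "transition c' c'' (transition c c' z) = transition c c'' z"
      using jcoord_transition[of c c' q] jcoord_transition[of c' c'' q] jcoord_transition[of c c'' q] assms by simp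
  qed
  then have "(\<lambda>w. jac M c' c'' p (jac M c c' p w)) = jac M c c'' p"
    using has_derivative_transition(1)[of c c'' p] assms has_derivative_unique by blast
  then show ?thesis by (rule fun_cong)
qed

lemma jac_inverse:
  assumes "c \<in> jcharts M" "c' \<in> jcharts M" "p \<in> jdom M c \<inter> jdom M c'"
  shows "jac M c' c p (jac M c c' p w) = w"
  using jac_compose[of c c' c p w] jac_self[of c p w] assms by auto

text \<open>The new time depends on the old time only, the new position on the old position only, and the
  new velocity is linear in the old one with the factor \<open>dt/dt'\<close> (the inverse of \<open>d\<close>). The
  remaining blocks, the derivatives of the new velocity with respect to time and position, are
  unconstrained.\<close>

lemma jac_blocks:
  assumes "c \<in> jcharts M" "c' \<in> jcharts M" "p \<in> jdom M c \<inter> jdom M c'"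
  shows "\<exists>d A. d \<noteq> 0 \<and> linear A \<and> (\<forall>a b w. fst (jac M c c' p (a, b, w)) = a * d \<and>
    fst (snd (jac M c c' p (a, b, w))) = A b \<and> jac M c c' p (0, 0, w) = (0, 0, inverse d *\<^sub>R A w))"
proof -
  obtain I \<tau> U \<phi> I' \<tau>' V \<psi> where c: "c = ((I, \<tau>), (U, \<phi>))" "c' = ((I', \<tau>'), (V, \<psi>))"
    by (metis prod.exhaust)
  have t: "(I, \<tau>) \<in> time_charts" "(I', \<tau>') \<in> time_charts" and u: "(U, \<phi>) \<in> snd M" "(V, \<psi>) \<in> snd M"
    using assms by (auto simp: c jcharts_def)
  let ?\<theta> = "\<lambda>t. \<tau>' (inv_into I \<tau> t)" and ?h = "\<lambda>x. \<psi> (inv_into U \<phi> x)"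
  obtain t0 x0 y0 where z: "jcoord c p = (t0, x0, y0)" by (metis prod.exhaust)
  have z0: "t0 \<in> \<tau> ` (I \<inter> I')" "x0 \<in> \<phi> ` (U \<inter> V)"
    using imageI[OF assms(3), of "jcoord c"] jcoord_overlap_image[of I \<tau> U \<phi> I' \<tau>' V \<psi>] assms(1,2) z
    by (simp_all add: c)
  define d where "d = FD ?\<theta> t0 1"
  define A where "A = FD ?h x0"
  have d: "d \<noteq> 0" unfolding d_def by (rule time_transition_nonzero[OF t z0(1)])
  have A: "linear A" unfolding A_def by (rule smooth_on_FD_linear[OF chart_transition_smooth[OF u] z0(2)])
  have "FD ?\<theta> t0 = (\<lambda>r. r * d)"
  proof
    fix r show "FD ?\<theta> t0 r = r * d"
      using linear_cmul[OF smooth_on_FD_linear[OF time_transition_smooth[OF t] z0(1)], of r 1]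
      by (simp add: d_def)
  qed
  then have \<theta>: "(?\<theta> has_derivative (\<lambda>r. r * d)) (at t0)"
    using smooth_on_has_derivative[OF time_transition_smooth[OF t] z0(1)] by simp
  have h: "(?h has_derivative A) (at x0)"
    unfolding A_def by (rule smooth_on_has_derivative[OF chart_transition_smooth[OF u] z0(2)])
  have T: "(transition c c' has_derivative jac M c c' p) (at (t0, x0, y0))"
    using has_derivative_transition(1)[OF assms] z by simp
  have "((\<lambda>z. fst (transition c c' z)) has_derivative (\<lambda>v. fst v * d)) (at (t0, x0, y0))"
    using has_derivative_compose[OF has_derivative_fst[OF has_derivative_ident] , of ?\<theta> "\<lambda>r. r * d" "(t0, x0, y0)"] \<theta>
    by (simp add: c transition_def)
  then have 1: "fst (jac M c c' p v) = fst v * d" for v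
    using has_derivative_unique[OF has_derivative_fst[OF T]] by metis
  have "((\<lambda>z. fst (snd (transition c c' z))) has_derivative (\<lambda>v. A (fst (snd v)))) (at (t0, x0, y0))"
    using has_derivative_compose[OF has_derivative_fst[OF has_derivative_snd[OF has_derivative_ident]], of ?h A "(t0, x0, y0)"] h
    by (simp add: c transition_def)
  then have 2: "fst (snd (jac M c c' p v)) = A (fst (snd v))" for v
    using has_derivative_unique[OF has_derivative_fst[OF has_derivative_snd[OF T]]] by metis
  have 3: "snd (snd (jac M c c' p (0, 0, w))) = inverse d *\<^sub>R A w" for w
  proof -
    have "((\<lambda>r. (t0, x0, y0 + r *\<^sub>R w)) has_derivative (\<lambda>r. (0, 0, r *\<^sub>R w))) (at (0::real))"
      by (auto intro!: derivative_eq_intros)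
    moreover have "(transition c c' has_derivative jac M c c' p) (at ((\<lambda>r. (t0, x0, y0 + r *\<^sub>R w)) 0))"
      using T by simp
    ultimately have "((\<lambda>r. snd (snd (transition c c' (t0, x0, y0 + r *\<^sub>R w)))) has_derivative
        (\<lambda>r. snd (snd (jac M c c' p (0, 0, r *\<^sub>R w))))) (at (0::real))"
      by (intro has_derivative_snd) (rule has_derivative_compose)
    moreover have "snd (snd (transition c c' (t0, x0, y0 + r *\<^sub>R w))) = inverse d *\<^sub>R (A y0 + r *\<^sub>R A w)" for r
      by (simp add: c transition_def d_def[symmetric] A_def[symmetric] linear_add[OF A] linear_cmul[OF A])
    ultimately have "((\<lambda>r. inverse d *\<^sub>R (A y0 + r *\<^sub>R A w)) has_derivative
        (\<lambda>r. snd (snd (jac M c c' p (0, 0, r *\<^sub>R w))))) (at (0::real))" by simp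
    moreover have "((\<lambda>r. inverse d *\<^sub>R (A y0 + r *\<^sub>R A w)) has_derivative (\<lambda>r. inverse d *\<^sub>R (r *\<^sub>R A w))) (at (0::real))"
      by (auto intro!: derivative_eq_intros)
    ultimately have "(\<lambda>r. snd (snd (jac M c c' p (0, 0, r *\<^sub>R w)))) = (\<lambda>r. inverse d *\<^sub>R (r *\<^sub>R A w))"
      by (rule has_derivative_unique)
    from fun_cong[OF this, of 1] show ?thesis by simp
  qed
  have "jac M c c' p (0, 0, w) = (0, 0, inverse d *\<^sub>R A w)" for w
    using 1[of "(0, 0, w)"] 2[of "(0, 0, w)"] 3[of w] linear_0[OF A] by (simp add: prod_eq_iff)
  then show ?thesis
    using d A 1 2 by (intro exI[of _ d] exI[of _ A]) simp
qed

lemma jac_columns: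
  assumes "c \<in> jcharts M" "c' \<in> jcharts M" "p \<in> jdom M c \<inter> jdom M c'"
  shows "jac M c c' p (1, 0, 0) = (dt'_dt M c c' p, 0, \<chi> k. dy'_dt M c c' p k)"
    and "jac M c c' p (0, axis i 1, 0) = (0, \<chi> k. dx'_dx M c c' p k i, \<chi> k. dy'_dx M c c' p k i)"
    and "jac M c c' p (0, 0, axis i 1) = (0, 0, \<chi> k. dx'_dx M c c' p k i * dt'_dt M c' c p)"
    and "dt'_dt M c' c p * dt'_dt M c c' p = 1"
proof -
  obtain d A where B: "d \<noteq> 0" "linear A"
    "\<And>a b w. fst (jac M c c' p (a, b, w)) = a * d" "\<And>a b w. fst (snd (jac M c c' p (a, b, w))) = A b"
    "\<And>w. jac M c c' p (0, 0, w) = (0, 0, inverse d *\<^sub>R A w)"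
    using jac_blocks[OF assms] by auto
  obtain d' A' where B': "\<And>a b w. fst (jac M c' c p (a, b, w)) = a * d'"
    using jac_blocks[of c' c p] assms by auto
  have d: "dt'_dt M c c' p = d" "dt'_dt M c' c p = d'"
    by (simp_all add: dt'_dt_def B(3) B')
  have "jac M c' c p (jac M c c' p (1, 0, 0)) = (1, 0, 0)"
    by (rule jac_inverse[OF assms])
  then have dd: "d * d' = 1"
    using B' B(3)[of 1 0 0] by (metis fst_conv mult_1 surj_pair)
  then show "dt'_dt M c' c p * dt'_dt M c c' p = 1"
    by (simp add: d mult.commute)
  have x: "dx'_dx M c c' p k i = A (axis i 1) $ k" for k i
    by (simp add: dx'_dx_def B(4))
  have "d' = inverse d" using dd B(1) by (simp add: field_simps)
  then show "jac M c c' p (0, 0, axis i 1) = (0, 0, \<chi> k. dx'_dx M c c' p k i * dt'_dt M c' c p)"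
    by (simp add: B(5) x d vec_eq_iff)
  show "jac M c c' p (1, 0, 0) = (dt'_dt M c c' p, 0, \<chi> k. dy'_dt M c c' p k)"
    using B(3)[of 1 0 0] B(4)[of 1 0 0] linear_0[OF B(2)]
    by (simp add: prod_eq_iff d dy'_dt_def vec_eq_iff)
  show "jac M c c' p (0, axis i 1, 0) = (0, \<chi> k. dx'_dx M c c' p k i, \<chi> k. dy'_dx M c c' p k i)"
    using B(3)[of 0 "axis i 1" 0] B(4)[of 0 "axis i 1" 0]
    by (simp add: prod_eq_iff x dy'_dx_def vec_eq_iff)
qed

text \<open>A compact set \<open>C\<close> in the coordinates of \<open>c\<close> is closed in the jet space; this is where \<open>M\<close> being
  Hausdorff is used. For a sequence in \<open>jinv M c ` C\<close> that converges in the chart \<open>c'\<close>, pass to a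
  subsequence converging in \<open>C\<close>. The times converge in both charts to the same limit, and the base
  points have the same limit by uniqueness of limits in \<open>M\<close>. Therefore the limit lies in the domain
  of \<open>c\<close> (membership depends only on time and base point), and there the change of coordinates is
  continuous.\<close>

lemma compact_image_closed:
  assumes c: "c \<in> jcharts M" and c': "c' \<in> jcharts M" and C: "compact C" "C \<subseteq> jcoord c ` jdom M c"
  shows "open (jcoord c' ` (jdom M c' - jinv M c ` C))"
proof -
  obtain I \<tau> U \<phi> I' \<tau>' V \<psi> where ce: "c = ((I, \<tau>), (U, \<phi>))" "c' = ((I', \<tau>'), (V, \<psi>))"
    by (metis prod.exhaust)
  have t: "(I, \<tau>) \<in> time_charts" "(I', \<tau>') \<in> time_charts" and u: "(U, \<phi>) \<in> snd M" "(V, \<psi>) \<in> snd M"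
    using c c' by (auto simp: ce jcharts_def)
  let ?D = "jcoord c' ` jdom M c'" and ?K = "jcoord c' ` (jdom M c' \<inter> jinv M c ` C)"
  have De: "jcoord c ` jdom M c = \<tau> ` I \<times> \<phi> ` U \<times> UNIV" "?D = \<tau>' ` I' \<times> \<psi> ` V \<times> UNIV"
    using jcoord_overlap_image[of I \<tau> U \<phi> I \<tau> U \<phi>] jcoord_overlap_image[of I' \<tau>' V \<psi> I' \<tau>' V \<psi>] c c'
    by (auto simp: ce)
  have time: "fst p = inv_into I \<tau> (fst (jcoord c p))" "base_point p = inv_into U \<phi> (fst (snd (jcoord c p)))"
    if "p \<in> jdom M c" for p
    using that time_chartD(2)[OF t(1)] chartD(4)[OF u(1)] by (auto simp: ce jcoord_eq[OF t(1) u(1)] jdom_iff)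
  have time': "fst p = inv_into I' \<tau>' (fst (jcoord c' p))" "base_point p = inv_into V \<psi> (fst (snd (jcoord c' p)))"
    if "p \<in> jdom M c'" for p
    using that time_chartD(2)[OF t(2)] chartD(4)[OF u(2)] by (auto simp: ce jcoord_eq[OF t(2) u(2)] jdom_iff)
  have "closedin (top_of_set ?D) ?K"
    unfolding closedin_limpt islimpt_sequential
  proof (intro conjI allI impI)
    show "?K \<subseteq> ?D" by auto
    fix z assume "(\<exists>X. (\<forall>n. X n \<in> ?K - {z}) \<and> X \<longlonglongrightarrow> z) \<and> z \<in> ?D"
    then obtain X where X: "(\<forall>n. X n \<in> ?K) \<and> z \<in> ?D \<and> X \<longlonglongrightarrow> z" by blast
    have "\<exists>P. P \<in> jdom M c' \<and> X n = jcoord c' P \<and> P \<in> jdom M c \<and> jcoord c P \<in> C" for n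
    proof -
      have "X n \<in> ?K" using X by blast
      then obtain P v where P: "P \<in> jdom M c'" "v \<in> C" "P = jinv M c v" "X n = jcoord c' P" by blast
      have "v \<in> jcoord c ` jdom M c" using C(2) P(2) by (rule subsetD)
      then have "P \<in> jdom M c" "jcoord c P = v" unfolding P(3) by (rule jinv_in_jdom, rule jcoord_jinv)
      then show ?thesis using P by blast
    qed
    then obtain P where P: "\<And>n. P n \<in> jdom M c'" "\<And>n. X n = jcoord c' (P n)" "\<And>n. P n \<in> jdom M c" "\<And>n. jcoord c (P n) \<in> C"
      by metis
    obtain w r where w: "w \<in> C" "strict_mono (r :: nat \<Rightarrow> nat)" "((\<lambda>n. jcoord c (P n)) \<circ> r) \<longlonglongrightarrow> w"
      using C(1) P(4) unfolding compact_def by metis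
    define Z where "Z n = jcoord c' (P (r n))" for n
    define W where "W n = jcoord c (P (r n))" for n
    have W: "W \<longlonglongrightarrow> w" using w(3) by (simp add: W_def[abs_def] comp_def)
    have "(X \<circ> r) \<longlonglongrightarrow> z" using X w(2) by (blast intro: LIMSEQ_subseq_LIMSEQ)
    then have Z: "Z \<longlonglongrightarrow> z" by (simp add: Z_def[abs_def] comp_def P(2))
    define q where "q = jinv M c w"
    define p where "p = jinv M c' z"
    have wD: "w \<in> jcoord c ` jdom M c" using w(1) C(2) by blast
    have q: "q \<in> jdom M c" "jcoord c q = w" using wD by (auto simp: q_def jinv_in_jdom)
    have p: "p \<in> jdom M c'" "jcoord c' p = z" using X by (auto simp: p_def jinv_in_jdom)
    have "(\<lambda>n. inv_into I \<tau> (fst (W n))) \<longlonglongrightarrow> inv_into I \<tau> (fst w)"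
      using wD time_chartD(3)[OF t(1)]
      by (intro isCont_tendsto_compose[OF _ tendsto_fst[OF W]]
          continuous_on_interior[OF smooth_on_continuous_on[OF time_chartD(5)[OF t(1)]]])
         (auto simp: De interior_open)
    moreover have "(\<lambda>n. inv_into I' \<tau>' (fst (Z n))) \<longlonglongrightarrow> inv_into I' \<tau>' (fst z)"
      using X time_chartD(3)[OF t(2)]
      by (intro isCont_tendsto_compose[OF _ tendsto_fst[OF Z]]
          continuous_on_interior[OF smooth_on_continuous_on[OF time_chartD(5)[OF t(2)]]])
         (auto simp: De interior_open)
    moreover have "inv_into I \<tau> (fst (W n)) = inv_into I' \<tau>' (fst (Z n))" for n
      using time(1)[OF P(3)] time'(1)[OF P(1)] by (simp add: W_def Z_def)
    ultimately have 1: "fst q = fst p"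
      using LIMSEQ_unique time(1)[OF q(1)] time'(1)[OF p(1)] q(2) p(2) by simp
    have Wx: "(\<lambda>n. fst (snd (W n))) \<longlonglongrightarrow> fst (snd w)" and Zx: "(\<lambda>n. fst (snd (Z n))) \<longlonglongrightarrow> fst (snd z)"
      by (intro tendsto_fst tendsto_snd W Z)+
    have "limitin (top_of_set (\<phi> ` U)) (\<lambda>n. fst (snd (W n))) (fst (snd w)) sequentially"
      using Wx wD P(3) De by (auto simp: limitin_subtopology W_def jcoord_eq[OF t(1) u(1)] ce jdom_iff
          intro!: eventuallyI)
    from continuous_map_limit[OF chart_inv_continuous[OF u(1)] this]
    have "limitin (fst M) (\<lambda>n. base_point (P (r n))) (base_point q) sequentially"
      using time(2)[OF P(3)] time(2)[OF q(1)] q(2) by (simp add: W_def comp_def)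
    moreover have "limitin (top_of_set (\<psi> ` V)) (\<lambda>n. fst (snd (Z n))) (fst (snd z)) sequentially"
      using Zx X P(1) De by (auto simp: limitin_subtopology Z_def jcoord_eq[OF t(2) u(2)] ce jdom_iff
          intro!: eventuallyI)
    from continuous_map_limit[OF chart_inv_continuous[OF u(2)] this]
    have "limitin (fst M) (\<lambda>n. base_point (P (r n))) (base_point p) sequentially"
      using time'(2)[OF P(1)] time'(2)[OF p(1)] p(2) by (simp add: Z_def comp_def)
    ultimately have 2: "base_point q = base_point p"
      using limitin_Hausdorff_unique[OF _ _ _ Hausdorff] by (metis trivial_limit_sequentially)
    have pc: "p \<in> jdom M c"
      using p(1) q(1) 1 2 unfolding ce jdom_iff by simp
    have zO: "z \<in> jcoord c' ` (jdom M c' \<inter> jdom M c)" using p pc by force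
    have "(\<lambda>n. transition c' c (Z n)) \<longlonglongrightarrow> transition c' c z"
      by (rule isCont_tendsto_compose[OF _ Z])
         (use smooth_on_has_derivative[OF transition_smooth[OF c' c] zO] has_derivative_continuous in blast)
    moreover have "transition c' c (Z n) = W n" for n
      using jcoord_transition[OF c' c, of "P (r n)"] P by (simp add: Z_def W_def)
    moreover have "transition c' c z = jcoord c p"
      using jcoord_transition[OF c' c, of p] p pc by simp
    ultimately have "jcoord c p = w" using W LIMSEQ_unique by auto
    then have "p = jinv M c w" using jinv_jcoord[OF c pc] by simp
    then show "z \<in> ?K" using p w(1) by force
  qed
  then have "openin (top_of_set ?D) (?D - ?K)" by (simp add: openin_diff)
  then have "open (?D - ?K)" using open_jcoord_image[OF c'] by (meson openin_open_trans)
  moreover have "?D - ?K = jcoord c' ` (jdom M c' - jinv M c ` C)"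
    using inj_on_image_set_diff[OF jcoord_inj[OF c'], of "jdom M c'" "jdom M c' \<inter> jinv M c ` C"]
    by (simp add: Diff_Int_distrib Diff_Int)
  ultimately show ?thesis by simp
qed


section \<open>Smooth functions and vector fields on the jet space\<close>

lemma charts_at_iff: "c \<in> charts_at M p \<longleftrightarrow> c \<in> jcharts M \<and> p \<in> jdom M c"
  by (simp add: charts_at_def)

lemma jet_space_chart:
  assumes "p \<in> jet_space M"
  obtains c where "c \<in> jcharts M" "p \<in> jdom M c"
  using charts_at_nonempty[OF assms] unfolding charts_at_iff by blast

lemma jdom_in_jet_space: "p \<in> jdom M c \<Longrightarrow> p \<in> jet_space M"
  using jdom_subset by blast

lemma jet_space_Int_jdom [simp]: "jet_space M \<inter> jdom M c = jdom M c"
  using jdom_subset by blast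

lemma jet_open_jdom: "c \<in> jcharts M \<Longrightarrow> jet_open M (jdom M c)"
  unfolding jet_open_def using open_overlap[of _ c] jdom_subset by (simp add: Int_commute)

lemma jet_open_Int:
  assumes "jet_open M V" "jet_open M W"
  shows "jet_open M (V \<inter> W)"
  unfolding jet_open_def
proof (intro conjI ballI)
  show "V \<inter> W \<subseteq> jet_space M" using assms by (auto simp: jet_open_def)
  fix c assume c: "c \<in> jcharts M"
  have "jcoord c ` (V \<inter> W \<inter> jdom M c) = jcoord c ` ((V \<inter> jdom M c) \<inter> (W \<inter> jdom M c))"
    by (rule arg_cong[where f = "image (jcoord c)"]) blast
  also have "\<dots> = jcoord c ` (V \<inter> jdom M c) \<inter> jcoord c ` (W \<inter> jdom M c)"
    by (rule inj_on_image_Int[OF jcoord_inj[OF c]]) auto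
  finally show "open (jcoord c ` (V \<inter> W \<inter> jdom M c))"
    using assms c by (simp add: jet_open_def open_Int)
qed

lemma open_jcoord_jet_open:
  assumes "jet_open M V" "c \<in> jcharts M" "V \<subseteq> jdom M c"
  shows "open (jcoord c ` V)"
  using assms unfolding jet_open_def by (metis inf.absorb1)

lemma jet_open_jinv:
  assumes c: "c \<in> jcharts M" and S: "open S" "S \<subseteq> jcoord c ` jdom M c"
  shows "jet_open M (jinv M c ` S)"
  unfolding jet_open_def
proof (intro conjI ballI)
  show "jinv M c ` S \<subseteq> jet_space M" using S jinv_in_jdom jdom_subset by blast
  fix c' assume c': "c' \<in> jcharts M"
  have "jcoord c' ` (jinv M c ` S \<inter> jdom M c') = jcoord c' ` (jdom M c' \<inter> jdom M c) \<inter> transition c' c -` S"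
    (is "?L = ?R")
  proof
    show "?L \<subseteq> ?R"
    proof
      fix z assume "z \<in> ?L"
      then obtain s where s: "s \<in> S" "jinv M c s \<in> jdom M c'" "z = jcoord c' (jinv M c s)" by blast
      then have "s \<in> jcoord c ` jdom M c" using S(2) by blast
      then show "z \<in> ?R"
        using s jinv_in_jdom[of s c] jcoord_transition[OF c' c, of "jinv M c s"] by auto
    qed
    show "?R \<subseteq> ?L"
    proof
      fix z assume z: "z \<in> ?R"
      then obtain q where q: "q \<in> jdom M c'" "q \<in> jdom M c" "z = jcoord c' q" by blast
      have "q = jinv M c (jcoord c q)" using q(2) c by simp
      moreover have "jcoord c q \<in> S"
        using q z jcoord_transition[OF c' c, of q] by auto
      ultimately
      show "z \<in> ?L" using q by blast
    qed
  qed
  then show "open (jcoord c' ` (jinv M c ` S \<inter> jdom M c'))"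
    using continuous_open_preimage[OF smooth_on_continuous_on[OF transition_smooth[OF c' c]] open_overlap[OF c' c] S(1)]
    by simp
qed

lemma jet_open_compact_complement:
  assumes "c \<in> jcharts M" "compact C" "C \<subseteq> jcoord c ` jdom M c"
  shows "jet_open M (jet_space M - jinv M c ` C)"
proof -
  have "(jet_space M - jinv M c ` C) \<inter> jdom M c' = jdom M c' - jinv M c ` C" for c'
    using jdom_subset by blast
  then show ?thesis
    unfolding jet_open_def using compact_image_closed[OF assms(1) _ assms(2,3)] by auto
qed

text \<open>Near each jet smoothness need only be checked in one chart of one's choice.\<close>

lemma smooth_fun_local:
  assumes "\<And>p. p \<in> W \<Longrightarrow> \<exists>c V. c \<in> jcharts M \<and> jet_open M V \<and> p \<in> V \<and> V \<subseteq> jdom M c \<and>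
    smooth_on (\<lambda>z. f (jinv M c z)) (jcoord c ` V)"
  shows "smooth_fun M W f"
  unfolding smooth_fun_def
proof (intro ballI smooth_on_local)
  fix c' z assume c': "c' \<in> jcharts M" and "z \<in> jcoord c' ` (W \<inter> jdom M c')"
  then obtain p where p: "p \<in> W" "p \<in> jdom M c'" "z = jcoord c' p" by blast
  obtain c V where c: "c \<in> jcharts M" and V: "jet_open M V" "p \<in> V" "V \<subseteq> jdom M c"
    "smooth_on (\<lambda>z. f (jinv M c z)) (jcoord c ` V)"
    using assms[OF p(1)] by blast
  let ?T = "jcoord c' ` (V \<inter> jdom M c')"
  have T: "open ?T" using V(1) c' by (simp add: jet_open_def)
  have tr: "transition c' c (jcoord c' q) = jcoord c q" if "q \<in> V \<inter> jdom M c'" for q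
    using jcoord_transition[OF c' c, of q] that V(3) by auto
  have "smooth_on (\<lambda>z. f (jinv M c (transition c' c z))) ?T"
  proof (rule smooth_on_compose[OF V(4) smooth_on_subset[OF transition_smooth[OF c' c]] _ T open_jcoord_jet_open[OF V(1) c V(3)]])
    show "?T \<subseteq> jcoord c' ` (jdom M c' \<inter> jdom M c)" using V(3) by blast
    show "transition c' c ` ?T \<subseteq> jcoord c ` V" using tr by auto
  qed
  then have "smooth_on (f \<circ> jinv M c') ?T"
    by (rule smooth_on_cong[OF T, rotated]) (use tr V(3) c c' in auto)
  then show "\<exists>T. open T \<and> z \<in> T \<and> smooth_on (f \<circ> jinv M c') T"
    using T p V(2) by blast
qed

lemma tangent_transform:
  "v \<in> tangent_space M p \<Longrightarrow> c \<in> charts_at M p \<Longrightarrow> c' \<in> charts_at M p \<Longrightarrow> v c' = jac M c c' p (v c)"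
  unfolding tangent_space_def by blast

lemma tangent_zero_outside:
  "v \<in> tangent_space M p \<Longrightarrow> c \<notin> charts_at M p \<Longrightarrow> v c = 0"
  unfolding tangent_space_def by blast

text \<open>A tangent vector is determined by its components in one chart around the jet. Equalities of
  tangent vectors are proved below by comparing components in a convenient chart.\<close>

lemma tangent_eqI:
  assumes "v \<in> tangent_space M p" "w \<in> tangent_space M p" "c \<in> charts_at M p" "v c = w c"
  shows "v = w"
proof
  fix d show "v d = w d"
    using tangent_transform[OF assms(1,3), of d] tangent_transform[OF assms(2,3), of d]
      tangent_zero_outside[OF assms(1), of d] tangent_zero_outside[OF assms(2), of d] assms(4)
    by (cases "d \<in> charts_at M p") simp_all
qed

lemma linear_jac': "c \<in> charts_at M p \<Longrightarrow> c' \<in> charts_at M p \<Longrightarrow> linear (jac M c c' p)"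
  by (rule linear_jac) (auto simp: charts_at_iff)

lemma tangent_add: "v \<in> tangent_space M p \<Longrightarrow> w \<in> tangent_space M p \<Longrightarrow> (\<lambda>c. v c + w c) \<in> tangent_space M p"
  unfolding tangent_space_def mem_Collect_eq by (metis linear_add[OF linear_jac'] add_0)

lemma tangent_scale: "v \<in> tangent_space M p \<Longrightarrow> (\<lambda>c. r *\<^sub>R v c) \<in> tangent_space M p"
  unfolding tangent_space_def mem_Collect_eq by (metis linear_cmul[OF linear_jac'] scaleR_zero_right)

lemma tangent_zero: "(\<lambda>c. 0) \<in> tangent_space M p"
  unfolding tangent_space_def mem_Collect_eq by (metis linear_0[OF linear_jac'])

lemma tangent_sum:
  "(\<And>i. i \<in> I \<Longrightarrow> v i \<in> tangent_space M p) \<Longrightarrow> (\<lambda>c. \<Sum>i\<in>I. v i c) \<in> tangent_space M p"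
  by (induction I rule: infinite_finite_induct) (auto simp: tangent_zero tangent_add)

lemma tvec_of_self: "c \<in> charts_at M p \<Longrightarrow> tvec_of M c p w c = w"
  by (simp add: tvec_of_def charts_at_iff jac_self)

lemma tvec_of_tangent: "c \<in> charts_at M p \<Longrightarrow> tvec_of M c p w \<in> tangent_space M p"
  unfolding tangent_space_def tvec_of_def using jac_compose by (auto simp: charts_at_iff)

lemma vector_fieldI:
  assumes "\<And>p. p \<in> jet_space M \<Longrightarrow> X p \<in> tangent_space M p"
    and "\<And>p. p \<notin> jet_space M \<Longrightarrow> X p = (\<lambda>c. 0)"
    and "\<And>c. c \<in> jcharts M \<Longrightarrow> smooth_on (\<lambda>z. X (jinv M c z) c) (jcoord c ` jdom M c)"
  shows "X \<in> vector_fields M"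
  using assms unfolding vector_fields_def by blast

lemma vector_field_tangent: "X \<in> vector_fields M \<Longrightarrow> p \<in> jet_space M \<Longrightarrow> X p \<in> tangent_space M p"
  unfolding vector_fields_def by blast

lemma vector_field_outside: "X \<in> vector_fields M \<Longrightarrow> p \<notin> jet_space M \<Longrightarrow> X p = (\<lambda>c. 0)"
  unfolding vector_fields_def by blast

lemma vector_field_zero:
  assumes "X \<in> vector_fields M" "c \<notin> charts_at M p"
  shows "X p c = 0"
  using vector_field_outside[OF assms(1), of p] tangent_zero_outside[OF vector_field_tangent[OF assms(1)] assms(2)] by metis

lemma vector_field_smooth:
  "X \<in> vector_fields M \<Longrightarrow> c \<in> jcharts M \<Longrightarrow> smooth_on (\<lambda>z. X (jinv M c z) c) (jcoord c ` jdom M c)"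
  unfolding vector_fields_def by blast

text \<open>The analogue of \<open>smooth_fun_local\<close>: in any other chart the components arise by the smooth
  Jacobian of the change of coordinates.\<close>

lemma vector_field_local:
  assumes tan: "\<And>p. p \<in> jet_space M \<Longrightarrow> X p \<in> tangent_space M p"
    and "\<And>p. p \<notin> jet_space M \<Longrightarrow> X p = (\<lambda>c. 0)"
    and loc: "\<And>p. p \<in> jet_space M \<Longrightarrow> \<exists>c V. c \<in> jcharts M \<and> jet_open M V \<and> p \<in> V \<and> V \<subseteq> jdom M c \<and>
      smooth_on (\<lambda>z. X (jinv M c z) c) (jcoord c ` V)"
  shows "X \<in> vector_fields M"
proof -
  have "smooth_on (\<lambda>z. X (jinv M c' z) c') (jcoord c' ` jdom M c')" if c': "c' \<in> jcharts M" for c'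
  proof (rule smooth_on_local)
    fix z assume "z \<in> jcoord c' ` jdom M c'"
    then obtain p where p: "p \<in> jdom M c'" "z = jcoord c' p" by blast
    obtain c V where c: "c \<in> jcharts M" and V: "jet_open M V" "p \<in> V" "V \<subseteq> jdom M c"
      "smooth_on (\<lambda>z. X (jinv M c z) c) (jcoord c ` V)"
      using loc[of p] p jdom_subset by blast
    let ?T = "jcoord c' ` (V \<inter> jdom M c')"
    have T: "open ?T" using V(1) c' by (simp add: jet_open_def)
    have tr: "transition c' c (jcoord c' q) = jcoord c q" if "q \<in> V \<inter> jdom M c'" for q
      using jcoord_transition[OF c' c, of q] that V(3) by auto
    have trs: "smooth_on (transition c' c) ?T"
      by (rule smooth_on_subset[OF transition_smooth[OF c' c]]) (use V(3) in blast)
    have 1: "smooth_on (\<lambda>z. X (jinv M c (transition c' c z)) c) ?T"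
      by (rule smooth_on_compose[OF V(4) trs _ T open_jcoord_jet_open[OF V(1) c V(3)]]) (use tr in auto)
    have "smooth_on (\<lambda>z. FD (transition c c') (transition c' c z) (X (jinv M c (transition c' c z)) c)) ?T"
      by (rule smooth_on_FD[OF transition_smooth[OF c c'] trs 1 _ T open_overlap[OF c c']])
         (use tr V(3) in auto)
    then have "smooth_on (\<lambda>z. X (jinv M c' z) c') ?T"
    proof (rule smooth_on_cong[OF T, rotated])
      fix z assume "z \<in> ?T"
      then obtain q where q: "q \<in> V" "q \<in> jdom M c'" "z = jcoord c' q" by blast
      have qc: "q \<in> jdom M c" using q V(3) by blast
      have "X q c' = jac M c c' q (X q c)"
        by (rule tangent_transform[OF tan]) (use q qc c c' in \<open>auto simp: charts_at_iff jdom_in_jet_space\<close>)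
      then show "FD (transition c c') (transition c' c z) (X (jinv M c (transition c' c z)) c) = X (jinv M c' z) c'"
        using tr[of q] q qc c c' jac_eq_FD[OF c c', of q] by simp
    qed
    then show "\<exists>T. open T \<and> z \<in> T \<and> smooth_on (\<lambda>z. X (jinv M c' z) c') T"
      using T p V(2) by blast
  qed
  then show ?thesis
    using assms by (intro vector_fieldI)
qed

text \<open>Sum and product with a function are named so that the axioms of a connection become equations
  between vector fields.\<close>

definition vadd :: "('a, 'n) vfield \<Rightarrow> ('a, 'n) vfield \<Rightarrow> ('a, 'n) vfield" where
  "vadd X Y = (\<lambda>p c. X p c + Y p c)"

definition vscale :: "('a jet \<Rightarrow> real) \<Rightarrow> ('a, 'n) vfield \<Rightarrow> ('a, 'n) vfield" where
  "vscale f X = (\<lambda>p c. f p *\<^sub>R X p c)"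

abbreviation smooth_function :: "('a jet \<Rightarrow> real) \<Rightarrow> bool" where
  "smooth_function f \<equiv> smooth_fun M (jet_space M) f"

lemma smooth_function_iff:
  "smooth_function f \<longleftrightarrow> (\<forall>c\<in>jcharts M. smooth_on (\<lambda>z. f (jinv M c z)) (jcoord c ` jdom M c))"
  by (simp add: smooth_fun_def comp_def)

lemma smooth_function_const: "smooth_function (\<lambda>p. r)"
  by (simp add: smooth_function_iff smooth_on_const)

lemma smooth_function_mult: "smooth_function f \<Longrightarrow> smooth_function g \<Longrightarrow> smooth_function (\<lambda>p. f p * g p)"
  by (simp add: smooth_function_iff smooth_on_mult open_jcoord_image)

lemma smooth_function_minus: "smooth_function f \<Longrightarrow> smooth_function (\<lambda>p. - f p)"
  by (simp add: smooth_function_iff smooth_on_minus open_jcoord_image)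

lemma vadd_vf [intro]:
  assumes "X \<in> vector_fields M" "Y \<in> vector_fields M"
  shows "vadd X Y \<in> vector_fields M"
  unfolding vadd_def using assms
  by (intro vector_fieldI tangent_add smooth_on_add)
     (simp_all add: vector_field_tangent vector_field_outside vector_field_smooth open_jcoord_image)

lemma vscale_vf [intro]:
  assumes "smooth_function f" "X \<in> vector_fields M"
  shows "vscale f X \<in> vector_fields M"
  unfolding vscale_def using assms
  by (intro vector_fieldI tangent_scale smooth_on_scaleR)
     (simp_all add: vector_field_tangent vector_field_outside vector_field_smooth open_jcoord_image smooth_function_iff)

lemma vzero_vf: "(\<lambda>p c. 0) \<in> vector_fields M"
  by (rule vector_fieldI) (simp_all add: tangent_zero smooth_on_const)

section \<open>Bump functions and extension of local fields\<close>

text \<open>The bump function of the coordinate ball around \<open>p\<close>, continued by zero. It vanishes on the open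
  complement of a closed coordinate ball inside \<open>W\<close>, so the continuation is smooth.\<close>

lemma bump_function:
  assumes "c \<in> charts_at M p" "jet_open M W" "p \<in> W"
  obtains f W' V where "smooth_function f" "jet_open M W'" "p \<in> W'" "W' \<subseteq> W \<inter> jdom M c"
    "\<And>q. q \<in> W' \<Longrightarrow> f q = 1" "jet_open M V" "jet_space M \<subseteq> V \<union> (W \<inter> jdom M c)" "\<And>q. q \<in> V \<Longrightarrow> f q = 0"
proof -
  have c: "c \<in> jcharts M" and pc: "p \<in> jdom M c" using assms(1) by (auto simp: charts_at_iff)
  let ?Q = "jcoord c ` (W \<inter> jdom M c)"
  have "open ?Q" "jcoord c p \<in> ?Q" using assms(2,3) c pc by (auto simp: jet_open_def)
  then obtain r where r: "r > 0" "cball (jcoord c p) r \<subseteq> ?Q" using open_contains_cball by blast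
  obtain \<rho> :: "'n jcoords \<Rightarrow> real" where \<rho>: "smooth_on \<rho> UNIV" "\<And>z. z \<in> ball (jcoord c p) (r/2) \<Longrightarrow> \<rho> z = 1"
    "\<And>z. z \<notin> ball (jcoord c p) r \<Longrightarrow> \<rho> z = 0"
    by (rule smooth_bump[OF r(1), of "jcoord c p"]) blast
  define f where "f q = (if q \<in> jdom M c then \<rho> (jcoord c q) else 0)" for q
  define W' where "W' = jinv M c ` ball (jcoord c p) (r/2)"
  define V where "V = jet_space M - jinv M c ` cball (jcoord c p) r"
  have b: "ball (jcoord c p) (r/2) \<subseteq> ?Q" using r by (auto simp: subset_iff)
  have sub: "?Q \<subseteq> jcoord c ` jdom M c" by blast
  have V: "jet_open M V" unfolding V_def
    by (rule jet_open_compact_complement[OF c]) (use r sub in auto)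
  have fV: "f q = 0" if "q \<in> V" for q
  proof (cases "q \<in> jdom M c")
    case True
    then have "jcoord c q \<notin> ball (jcoord c p) r"
      using that c by (auto simp: V_def image_iff) (metis jinv_jcoord less_imp_le mem_cball)
    then show ?thesis using \<rho>(3) by (simp add: f_def)
  qed (simp add: f_def)
  have "smooth_function f"
  proof (rule smooth_fun_local)
    fix q assume q: "q \<in> jet_space M"
    show "\<exists>c V. c \<in> jcharts M \<and> jet_open M V \<and> q \<in> V \<and> V \<subseteq> jdom M c \<and> smooth_on (\<lambda>z. f (jinv M c z)) (jcoord c ` V)"
    proof (cases "q \<in> jdom M c")
      case True
      have "smooth_on (\<lambda>z. f (jinv M c z)) (jcoord c ` jdom M c)"
        by (rule smooth_on_cong[OF open_jcoord_image[OF c] _ smooth_on_subset[OF \<rho>(1)]])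
           (auto simp: f_def c)
      then show ?thesis using jet_open_jdom[OF c] c True by blast
    next
      case False
      obtain d where d: "d \<in> jcharts M" "q \<in> jdom M d" using jet_space_chart[OF q] .
      have qV: "q \<in> V" using False q r sub jinv_in_jdom unfolding V_def by blast
      have o: "jet_open M (V \<inter> jdom M d)" by (rule jet_open_Int[OF V jet_open_jdom[OF d(1)]])
      have "smooth_on (\<lambda>z. f (jinv M d z)) (jcoord d ` (V \<inter> jdom M d))"
        by (rule smooth_on_cong[OF open_jcoord_jet_open[OF o d(1)] _ smooth_on_const[of 0]]) (use fV d in auto)
      then show ?thesis using o d qV by blast
    qed
  qed
  moreover have "jet_open M W'" unfolding W'_def by (rule jet_open_jinv[OF c]) (use b in auto)
  moreover have "p \<in> W'" using r(1) c pc unfolding W'_def by (intro image_eqI[of _ _ "jcoord c p"]) auto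
  moreover have "W' \<subseteq> W \<inter> jdom M c" using b c unfolding W'_def by auto
  moreover have "f q = 1" if "q \<in> W'" for q
  proof -
    have "q \<in> jinv M c ` ball (jcoord c p) (r/2)" using that by (simp only: W'_def)
    then obtain z where z: "z \<in> ball (jcoord c p) (r/2)" "q = jinv M c z" by blast
    then have "z \<in> jcoord c ` jdom M c" using b by blast
    then show ?thesis using z \<rho>(2) by (simp add: f_def jinv_in_jdom)
  qed
  moreover have "jet_space M \<subseteq> V \<union> (W \<inter> jdom M c)"
    using r(2) c unfolding V_def by auto
  ultimately show thesis using that V fV by blast
qed

text \<open>Vector fields that are meaningful on the domain of one chart only, such as the adapted frame.\<close>

definition local_field :: "('a, 'n) jchart \<Rightarrow> ('a, 'n) vfield \<Rightarrow> bool" where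
  "local_field c X \<longleftrightarrow> (\<forall>q\<in>jdom M c. X q \<in> tangent_space M q) \<and>
     smooth_on (\<lambda>z. X (jinv M c z) c) (jcoord c ` jdom M c)"

lemma local_field_tvec_of:
  assumes c: "c \<in> jcharts M" and w: "smooth_on (\<lambda>z. w (jinv M c z)) (jcoord c ` jdom M c)"
  shows "local_field c (\<lambda>q. tvec_of M c q (w q))"
  unfolding local_field_def
proof
  show "\<forall>q\<in>jdom M c. tvec_of M c q (w q) \<in> tangent_space M q"
    using c by (auto intro!: tvec_of_tangent simp: charts_at_iff)
  show "smooth_on (\<lambda>z. tvec_of M c (jinv M c z) (w (jinv M c z)) c) (jcoord c ` jdom M c)"
    by (rule smooth_on_cong[OF open_jcoord_image[OF c] _ w])
       (use c in \<open>auto simp: tvec_of_self charts_at_iff\<close>)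
qed

text \<open>If \<open>f\<close> vanishes near the complement of the chart domain, this turns a local field into a global
  one (\<open>cutoff_vf\<close>).\<close>

definition cutoff :: "('a, 'n) jchart \<Rightarrow> ('a jet \<Rightarrow> real) \<Rightarrow> ('a, 'n) vfield \<Rightarrow> ('a, 'n) vfield" where
  "cutoff c f X = (\<lambda>q d. if q \<in> jdom M c then f q *\<^sub>R X q d else 0)"

lemma cutoff_vf:
  assumes X: "local_field c X" and c: "c \<in> jcharts M" and f: "smooth_function f"
    and V: "jet_open M V" "jet_space M \<subseteq> V \<union> jdom M c" "\<And>q. q \<in> V \<Longrightarrow> f q = 0"
  shows "cutoff c f X \<in> vector_fields M"
proof (rule vector_field_local)
  fix p assume p: "p \<in> jet_space M"
  show "cutoff c f X p \<in> tangent_space M p"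
    using X by (cases "p \<in> jdom M c") (simp_all add: cutoff_def local_field_def tangent_scale tangent_zero)
  show "\<exists>c' V. c' \<in> jcharts M \<and> jet_open M V \<and> p \<in> V \<and> V \<subseteq> jdom M c' \<and>
      smooth_on (\<lambda>z. cutoff c f X (jinv M c' z) c') (jcoord c' ` V)"
  proof (cases "p \<in> jdom M c")
    case True
    have "smooth_on (\<lambda>z. f (jinv M c z) *\<^sub>R X (jinv M c z) c) (jcoord c ` jdom M c)"
      using f X c by (intro smooth_on_scaleR) (auto simp: smooth_function_iff local_field_def open_jcoord_image)
    then have "smooth_on (\<lambda>z. cutoff c f X (jinv M c z) c) (jcoord c ` jdom M c)"
      by (rule smooth_on_cong[OF open_jcoord_image[OF c], rotated]) (simp add: cutoff_def jinv_in_jdom)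
    then show ?thesis using jet_open_jdom[OF c] c True by blast
  next
    case False
    obtain d where d: "d \<in> jcharts M" "p \<in> jdom M d" using jet_space_chart[OF p] .
    have o: "jet_open M (V \<inter> jdom M d)" by (rule jet_open_Int[OF V(1) jet_open_jdom[OF d(1)]])
    have "smooth_on (\<lambda>z. cutoff c f X (jinv M d z) d) (jcoord d ` (V \<inter> jdom M d))"
      by (rule smooth_on_cong[OF open_jcoord_jet_open[OF o d(1)] _ smooth_on_const[of 0]])
         (use V(3) d in \<open>auto simp: cutoff_def\<close>)
    then show ?thesis using o d V(2) p False by blast
  qed
next
  show "cutoff c f X p = (\<lambda>c. 0)" if "p \<notin> jet_space M" for p
  proof -
    have "p \<notin> jdom M c" using that jdom_in_jet_space by blast
    then show ?thesis by (simp add: cutoff_def)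
  qed
qed

lemma cutoff_function:
  assumes g: "smooth_on (\<lambda>z. g (jinv M c z)) (jcoord c ` jdom M c)" and c: "c \<in> jcharts M" and f: "smooth_function f"
    and V: "jet_open M V" "jet_space M \<subseteq> V \<union> jdom M c" "\<And>q. q \<in> V \<Longrightarrow> f q = 0"
  shows "smooth_function (\<lambda>q. if q \<in> jdom M c then f q * g q else 0)" (is "smooth_function ?h")
proof (rule smooth_fun_local)
  fix p assume p: "p \<in> jet_space M"
  show "\<exists>c' V. c' \<in> jcharts M \<and> jet_open M V \<and> p \<in> V \<and> V \<subseteq> jdom M c' \<and>
      smooth_on (\<lambda>z. ?h (jinv M c' z)) (jcoord c' ` V)"
  proof (cases "p \<in> jdom M c")
    case True
    have "smooth_on (\<lambda>z. f (jinv M c z) * g (jinv M c z)) (jcoord c ` jdom M c)"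
      using f g c by (intro smooth_on_mult) (auto simp: smooth_function_iff open_jcoord_image)
    then have "smooth_on (\<lambda>z. ?h (jinv M c z)) (jcoord c ` jdom M c)"
      by (rule smooth_on_cong[OF open_jcoord_image[OF c], rotated]) (simp add: jinv_in_jdom)
    then show ?thesis using jet_open_jdom[OF c] c True by blast
  next
    case False
    obtain d where d: "d \<in> jcharts M" "p \<in> jdom M d" using jet_space_chart[OF p] .
    have o: "jet_open M (V \<inter> jdom M d)" by (rule jet_open_Int[OF V(1) jet_open_jdom[OF d(1)]])
    have "smooth_on (\<lambda>z. ?h (jinv M d z)) (jcoord d ` (V \<inter> jdom M d))"
      by (rule smooth_on_cong[OF open_jcoord_jet_open[OF o d(1)] _ smooth_on_const[of 0]])
         (use V(3) d in auto)
    then show ?thesis using o d V(2) p False by blast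
  qed
qed

lemma local_field_extension:
  assumes "local_field c X" "c \<in> charts_at M p"
  obtains X' where "X' \<in> vector_fields M" "eq_near M p X' X"
proof -
  have c: "c \<in> jcharts M" "p \<in> jdom M c" using assms(2) by (auto simp: charts_at_iff)
  obtain f W' V where f: "smooth_function f" "jet_open M W'" "p \<in> W'" "W' \<subseteq> jdom M c"
    "\<And>q. q \<in> W' \<Longrightarrow> f q = 1" "jet_open M V" "jet_space M \<subseteq> V \<union> jdom M c" "\<And>q. q \<in> V \<Longrightarrow> f q = 0"
    using bump_function[OF assms(2) jet_open_jdom[OF c(1)] c(2)] by auto
  have "cutoff c f X \<in> vector_fields M"
    by (rule cutoff_vf[OF assms(1) c(1) f(1) f(6-8)])
  moreover have "eq_near M p (cutoff c f X) X"
    unfolding eq_near_def using f by (intro exI[of _ W']) (auto simp: cutoff_def subset_iff)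
  ultimately show thesis by (rule that)
qed

lemma eq_near_at: "eq_near M p X Y \<Longrightarrow> X p = Y p"
  by (auto simp: eq_near_def)

lemma vector_field_through:
  assumes "p \<in> jet_space M" "v \<in> tangent_space M p"
  obtains X where "X \<in> vector_fields M" "X p = v"
proof -
  obtain c where c: "c \<in> charts_at M p" using charts_at_nonempty[OF assms(1)] .
  have "local_field c (\<lambda>q. tvec_of M c q (v c))"
    by (rule local_field_tvec_of) (use c in \<open>auto simp: charts_at_iff smooth_on_const\<close>)
  then obtain X where "X \<in> vector_fields M" "eq_near M p X (\<lambda>q. tvec_of M c q (v c))"
    using local_field_extension c by blast
  moreover from this have "X p = v"
    using eq_near_at tangent_eqI[OF tvec_of_tangent[OF c] assms(2) c tvec_of_self[OF c]] by metis
  ultimately show thesis using that by blast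
qed


section \<open>The Lie bracket\<close>

lemma vector_field_transition:
  assumes X: "X \<in> vector_fields M" and c: "c \<in> jcharts M" "c' \<in> jcharts M" "q \<in> jdom M c \<inter> jdom M c'"
  shows "X q c' = FD (transition c c') (jcoord c q) (X q c)"
  using tangent_transform[OF vector_field_tangent[OF X], of q c c'] c jac_eq_FD[OF c]
  by (simp add: charts_at_iff jdom_in_jet_space)

text \<open>Differentiating the relation \<open>Y' \<circ> T = DT(Y)\<close> between the components of \<open>Y\<close> in two charts, with
  \<open>T\<close> the change of coordinates, produces besides the tensorial term one that contains the second
  derivative of \<open>T\<close>. That term is symmetric in \<open>X\<close> and \<open>Y\<close> and cancels in the bracket.\<close>

lemma lie_bracket_transform:
  assumes X: "X \<in> vector_fields M" and Y: "Y \<in> vector_fields M"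
    and c: "c \<in> jcharts M" "c' \<in> jcharts M" and p: "p \<in> jdom M c \<inter> jdom M c'"
  shows "FD (\<lambda>z. Y (jinv M c' z) c') (jcoord c' p) (X p c')
    = FD (\<lambda>y. FD (transition c c') y (Y p c)) (jcoord c p) (X p c)
      + jac M c c' p (FD (\<lambda>z. Y (jinv M c z) c) (jcoord c p) (X p c))"
proof -
  let ?T = "transition c c'" and ?Y = "\<lambda>z. Y (jinv M c z) c" and ?Y' = "\<lambda>z. Y (jinv M c' z) c'"
  let ?z = "jcoord c p" and ?Q = "jcoord c ` (jdom M c \<inter> jdom M c')"
  note Ts = transition_smooth[OF c] and Q = open_overlap[OF c]
  have z: "?z \<in> ?Q" using p by blast
  have T: "?T (jcoord c q) = jcoord c' q" if "q \<in> jdom M c \<inter> jdom M c'" for q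
    using jcoord_transition[OF c that] by simp
  have "(?Y has_derivative FD ?Y ?z) (at ?z)"
    by (rule smooth_on_has_derivative[OF vector_field_smooth[OF Y c(1)]]) (use p in auto)
  from has_derivative_FD[OF Ts Q z this]
  have 1: "((\<lambda>y. FD ?T y (?Y y)) has_derivative (\<lambda>u. FD (\<lambda>y. FD ?T y (Y p c)) ?z u + FD ?T ?z (FD ?Y ?z u))) (at ?z)"
    using c p by simp
  have "(?Y' has_derivative FD ?Y' (?T ?z)) (at (?T ?z))"
    unfolding T[OF p] by (rule smooth_on_has_derivative[OF vector_field_smooth[OF Y c(2)]]) (use p in auto)
  from has_derivative_compose[OF smooth_on_has_derivative[OF Ts z] this]
  have "((\<lambda>y. ?Y' (?T y)) has_derivative (\<lambda>u. FD ?Y' (?T ?z) (FD ?T ?z u))) (at ?z)" .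
  then have "((\<lambda>y. FD ?T y (?Y y)) has_derivative (\<lambda>u. FD ?Y' (?T ?z) (FD ?T ?z u))) (at ?z)"
  proof (rule has_derivative_transform_within_open[OF _ Q z])
    fix y assume "y \<in> ?Q"
    then obtain q where "q \<in> jdom M c \<inter> jdom M c'" "y = jcoord c q" by blast
    then show "?Y' (?T y) = FD ?T y (?Y y)"
      using T[of q] vector_field_transition[OF Y c, of q] c by simp
  qed
  from has_derivative_unique[OF this 1]
  have "FD ?Y' (?T ?z) (FD ?T ?z (X p c))
     = FD (\<lambda>y. FD ?T y (Y p c)) ?z (X p c) + FD ?T ?z (FD ?Y ?z (X p c))" by (rule fun_cong)
  then show ?thesis
    unfolding T[OF p] vector_field_transition[OF X c p, symmetric] jac_eq_FD[OF c p] .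
qed

lemma lie_bracket_vf [intro]:
  assumes X: "X \<in> vector_fields M" and Y: "Y \<in> vector_fields M"
  shows "lie_bracket M X Y \<in> vector_fields M"
proof (rule vector_fieldI)
  fix p assume "p \<in> jet_space M"
  show "lie_bracket M X Y p \<in> tangent_space M p"
    unfolding tangent_space_def mem_Collect_eq
  proof (intro conjI ballI allI impI)
    fix c c' assume "c \<in> charts_at M p" "c' \<in> charts_at M p"
    then have c: "c \<in> jcharts M" "c' \<in> jcharts M" and p: "p \<in> jdom M c \<inter> jdom M c'"
      and ch: "c \<in> charts_at M p" "c' \<in> charts_at M p" by (auto simp: charts_at_iff)
    have sym: "FD (\<lambda>y. FD (transition c c') y (Y p c)) (jcoord c p) (X p c)
       = FD (\<lambda>y. FD (transition c c') y (X p c)) (jcoord c p) (Y p c)"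
      by (rule FD_symmetric[OF transition_smooth[OF c] open_overlap[OF c]]) (use p in blast)
    show "lie_bracket M X Y p c' = jac M c c' p (lie_bracket M X Y p c)"
      unfolding lie_bracket_def if_P[OF ch(1)] if_P[OF ch(2)]
        lie_bracket_transform[OF X Y c p] lie_bracket_transform[OF Y X c p] sym
        linear_diff[OF linear_jac[OF c p]] by simp
  qed (simp add: lie_bracket_def)
next
  fix p assume "p \<notin> jet_space M"
  then have "c \<notin> charts_at M p" for c
    using jdom_in_jet_space charts_at_iff by blast
  then show "lie_bracket M X Y p = (\<lambda>c. 0)"
    by (simp add: lie_bracket_def)
next
  fix c assume c: "c \<in> jcharts M"
  let ?D = "jcoord c ` jdom M c"
  note D = open_jcoord_image[OF c] and XY = vector_field_smooth[OF X c] vector_field_smooth[OF Y c]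
  have "smooth_on (\<lambda>z. FD (\<lambda>z. Y (jinv M c z) c) z (X (jinv M c z) c) - FD (\<lambda>z. X (jinv M c z) c) z (Y (jinv M c z) c)) ?D"
    by (intro smooth_on_diff smooth_on_FD[OF _ smooth_on_linear[OF bounded_linear_ident] _ _ D D] XY D) auto
  then show "smooth_on (\<lambda>z. lie_bracket M X Y (jinv M c z) c) ?D"
    by (rule smooth_on_cong[OF D, rotated]) (auto simp: lie_bracket_def charts_at_iff c)
qed

text \<open>The function \<open>X f\<close> as a global function; the choice of the chart does not matter by
  \<open>vf_apply_chart_independent\<close>.\<close>

definition directional :: "('a, 'n) vfield \<Rightarrow> ('a jet \<Rightarrow> real) \<Rightarrow> 'a jet \<Rightarrow> real" where
  "directional X f p = (if p \<in> jet_space M then vf_apply M (SOME c. c \<in> charts_at M p) X f p else 0)"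

lemma smooth_function_at:
  "smooth_function f \<Longrightarrow> c \<in> charts_at M p \<Longrightarrow>
    ((f \<circ> jinv M c) has_derivative FD (f \<circ> jinv M c) (jcoord c p)) (at (jcoord c p))"
  by (rule smooth_on_has_derivative[of _ "jcoord c ` jdom M c"])
     (auto simp: smooth_function_iff charts_at_iff comp_def)

lemma vf_apply_chart_independent:
  assumes X: "X \<in> vector_fields M" and f: "smooth_function f" and ch: "c \<in> charts_at M p" "c' \<in> charts_at M p"
  shows "vf_apply M c' X f p = vf_apply M c X f p"
proof -
  have c: "c \<in> jcharts M" "c' \<in> jcharts M" and p: "p \<in> jdom M c \<inter> jdom M c'"
    using ch by (auto simp: charts_at_iff)
  let ?T = "transition c c'" and ?z = "jcoord c p"
  have z: "?z \<in> jcoord c ` (jdom M c \<inter> jdom M c')" using p by blast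
  have T: "?T (jcoord c q) = jcoord c' q" if "q \<in> jdom M c \<inter> jdom M c'" for q
    using jcoord_transition[OF c that] by simp
  have "((f \<circ> jinv M c') has_derivative FD (f \<circ> jinv M c') (?T ?z)) (at (?T ?z))"
    unfolding T[OF p] by (rule smooth_function_at[OF f ch(2)])
  from has_derivative_compose[OF smooth_on_has_derivative[OF transition_smooth[OF c] z] this]
  have "((f \<circ> jinv M c) has_derivative (\<lambda>u. FD (f \<circ> jinv M c') (?T ?z) (FD ?T ?z u))) (at ?z)"
    by (rule has_derivative_transform_within_open[OF _ open_overlap[OF c] z]) (use T c in auto)
  from FD_eqI[OF this] show ?thesis
    unfolding vf_apply_def T[OF p] vector_field_transition[OF X c p] by simp
qed

lemma directional_eq:
  assumes X: "X \<in> vector_fields M" and f: "smooth_function f" and c: "c \<in> charts_at M p"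
  shows "directional X f p = FD (f \<circ> jinv M c) (jcoord c p) (X p c)"
proof -
  have "p \<in> jet_space M" using c unfolding charts_at_iff by (blast intro: jdom_in_jet_space)
  moreover have "(SOME c. c \<in> charts_at M p) \<in> charts_at M p" using c by (rule someI)
  ultimately show ?thesis
    using vf_apply_chart_independent[OF X f c] by (simp add: directional_def vf_apply_def)
qed

lemma directional_smooth:
  assumes X: "X \<in> vector_fields M" and f: "smooth_function f"
  shows "smooth_function (directional X f)"
  unfolding smooth_function_iff
proof
  fix c assume c: "c \<in> jcharts M"
  let ?D = "jcoord c ` jdom M c"
  note D = open_jcoord_image[OF c]
  have fs: "smooth_on (f \<circ> jinv M c) ?D" using f c by (simp add: smooth_function_iff comp_def)
  have "smooth_on (\<lambda>z. FD (f \<circ> jinv M c) z (X (jinv M c z) c)) ?D"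
    by (rule smooth_on_FD[OF fs smooth_on_linear[OF bounded_linear_ident] vector_field_smooth[OF X c] _ D D]) auto
  then show "smooth_on (\<lambda>z. directional X f (jinv M c z)) ?D"
    by (rule smooth_on_cong[OF D, rotated]) (auto simp: directional_eq[OF X f, of c] charts_at_iff c)
qed

lemma directional_lie_bracket:
  assumes X: "X \<in> vector_fields M" and Y: "Y \<in> vector_fields M" and f: "smooth_function f" and p: "p \<in> jet_space M"
  shows "directional (lie_bracket M X Y) f p = directional X (directional Y f) p - directional Y (directional X f) p"
proof -
  obtain c where c: "c \<in> jcharts M" "p \<in> jdom M c" using jet_space_chart[OF p] .
  have ch: "c \<in> charts_at M p" using c by (simp add: charts_at_iff)
  let ?D = "jcoord c ` jdom M c" and ?F = "f \<circ> jinv M c" and ?z = "jcoord c p"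
  note D = open_jcoord_image[OF c(1)]
  have z: "?z \<in> ?D" using c by blast
  have F: "smooth_on ?F ?D" using f c by (simp add: smooth_function_iff comp_def)
  have second: "directional X (directional Y f) p
      = FD (\<lambda>y. FD ?F y (Y p c)) ?z (X p c) + FD ?F ?z (FD (\<lambda>z. Y (jinv M c z) c) ?z (X p c))"
    if X: "X \<in> vector_fields M" and Y: "Y \<in> vector_fields M" for X Y
  proof -
    from has_derivative_FD[OF F D z smooth_on_has_derivative[OF vector_field_smooth[OF Y c(1)] z]]
    have "((\<lambda>y. FD ?F y (Y (jinv M c y) c)) has_derivative
      (\<lambda>u. FD (\<lambda>y. FD ?F y (Y p c)) ?z u + FD ?F ?z (FD (\<lambda>z. Y (jinv M c z) c) ?z u))) (at ?z)"
      using c by simp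
    then have "((directional Y f \<circ> jinv M c) has_derivative
      (\<lambda>u. FD (\<lambda>y. FD ?F y (Y p c)) ?z u + FD ?F ?z (FD (\<lambda>z. Y (jinv M c z) c) ?z u))) (at ?z)"
      by (rule has_derivative_transform_within_open[OF _ D z])
         (auto simp: directional_eq[OF Y f, of c] charts_at_iff c(1))
    from FD_eqI[OF this] show ?thesis
      by (simp add: directional_eq[OF X directional_smooth[OF Y f] ch])
  qed
  have sym: "FD (\<lambda>y. FD ?F y (Y p c)) ?z (X p c) = FD (\<lambda>y. FD ?F y (X p c)) ?z (Y p c)"
    by (rule FD_symmetric[OF F D z])
  have "directional (lie_bracket M X Y) f p = FD ?F ?z (lie_bracket M X Y p c)"
    by (rule directional_eq[OF lie_bracket_vf[OF X Y] f ch])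
  then show ?thesis
    unfolding second[OF X Y] second[OF Y X] sym
    by (simp add: lie_bracket_def ch linear_diff[OF smooth_on_FD_linear[OF F z]])
qed

lemma lie_bracket_antisym: "lie_bracket M Y X = vscale (\<lambda>p. -1) (lie_bracket M X Y)"
  by (intro ext) (simp add: lie_bracket_def vscale_def)

lemma lie_bracket_add_left:
  assumes X: "X \<in> vector_fields M" and X': "X' \<in> vector_fields M" and Y: "Y \<in> vector_fields M"
  shows "lie_bracket M (vadd X X') Y = vadd (lie_bracket M X Y) (lie_bracket M X' Y)"
proof (intro ext)
  fix p c
  show "lie_bracket M (vadd X X') Y p c = vadd (lie_bracket M X Y) (lie_bracket M X' Y) p c"
  proof (cases "c \<in> charts_at M p")
    case True
    then have c: "c \<in> jcharts M" "p \<in> jdom M c" by (auto simp: charts_at_iff)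
    then have z: "jcoord c p \<in> jcoord c ` jdom M c" by blast
    note dX = smooth_on_has_derivative[OF vector_field_smooth[OF X c(1)] z]
      and dX' = smooth_on_has_derivative[OF vector_field_smooth[OF X' c(1)] z]
    have "linear (FD (\<lambda>z. Y (jinv M c z) c) (jcoord c p))"
      by (rule smooth_on_FD_linear[OF vector_field_smooth[OF Y c(1)] z])
    then show ?thesis
      using True FD_eqI[OF has_derivative_add[OF dX dX']]
      by (simp add: lie_bracket_def vadd_def linear_add)
  qed (simp add: lie_bracket_def vadd_def)
qed

lemma lie_bracket_scale_left:
  assumes X: "X \<in> vector_fields M" and Y: "Y \<in> vector_fields M" and f: "smooth_function f"
  shows "lie_bracket M (vscale f X) Y = vadd (vscale f (lie_bracket M X Y)) (vscale (\<lambda>p. - directional Y f p) X)"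
proof (intro ext)
  fix p c
  show "lie_bracket M (vscale f X) Y p c = vadd (vscale f (lie_bracket M X Y)) (vscale (\<lambda>p. - directional Y f p) X) p c"
  proof (cases "c \<in> charts_at M p")
    case True
    then have c: "c \<in> jcharts M" "p \<in> jdom M c" by (auto simp: charts_at_iff)
    then have z: "jcoord c p \<in> jcoord c ` jdom M c" by blast
    note dX = smooth_on_has_derivative[OF vector_field_smooth[OF X c(1)] z]
      and df = smooth_function_at[OF f True]
    have "linear (FD (\<lambda>z. Y (jinv M c z) c) (jcoord c p))"
      by (rule smooth_on_FD_linear[OF vector_field_smooth[OF Y c(1)] z])
    then show ?thesis
      using True FD_eqI[OF has_derivative_scaleR[OF df dX]] c
      by (simp add: lie_bracket_def vadd_def vscale_def linear_cmul directional_eq[OF Y f True] scaleR_diff_right)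
  qed (simp add: lie_bracket_def vadd_def vscale_def vector_field_zero[OF X])
qed

lemma lie_bracket_eq_near:
  assumes "eq_near M p X' X" "eq_near M p Y' Y"
  shows "eq_near M p (lie_bracket M X' Y') (lie_bracket M X Y)"
proof -
  obtain V W where V: "jet_open M V" "p \<in> V" "\<And>q. q \<in> V \<Longrightarrow> X' q = X q"
    and W: "jet_open M W" "p \<in> W" "\<And>q. q \<in> W \<Longrightarrow> Y' q = Y q"
    using assms unfolding eq_near_def by blast
  have VW: "jet_open M (V \<inter> W)" by (rule jet_open_Int[OF V(1) W(1)])
  have "lie_bracket M X' Y' q c = lie_bracket M X Y q c" if q: "q \<in> V \<inter> W" for q c
  proof (cases "c \<in> charts_at M q")
    case True
    then have c: "c \<in> jcharts M" "q \<in> jdom M c" by (auto simp: charts_at_iff)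
    let ?O = "jcoord c ` (V \<inter> W \<inter> jdom M c)"
    have opn: "open ?O" using VW c(1) by (simp add: jet_open_def)
    have "jcoord c q \<in> ?O" using q c by blast
    note cong = FD_cong_open[OF opn this]
    have 1: "FD (\<lambda>z. X' (jinv M c z) c) (jcoord c q) = FD (\<lambda>z. X (jinv M c z) c) (jcoord c q)"
      by (rule cong) (use V(3) c in auto)
    have 2: "FD (\<lambda>z. Y' (jinv M c z) c) (jcoord c q) = FD (\<lambda>z. Y (jinv M c z) c) (jcoord c q)"
      by (rule cong) (use W(3) c in auto)
    show ?thesis using q V(3) W(3) by (simp add: lie_bracket_def 1 2)
  qed (simp add: lie_bracket_def)
  then show ?thesis
    unfolding eq_near_def using VW V(2) W(2) by (intro exI[of _ "V \<inter> W"]) auto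
qed


section \<open>Tensorial maps act pointwise\<close>

lemma eq_near_sym: "eq_near M p X Y \<Longrightarrow> eq_near M p Y X"
  unfolding eq_near_def by metis

lemma eq_near_trans: "eq_near M p X Y \<Longrightarrow> eq_near M p Y Z \<Longrightarrow> eq_near M p X Z"
  unfolding eq_near_def by (metis (no_types, opaque_lifting) IntE IntI jet_open_Int)

lemma eq_near_jet_space: "eq_near M p X Y \<Longrightarrow> p \<in> jet_space M"
  unfolding eq_near_def jet_open_def by blast

lemma eq_near_nearby:
  assumes "eq_near M p X Y"
  obtains W where "jet_open M W" "p \<in> W" "\<And>q. q \<in> W \<Longrightarrow> eq_near M q X Y"
  using assms unfolding eq_near_def by blast

definition vsum :: "'i set \<Rightarrow> ('i \<Rightarrow> ('a, 'n) vfield) \<Rightarrow> ('a, 'n) vfield" where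
  "vsum I F = (\<lambda>p c. \<Sum>i\<in>I. F i p c)"

lemma vsum_vf:
  assumes "finite I" "\<And>i. i \<in> I \<Longrightarrow> F i \<in> vector_fields M"
  shows "vsum I F \<in> vector_fields M"
  using assms
proof (induction I rule: finite_induct)
  case empty
  then show ?case by (simp add: vsum_def vzero_vf)
next
  case (insert i I)
  then have "vsum (insert i I) F = vadd (F i) (vsum I F)"
    by (simp add: vsum_def vadd_def)
  then show ?case using insert by auto
qed

text \<open>Linearity over the ring of smooth functions on the jet space.\<close>

definition tensorial :: "(('a, 'n) vfield \<Rightarrow> ('a, 'n) vfield) \<Rightarrow> bool" where
  "tensorial \<Phi> \<longleftrightarrow> (\<forall>X\<in>vector_fields M. \<forall>Y\<in>vector_fields M. \<Phi> (vadd X Y) = vadd (\<Phi> X) (\<Phi> Y)) \<and>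
     (\<forall>f. smooth_function f \<longrightarrow> (\<forall>X\<in>vector_fields M. \<Phi> (vscale f X) = vscale f (\<Phi> X)))"

lemma tensorial_vadd:
  "tensorial \<Phi> \<Longrightarrow> X \<in> vector_fields M \<Longrightarrow> Y \<in> vector_fields M \<Longrightarrow> \<Phi> (vadd X Y) = vadd (\<Phi> X) (\<Phi> Y)"
  unfolding tensorial_def by blast

lemma tensorial_vscale:
  "tensorial \<Phi> \<Longrightarrow> smooth_function f \<Longrightarrow> X \<in> vector_fields M \<Longrightarrow> \<Phi> (vscale f X) = vscale f (\<Phi> X)"
  unfolding tensorial_def by blast

lemma tensorial_zero: "tensorial \<Phi> \<Longrightarrow> \<Phi> (\<lambda>p c. 0) = (\<lambda>p c. 0)"
  using tensorial_vscale[OF _ smooth_function_const[of 0] vzero_vf] by (simp add: vscale_def)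

lemma tensorial_vsum:
  assumes "tensorial \<Phi>" "finite I" "\<And>i. i \<in> I \<Longrightarrow> F i \<in> vector_fields M"
  shows "\<Phi> (vsum I F) = vsum I (\<lambda>i. \<Phi> (F i))"
  using assms(2,3)
proof (induction I rule: finite_induct)
  case empty
  then show ?case using tensorial_zero[OF assms(1)] by (simp add: vsum_def)
next
  case (insert i I)
  have 1: "vsum (insert i I) G = vadd (G i) (vsum I G)" for G :: "'b \<Rightarrow> ('a, 'n) vfield"
    using insert by (simp add: vsum_def vadd_def)
  show ?case
    unfolding 1 using insert tensorial_vadd[OF assms(1)] vsum_vf[of I F] by auto
qed

text \<open>Let \<open>f\<close> be a bump function at \<open>p\<close> supported in a chart. There \<open>f\<^sup>2 X\<close> is a combination of
  global fields \<open>f E\<^sub>b\<close>, with \<open>E\<^sub>b\<close> the coordinate fields, with the global coefficients \<open>f X\<^sup>b\<close>. The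
  latter vanish at \<open>p\<close>; linearity over the functions then gives the claim, since \<open>f p = 1\<close>.\<close>

lemma tensorial_vanishes:
  assumes \<Phi>: "tensorial \<Phi>" and X: "X \<in> vector_fields M" and p: "p \<in> jet_space M" and Xp: "X p = (\<lambda>c. 0)"
  shows "\<Phi> X p = (\<lambda>c. 0)"
proof -
  obtain c where ch: "c \<in> charts_at M p" using charts_at_nonempty[OF p] .
  then have c: "c \<in> jcharts M" "p \<in> jdom M c" by (auto simp: charts_at_iff)
  obtain f W V where f: "smooth_function f" "p \<in> W" "W \<subseteq> jdom M c"
    "\<And>q. q \<in> W \<Longrightarrow> f q = 1" "jet_open M V" "jet_space M \<subseteq> V \<union> jdom M c" "\<And>q. q \<in> V \<Longrightarrow> f q = 0"
    by (rule bump_function[OF ch jet_open_jdom[OF c(1)] c(2)]) auto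
  define g where "g b = (\<lambda>q. if q \<in> jdom M c then f q * (X q c \<bullet> b) else 0)" for b
  define F where "F b = cutoff c f (\<lambda>q. tvec_of M c q b)" for b
  have g: "smooth_function (g b)" for b
    unfolding g_def
    by (rule cutoff_function[OF _ c(1) f(1) f(5-7)])
       (intro smooth_on_inner_left vector_field_smooth[OF X c(1)] open_jcoord_image[OF c(1)])
  have F: "F b \<in> vector_fields M" for b
    unfolding F_def
    by (rule cutoff_vf[OF _ c(1) f(1) f(5-7)]) (rule local_field_tvec_of[OF c(1) smooth_on_const])
  (* one factor f makes the coefficients global, the other one the coordinate fields *)
  have ff: "smooth_function (\<lambda>p. f p * f p)" by (rule smooth_function_mult[OF f(1) f(1)])
  have eq: "vscale (\<lambda>p. f p * f p) X = vsum Basis (\<lambda>b. vscale (g b) (F b))"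
  proof
    fix q
    show "vscale (\<lambda>p. f p * f p) X q = vsum Basis (\<lambda>b. vscale (g b) (F b)) q"
    proof (cases "q \<in> jdom M c")
      case False
      then have "q \<in> V \<or> q \<notin> jet_space M" using f(6) by blast
      then show ?thesis
        using False f(7)[of q] vector_field_outside[OF X, of q] by (auto simp: vscale_def vsum_def g_def)
    next
      case True
      have cq: "c \<in> charts_at M q" using True c by (simp add: charts_at_iff)
      have "vsum Basis (\<lambda>b. vscale (g b) (F b)) \<in> vector_fields M"
        by (rule vsum_vf[OF finite_Basis vscale_vf[OF g F]])
      note T = vector_field_tangent[OF this jdom_in_jet_space[OF True]]
        vector_field_tangent[OF vscale_vf[OF ff X] jdom_in_jet_space[OF True]]
      have "(\<Sum>b\<in>Basis. (f q * (X q c \<bullet> b)) *\<^sub>R f q *\<^sub>R b) = (f q * f q) *\<^sub>R (\<Sum>b\<in>Basis. (X q c \<bullet> b) *\<^sub>R b)"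
        by (simp add: scaleR_sum_right mult_ac)
      then have "vscale (\<lambda>p. f p * f p) X q c = vsum Basis (\<lambda>b. vscale (g b) (F b)) q c"
        using True by (simp add: vscale_def vsum_def g_def F_def cutoff_def tvec_of_self[OF cq] euclidean_representation)
      then show ?thesis using tangent_eqI[OF T(2,1) cq] by blast
    qed
  qed
  have "\<Phi> (vscale (\<lambda>p. f p * f p) X) = vsum Basis (\<lambda>b. vscale (g b) (\<Phi> (F b)))"
    unfolding eq using tensorial_vsum[OF \<Phi> finite_Basis vscale_vf[OF g F]] tensorial_vscale[OF \<Phi> g F]
    by simp
  then have "vscale (\<lambda>p. f p * f p) (\<Phi> X) p = vsum Basis (\<lambda>b. vscale (g b) (\<Phi> (F b))) p"
    using tensorial_vscale[OF \<Phi> ff X] by simp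
  moreover have "f p = 1" "g b p = 0" for b using f(4)[OF f(2)] Xp by (simp_all add: g_def)
  ultimately show ?thesis by (simp add: vscale_def vsum_def)
qed

lemma tensorial_pointwise:
  assumes \<Phi>: "tensorial \<Phi>" and X: "X \<in> vector_fields M" and Y: "Y \<in> vector_fields M" and p: "p \<in> jet_space M"
    and eq: "X p = Y p"
  shows "\<Phi> X p = \<Phi> Y p"
proof -
  let ?m = "vscale (\<lambda>p. -1) Y"
  have m: "?m \<in> vector_fields M" by (rule vscale_vf[OF smooth_function_const Y])
  have "\<Phi> (vadd X ?m) p = (\<lambda>c. 0)"
    by (rule tensorial_vanishes[OF \<Phi> vadd_vf[OF X m] p]) (simp add: vadd_def vscale_def eq)
  moreover have "\<Phi> (vadd X ?m) = vadd (\<Phi> X) (vscale (\<lambda>p. -1) (\<Phi> Y))"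
    using tensorial_vadd[OF \<Phi> X m] tensorial_vscale[OF \<Phi> smooth_function_const Y] by simp
  ultimately have "(\<lambda>c. \<Phi> X p c - \<Phi> Y p c) = (\<lambda>c. 0)"
    by (simp add: vadd_def vscale_def)
  then have "\<Phi> X p c - \<Phi> Y p c = 0" for c by (rule fun_cong)
  then show ?thesis by (intro ext) simp
qed

text \<open>Linearity on the tangent space at one jet.\<close>

definition tangent_linear :: "'a jet \<Rightarrow> (('a, 'n) tvec \<Rightarrow> ('a, 'n) tvec) \<Rightarrow> bool" where
  "tangent_linear p F \<longleftrightarrow>
    (\<forall>v\<in>tangent_space M p. \<forall>w\<in>tangent_space M p. F (\<lambda>c. v c + w c) = (\<lambda>c. F v c + F w c)) \<and>
    (\<forall>r. \<forall>v\<in>tangent_space M p. F (\<lambda>c. r *\<^sub>R v c) = (\<lambda>c. r *\<^sub>R F v c))"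

lemma tangent_linear_sum:
  assumes F: "tangent_linear p F" and "finite I" "\<And>i. i \<in> I \<Longrightarrow> v i \<in> tangent_space M p"
  shows "F (\<lambda>c. \<Sum>i\<in>I. a i *\<^sub>R v i c) = (\<lambda>c. \<Sum>i\<in>I. a i *\<^sub>R F (v i) c)"
  using assms(2,3)
proof (induction I rule: finite_induct)
  case empty
  have "\<forall>r. \<forall>v\<in>tangent_space M p. F (\<lambda>c. r *\<^sub>R v c) = (\<lambda>c. r *\<^sub>R F v c)"
    using F unfolding tangent_linear_def by (rule conjunct2)
  from bspec[OF spec[OF this, of 0] tangent_zero]
  have "F (\<lambda>c. 0 *\<^sub>R 0) = (\<lambda>c. 0 *\<^sub>R F (\<lambda>c. 0) c)" .
  then show ?case by simp
next
  case (insert i I)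
  have "F (\<lambda>c. (\<lambda>c. a i *\<^sub>R v i c) c + (\<lambda>c. \<Sum>i\<in>I. a i *\<^sub>R v i c) c)
     = (\<lambda>c. F (\<lambda>c. a i *\<^sub>R v i c) c + F (\<lambda>c. \<Sum>i\<in>I. a i *\<^sub>R v i c) c)"
    using F insert.prems unfolding tangent_linear_def by (simp add: tangent_scale tangent_sum)
  moreover have "F (\<lambda>c. a i *\<^sub>R v i c) = (\<lambda>c. a i *\<^sub>R F (v i) c)"
    using F insert.prems unfolding tangent_linear_def by simp
  ultimately show ?case using insert by simp
qed

end

section \<open>Locality of connections and tensoriality of the curvature\<close>

locale jet_connection = jets M for M :: "('a, 'n::finite) manifold" +
  fixes nab :: "('a, 'n) vfield \<Rightarrow> ('a, 'n) vfield \<Rightarrow> ('a, 'n) vfield"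
  assumes connection: "linear_connection M nab"
begin

lemma nab_vf [intro]: "X \<in> vector_fields M \<Longrightarrow> Y \<in> vector_fields M \<Longrightarrow> nab X Y \<in> vector_fields M"
  using connection unfolding linear_connection_def by blast

lemma nab_add_left:
  assumes "X \<in> vector_fields M" "Y \<in> vector_fields M" "Z \<in> vector_fields M"
  shows "nab (vadd X Y) Z = vadd (nab X Z) (nab Y Z)"
  using connection assms unfolding linear_connection_def vadd_def by blast

lemma nab_add_right:
  assumes "X \<in> vector_fields M" "Y \<in> vector_fields M" "Z \<in> vector_fields M"
  shows "nab X (vadd Y Z) = vadd (nab X Y) (nab X Z)"
  using connection assms unfolding linear_connection_def vadd_def by blast

lemma nab_scale_left:
  assumes "smooth_function f" "X \<in> vector_fields M" "Y \<in> vector_fields M"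
  shows "nab (vscale f X) Y = vscale f (nab X Y)"
  using connection assms unfolding linear_connection_def vscale_def by blast

text \<open>The Leibniz rule in terms of the global function \<open>X f\<close>. In charts that do not contain the jet both
  sides vanish with \<open>Y\<close>.\<close>

lemma nab_scale_right:
  assumes f: "smooth_function f" and X: "X \<in> vector_fields M" and Y: "Y \<in> vector_fields M"
  shows "nab X (vscale f Y) = vadd (vscale f (nab X Y)) (vscale (directional X f) Y)"
proof (intro ext)
  fix p c
  have "nab X (vscale f Y) = (\<lambda>p c. f p *\<^sub>R nab X Y p c + vf_apply M c X f p *\<^sub>R Y p c)"
    using connection assms unfolding linear_connection_def vscale_def by blast
  moreover have "vf_apply M c X f p *\<^sub>R Y p c = directional X f p *\<^sub>R Y p c"
    using directional_eq[OF X f] vector_field_zero[OF Y] unfolding vf_apply_def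
    by (cases "c \<in> charts_at M p") simp_all
  ultimately show "nab X (vscale f Y) p c = vadd (vscale f (nab X Y)) (vscale (directional X f) Y) p c"
    by (simp add: vadd_def vscale_def)
qed

lemma nab_tensorial: "Y \<in> vector_fields M \<Longrightarrow> tensorial (\<lambda>X. nab X Y)"
  unfolding tensorial_def using nab_add_left nab_scale_left by blast

text \<open>In the first argument a connection is tensorial. In the second one choose \<open>f\<close> with \<open>f p = 1\<close> and
  support where \<open>Y\<close> and \<open>Y'\<close> agree: then \<open>f Y = f Y'\<close>, and in the Leibniz rule at \<open>p\<close> the terms with
  the derivative of \<open>f\<close> coincide because \<open>Y p = Y' p\<close>.\<close>

lemma nab_local:
  assumes X: "X \<in> vector_fields M" "X' \<in> vector_fields M" and Y: "Y \<in> vector_fields M" "Y' \<in> vector_fields M"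
    and p: "p \<in> jet_space M" and eq: "X p = X' p" "eq_near M p Y Y'"
  shows "nab X Y p = nab X' Y' p"
proof -
  obtain W where W: "jet_open M W" "p \<in> W" "\<And>q. q \<in> W \<Longrightarrow> Y q = Y' q"
    using eq(2) unfolding eq_near_def by blast
  obtain c where ch: "c \<in> charts_at M p" using charts_at_nonempty[OF p] .
  obtain f W' V where f: "smooth_function f" "p \<in> W'" "\<And>q. q \<in> W' \<Longrightarrow> f q = 1"
     "jet_space M \<subseteq> V \<union> (W \<inter> jdom M c)" "\<And>q. q \<in> V \<Longrightarrow> f q = 0"
    using bump_function[OF ch W(1,2)] by metis
  have "vscale f Y = vscale f Y'"
  proof (intro ext)
    fix q c
    show "vscale f Y q c = vscale f Y' q c"
    proof -
      consider "q \<in> V" | "q \<in> W" | "q \<notin> jet_space M" using f(4) by blast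
      then show ?thesis
        using f(5)[of q] W(3)[of q] vector_field_outside[OF Y(1), of q] vector_field_outside[OF Y(2), of q]
        by cases (simp_all add: vscale_def)
    qed
  qed
  then have "vadd (vscale f (nab X Y)) (vscale (directional X f) Y) p
     = vadd (vscale f (nab X Y')) (vscale (directional X f) Y') p"
    using nab_scale_right[OF f(1) X(1) Y(1)] nab_scale_right[OF f(1) X(1) Y(2)] by simp
  then have "nab X Y p = nab X Y' p"
    using f(2,3) eq_near_at[OF eq(2)] by (auto simp: vadd_def vscale_def fun_eq_iff)
  also have "\<dots> = nab X' Y' p"
    by (rule tensorial_pointwise[OF nab_tensorial[OF Y(2)] X p eq(1)])
  finally show ?thesis .
qed

text \<open>Any two global representatives of the same germs give the same value, so the value that
  \<open>localize\<close> describes exists as soon as there is one pair of representatives.\<close>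

lemma localize_eq:
  assumes X': "X' \<in> vector_fields M" "eq_near M p X' X" and Y': "Y' \<in> vector_fields M" "eq_near M p Y' Y"
  shows "localize M nab X Y p = nab X' Y' p"
  unfolding localize_def
proof (rule the_equality)
  have p: "p \<in> jet_space M" by (rule eq_near_jet_space[OF X'(2)])
  show "\<forall>X''\<in>vector_fields M. \<forall>Y''\<in>vector_fields M. eq_near M p X'' X \<and> eq_near M p Y'' Y \<longrightarrow> nab X'' Y'' p = nab X' Y' p"
  proof (intro ballI impI)
    fix X'' Y'' assume X'': "X'' \<in> vector_fields M" and Y'': "Y'' \<in> vector_fields M"
      and "eq_near M p X'' X \<and> eq_near M p Y'' Y"
    then have "eq_near M p X'' X'" "eq_near M p Y'' Y'"
      using eq_near_trans[OF _ eq_near_sym[OF X'(2)]] eq_near_trans[OF _ eq_near_sym[OF Y'(2)]] by blast+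
    then show "nab X'' Y'' p = nab X' Y' p"
      by (intro nab_local[OF X'' X'(1) Y'' Y'(1) p]) (rule eq_near_at)
  qed
  show "v = nab X' Y' p" if "\<forall>X''\<in>vector_fields M. \<forall>Y''\<in>vector_fields M.
      eq_near M p X'' X \<and> eq_near M p Y'' Y \<longrightarrow> nab X'' Y'' p = v" for v
    using that X' Y' by blast
qed

lemma localize_eq_near:
  assumes X': "X' \<in> vector_fields M" "eq_near M p X' X" and Y': "Y' \<in> vector_fields M" "eq_near M p Y' Y"
  shows "eq_near M p (nab X' Y') (localize M nab X Y)"
proof -
  obtain V where V: "jet_open M V" "p \<in> V" "\<And>q. q \<in> V \<Longrightarrow> eq_near M q X' X"
    by (rule eq_near_nearby[OF X'(2)]) blast
  obtain W where W: "jet_open M W" "p \<in> W" "\<And>q. q \<in> W \<Longrightarrow> eq_near M q Y' Y"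
    by (rule eq_near_nearby[OF Y'(2)]) blast
  show ?thesis
    unfolding eq_near_def
    by (intro exI[of _ "V \<inter> W"]) (use jet_open_Int V W localize_eq[OF X'(1) _ Y'(1)] in auto)
qed

text \<open>The curvature nests the connection, so the inner covariant derivative must be known near \<open>p\<close> and
  not only at \<open>p\<close>.\<close>

lemma curvature_localize:
  assumes X: "X' \<in> vector_fields M" "eq_near M p X' X" and Y: "Y' \<in> vector_fields M" "eq_near M p Y' Y"
    and Z: "Z' \<in> vector_fields M" "eq_near M p Z' Z"
  shows "curvature M (localize M nab) X Y Z p = curvature M nab X' Y' Z' p"
proof -
  have "localize M nab X (localize M nab Y Z) p = nab X' (nab Y' Z') p"
    using X Y Z by (intro localize_eq localize_eq_near nab_vf)
  moreover have "localize M nab Y (localize M nab X Z) p = nab Y' (nab X' Z') p"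
    using X Y Z by (intro localize_eq localize_eq_near nab_vf)
  moreover have "localize M nab (lie_bracket M X Y) Z p = nab (lie_bracket M X' Y') Z' p"
    using X Y Z by (intro localize_eq lie_bracket_vf lie_bracket_eq_near)
  ultimately show ?thesis by (simp add: curvature_def)
qed

abbreviation curv :: "('a, 'n) vfield \<Rightarrow> ('a, 'n) vfield \<Rightarrow> ('a, 'n) vfield \<Rightarrow> ('a, 'n) vfield" where
  "curv \<equiv> curvature M nab"

lemma curv_eq:
  "curv X Y Z = vadd (nab X (nab Y Z)) (vscale (\<lambda>p. -1) (vadd (nab Y (nab X Z)) (nab (lie_bracket M X Y) Z)))"
  by (intro ext) (simp add: curvature_def vadd_def vscale_def)

lemma curv_vf [intro]:
  assumes "X \<in> vector_fields M" "Y \<in> vector_fields M" "Z \<in> vector_fields M"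
  shows "curv X Y Z \<in> vector_fields M"
  unfolding curv_eq using assms by (intro vadd_vf vscale_vf nab_vf lie_bracket_vf smooth_function_const)

lemma curv_antisym:
  assumes "X \<in> vector_fields M" "Y \<in> vector_fields M" "Z \<in> vector_fields M"
  shows "curv Y X Z = vscale (\<lambda>p. -1) (curv X Y Z)"
  unfolding lie_bracket_antisym[of Y X] curvature_def
    nab_scale_left[OF smooth_function_const lie_bracket_vf[OF assms(1,2)] assms(3)]
  by (intro ext) (simp add: vscale_def)

text \<open>The derivative term of \<open>\<nabla>\<^sub>Y \<nabla>\<^sub>f\<^sub>X Z\<close> cancels against the one of \<open>[f X, Y] = f [X, Y] - (Y f) X\<close>.\<close>

lemma curv_tensorial_left:
  assumes Y: "Y \<in> vector_fields M" and Z: "Z \<in> vector_fields M"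
  shows "tensorial (\<lambda>X. curv X Y Z)"
  unfolding tensorial_def
proof (intro conjI ballI allI impI)
  fix X X' assume X: "X \<in> vector_fields M" "X' \<in> vector_fields M"
  have "nab Y (nab (vadd X X') Z) = vadd (nab Y (nab X Z)) (nab Y (nab X' Z))"
    using X Y Z by (simp add: nab_add_left nab_add_right nab_vf)
  moreover have "nab (vadd X X') (nab Y Z) = vadd (nab X (nab Y Z)) (nab X' (nab Y Z))"
    using X Y Z by (simp add: nab_add_left nab_vf)
  moreover have "nab (lie_bracket M (vadd X X') Y) Z = vadd (nab (lie_bracket M X Y) Z) (nab (lie_bracket M X' Y) Z)"
    using X Y Z by (simp add: lie_bracket_add_left nab_add_left lie_bracket_vf)
  ultimately show "curv (vadd X X') Y Z = vadd (curv X Y Z) (curv X' Y Z)"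
    unfolding curvature_def by (intro ext) (simp add: vadd_def)
next
  fix f X assume f: "smooth_function f" and X: "X \<in> vector_fields M"
  have d: "smooth_function (directional Y f)" "smooth_function (\<lambda>p. - directional Y f p)"
    using directional_smooth[OF Y f] smooth_function_minus by auto
  have "nab Y (nab (vscale f X) Z) = vadd (vscale f (nab Y (nab X Z))) (vscale (directional Y f) (nab X Z))"
    using X Y Z f by (simp add: nab_scale_left nab_scale_right nab_vf)
  moreover have "nab (vscale f X) (nab Y Z) = vscale f (nab X (nab Y Z))"
    using X Y Z f by (simp add: nab_scale_left nab_vf)
  moreover have "nab (lie_bracket M (vscale f X) Y) Z
      = vadd (vscale f (nab (lie_bracket M X Y) Z)) (vscale (\<lambda>p. - directional Y f p) (nab X Z))"
    unfolding lie_bracket_scale_left[OF X Y f]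
    using X Y Z f d by (simp add: nab_add_left nab_scale_left lie_bracket_vf vscale_vf)
  ultimately show "curv (vscale f X) Y Z = vscale f (curv X Y Z)"
    unfolding curvature_def by (intro ext) (simp add: vadd_def vscale_def scaleR_diff_right)
qed

lemma curv_tensorial_middle:
  assumes X: "X \<in> vector_fields M" and Z: "Z \<in> vector_fields M"
  shows "tensorial (\<lambda>Y. curv X Y Z)"
proof -
  have L: "tensorial (\<lambda>Y. curv Y X Z)" by (rule curv_tensorial_left[OF X Z])
  have e: "curv X Y Z = vscale (\<lambda>p. -1) (curv Y X Z)" if "Y \<in> vector_fields M" for Y
    by (rule curv_antisym[OF that X Z])
  show ?thesis
    unfolding tensorial_def
  proof (intro conjI ballI allI impI)
    fix Y Y' assume Y: "Y \<in> vector_fields M" "Y' \<in> vector_fields M"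
    show "curv X (vadd Y Y') Z = vadd (curv X Y Z) (curv X Y' Z)"
      unfolding e[OF vadd_vf[OF Y]] e[OF Y(1)] e[OF Y(2)] tensorial_vadd[OF L Y]
      by (simp add: vadd_def vscale_def)
  next
    fix f Y assume f: "smooth_function f" and Y: "Y \<in> vector_fields M"
    show "curv X (vscale f Y) Z = vscale f (curv X Y Z)"
      unfolding e[OF vscale_vf[OF f Y]] e[OF Y] tensorial_vscale[OF L f Y]
      by (simp add: vscale_def)
  qed
qed

text \<open>The first derivatives of \<open>f\<close> cancel by symmetry; the second ones combine to
  \<open>X (Y f) - Y (X f) - [X, Y] f = 0\<close>.\<close>

lemma curv_tensorial_right:
  assumes X: "X \<in> vector_fields M" and Y: "Y \<in> vector_fields M"
  shows "tensorial (\<lambda>Z. curv X Y Z)"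
  unfolding tensorial_def
proof (intro conjI ballI allI impI)
  fix Z Z' assume Z: "Z \<in> vector_fields M" "Z' \<in> vector_fields M"
  show "curv X Y (vadd Z Z') = vadd (curv X Y Z) (curv X Y Z')"
    unfolding curvature_def using X Y Z
    by (intro ext) (simp add: nab_add_right nab_vf lie_bracket_vf, simp add: vadd_def)
next
  fix f Z assume f: "smooth_function f" and Z: "Z \<in> vector_fields M"
  have second: "nab X (nab Y (vscale f Z)) = vadd (vadd (vscale f (nab X (nab Y Z))) (vscale (directional X f) (nab Y Z)))
      (vadd (vscale (directional Y f) (nab X Z)) (vscale (directional X (directional Y f)) Z))"
    if X: "X \<in> vector_fields M" and Y: "Y \<in> vector_fields M" for X Y
  proof -
    note d = directional_smooth[OF Y f]
    have "nab X (nab Y (vscale f Z)) = vadd (nab X (vscale f (nab Y Z))) (nab X (vscale (directional Y f) Z))"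
      unfolding nab_scale_right[OF f Y Z] by (rule nab_add_right[OF X]) (use f d Y Z in auto)
    then show ?thesis
      using nab_scale_right[OF f X nab_vf[OF Y Z]] nab_scale_right[OF d X Z] by simp
  qed
  have br: "directional (lie_bracket M X Y) f p *\<^sub>R Z p c
     = directional X (directional Y f) p *\<^sub>R Z p c - directional Y (directional X f) p *\<^sub>R Z p c" for p c
    using directional_lie_bracket[OF X Y f, of p] vector_field_outside[OF Z, of p]
    by (cases "p \<in> jet_space M") (simp_all add: scaleR_diff_left)
  show "curv X Y (vscale f Z) = vscale f (curv X Y Z)"
  proof (intro ext)
    fix p c
    show "curv X Y (vscale f Z) p c = vscale f (curv X Y Z) p c"
      unfolding curvature_def second[OF X Y] second[OF Y X] nab_scale_right[OF f lie_bracket_vf[OF X Y] Z]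
      using br[of p c] by (simp add: vadd_def vscale_def algebra_simps)
  qed
qed

definition extend :: "'a jet \<Rightarrow> ('a, 'n) tvec \<Rightarrow> ('a, 'n) vfield" where
  "extend p v = (SOME X. X \<in> vector_fields M \<and> X p = v)"

lemma extend:
  assumes "p \<in> jet_space M" "v \<in> tangent_space M p"
  shows "extend p v \<in> vector_fields M" "extend p v p = v"
proof -
  have "\<exists>X. X \<in> vector_fields M \<and> X p = v" using vector_field_through[OF assms] by metis
  then have "extend p v \<in> vector_fields M \<and> extend p v p = v" unfolding extend_def by (rule someI_ex)
  then show "extend p v \<in> vector_fields M" "extend p v p = v" by auto
qed

text \<open>The curvature as a map of tangent vectors; by tensoriality the extensions are arbitrary
  (\<open>curv_at_eq\<close>).\<close>

definition curv_at :: "'a jet \<Rightarrow> ('a, 'n) tvec \<Rightarrow> ('a, 'n) tvec \<Rightarrow> ('a, 'n) tvec \<Rightarrow> ('a, 'n) tvec" where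
  "curv_at p u v w = curv (extend p u) (extend p v) (extend p w) p"

lemma curv_at_eq:
  assumes p: "p \<in> jet_space M" and X: "X \<in> vector_fields M" and Y: "Y \<in> vector_fields M" and Z: "Z \<in> vector_fields M"
  shows "curv_at p (X p) (Y p) (Z p) = curv X Y Z p"
proof -
  note T = vector_field_tangent[OF _ p]
  note x = extend[OF p T[OF X]] and y = extend[OF p T[OF Y]] and z = extend[OF p T[OF Z]]
  have "curv_at p (X p) (Y p) (Z p) = curv (extend p (X p)) (extend p (Y p)) (extend p (Z p)) p"
    by (simp add: curv_at_def)
  also have "\<dots> = curv X (extend p (Y p)) (extend p (Z p)) p"
    by (rule tensorial_pointwise[OF curv_tensorial_left[OF y(1) z(1)] x(1) X p x(2)])
  also have "\<dots> = curv X Y (extend p (Z p)) p"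
    by (rule tensorial_pointwise[OF curv_tensorial_middle[OF X z(1)] y(1) Y p y(2)])
  also have "\<dots> = curv X Y Z p"
    by (rule tensorial_pointwise[OF curv_tensorial_right[OF X Y] z(1) Z p z(2)])
  finally show ?thesis .
qed

lemma curv_at_tangent:
  assumes "p \<in> jet_space M" "u \<in> tangent_space M p" "v \<in> tangent_space M p" "w \<in> tangent_space M p"
  shows "curv_at p u v w \<in> tangent_space M p"
  unfolding curv_at_def by (intro vector_field_tangent curv_vf extend assms)

lemma curv_at_antisym:
  assumes "p \<in> jet_space M" "u \<in> tangent_space M p" "v \<in> tangent_space M p" "w \<in> tangent_space M p"
  shows "curv_at p v u w = (\<lambda>c. - curv_at p u v w c)"
  unfolding curv_at_def
  using curv_antisym[OF extend(1)[OF assms(1,2)] extend(1)[OF assms(1,3)] extend(1)[OF assms(1,4)]]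
  by (simp add: vscale_def)

lemma curv_at_same:
  assumes "p \<in> jet_space M" "u \<in> tangent_space M p" "w \<in> tangent_space M p"
  shows "curv_at p u u w = (\<lambda>c. 0)"
proof
  fix c
  have "curv_at p u u w c = - curv_at p u u w c"
    using curv_at_antisym[OF assms(1,2,2,3)] by (rule fun_cong)
  then have "2 *\<^sub>R curv_at p u u w c = 0" by (metis add.right_inverse scaleR_2)
  then show "curv_at p u u w c = 0" by simp
qed

lemma tangent_linearI:
  assumes p: "p \<in> jet_space M" and \<Phi>: "tensorial \<Phi>"
    and F: "\<And>X. X \<in> vector_fields M \<Longrightarrow> F (X p) = \<Phi> X p"
  shows "tangent_linear p F"
  unfolding tangent_linear_def
proof (intro conjI ballI allI)
  fix v w assume v: "v \<in> tangent_space M p" and w: "w \<in> tangent_space M p"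
  note x = extend[OF p v] and y = extend[OF p w]
  have "F (vadd (extend p v) (extend p w) p) = vadd (\<Phi> (extend p v)) (\<Phi> (extend p w)) p"
    using F[OF vadd_vf[OF x(1) y(1)]] tensorial_vadd[OF \<Phi> x(1) y(1)] by simp
  then show "F (\<lambda>c. v c + w c) = (\<lambda>c. F v c + F w c)"
    using F[OF x(1)] F[OF y(1)] x(2) y(2) by (simp add: vadd_def)
next
  fix r :: real and v assume v: "v \<in> tangent_space M p"
  note x = extend[OF p v]
  have "F (vscale (\<lambda>p. r) (extend p v) p) = vscale (\<lambda>p. r) (\<Phi> (extend p v)) p"
    using F[OF vscale_vf[OF smooth_function_const x(1)]] tensorial_vscale[OF \<Phi> smooth_function_const x(1)] by simp
  then show "F (\<lambda>c. r *\<^sub>R v c) = (\<lambda>c. r *\<^sub>R F v c)"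
    using F[OF x(1)] x(2) by (simp add: vscale_def)
qed

lemma curv_at_linear:
  assumes p: "p \<in> jet_space M" and v: "v \<in> tangent_space M p" and w: "w \<in> tangent_space M p"
  shows "tangent_linear p (\<lambda>u. curv_at p u v w)"
    and "tangent_linear p (\<lambda>u. curv_at p v u w)"
    and "tangent_linear p (\<lambda>u. curv_at p v w u)"
proof -
  note x = extend[OF p v] and y = extend[OF p w]
  show "tangent_linear p (\<lambda>u. curv_at p u v w)"
    by (rule tangent_linearI[OF p curv_tensorial_left[OF x(1) y(1)]])
       (use curv_at_eq[OF p _ x(1) y(1)] x y in simp)
  show "tangent_linear p (\<lambda>u. curv_at p v u w)"
    by (rule tangent_linearI[OF p curv_tensorial_middle[OF x(1) y(1)]])
       (use curv_at_eq[OF p x(1) _ y(1)] x y in simp)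
  show "tangent_linear p (\<lambda>u. curv_at p v w u)"
    by (rule tangent_linearI[OF p curv_tensorial_right[OF x(1) y(1)]])
       (use curv_at_eq[OF p x(1) y(1)] x y in simp)
qed

end

section \<open>The adapted frame and its dual\<close>

lemma vec_expand: "(w :: real ^ 'n::finite) = (\<Sum>j\<in>UNIV. (w $ j) *\<^sub>R axis j 1)"
  by (simp add: vec_eq_iff axis_def mult_delta_right)

lemma finite_slot_range: "finite (slot_range s :: 'n::finite option set)"
  by (cases s) auto

lemma sum_slot_range:
  "(\<Sum>a\<in>slot_range Time_down. g a) = g None"
  "(\<Sum>a\<in>slot_range Space_down. g a) = (\<Sum>i\<in>(UNIV::'n::finite set). g (Some i))"
  "(\<Sum>a\<in>slot_range Vert_down. g a) = (\<Sum>i\<in>(UNIV::'n::finite set). g (Some i))"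
  by (simp_all add: sum.reindex)

text \<open>The three summands of the tangent bundle are indexed by the covariant slots: the vectors of the
  adapted frame transform like covariant indices of the corresponding kind.\<close>

definition kinds :: "slot set" where
  "kinds = {Time_down, Space_down, Vert_down}"

fun contravariant :: "slot \<Rightarrow> slot" where
  "contravariant Time_down = Time_up"
| "contravariant Space_down = Space_up"
| "contravariant Vert_down = Vert_up"
| "contravariant s = s"

lemma slot_range_contravariant: "s \<in> kinds \<Longrightarrow> slot_range (contravariant s) = slot_range s"
  by (auto simp: kinds_def)

text \<open>An upper index transforms by the inverse of the matrix of the lower index of the same kind, that
  is, by the matrix with the two charts exchanged.\<close>

lemma slot_factor_contravariant:
  "s \<in> kinds \<Longrightarrow> slot_factor M c c' p (contravariant s) a b = slot_factor M c' c p s b a"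
  by (auto simp: kinds_def)

lemma sum_set_Cons:
  assumes "finite A" "finite XS"
  shows "(\<Sum>z\<in>set_Cons A XS. g z) = (\<Sum>x\<in>A. \<Sum>xs\<in>XS. g (x # xs))"
proof -
  have "set_Cons A XS = (\<lambda>(x, xs). x # xs) ` (A \<times> XS)"
    by (auto simp: set_Cons_def)
  moreover have "inj_on (\<lambda>(x, xs). x # xs) (A \<times> XS)" by (auto simp: inj_on_def)
  ultimately show ?thesis
    by (simp add: sum.reindex sum.cartesian_product case_prod_unfold comp_def)
qed

lemma finite_set_Cons: "finite A \<Longrightarrow> finite XS \<Longrightarrow> finite (set_Cons A XS)"
proof -
  assume "finite A" "finite XS"
  moreover have "set_Cons A XS = (\<lambda>(x, xs). x # xs) ` (A \<times> XS)" by (auto simp: set_Cons_def)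
  ultimately show "finite (set_Cons A XS)" by simp
qed

lemma sum_index_set4:
  fixes g :: "'n::finite option list \<Rightarrow> real"
  shows "(\<Sum>b\<in>index_set [s0, s1, s2, s3]. g b)
    = (\<Sum>l\<in>slot_range s0. \<Sum>i\<in>slot_range s1. \<Sum>j\<in>slot_range s2. \<Sum>k\<in>slot_range s3. g [l, i, j, k])"
  unfolding index_set_def
  by (simp add: sum_set_Cons finite_set_Cons finite_slot_range sum.reindex inj_on_def)

lemma index_set4E:
  assumes "a \<in> index_set [s0, s1, s2, s3]"
  obtains l i j k where "a = [l, i, j, k]" "l \<in> slot_range s0" "i \<in> slot_range s1" "j \<in> slot_range s2" "k \<in> slot_range s3"
  using assms by (auto simp: index_set_def set_Cons_def)

context jets
begin

lemma jac_vertical: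
  assumes "c \<in> jcharts M" "c' \<in> jcharts M" "p \<in> jdom M c \<inter> jdom M c'"
  shows "jac M c c' p (0, 0, w) = (0, 0, \<chi> k. \<Sum>j\<in>UNIV. w $ j * (dx'_dx M c c' p k j * dt'_dt M c' c p))"
proof -
  have "(0, 0, w) = (\<Sum>j\<in>UNIV. (w $ j) *\<^sub>R (0 :: real, 0 :: real ^ 'n, axis j 1 :: real ^ 'n))"
    using vec_expand[of w] by (simp add: prod_eq_iff fst_sum snd_sum)
  then have "jac M c c' p (0, 0, w) = jac M c c' p (\<Sum>j\<in>UNIV. (w $ j) *\<^sub>R (0, 0, axis j 1))"
    by (rule arg_cong)
  also have "\<dots> = (\<Sum>j\<in>UNIV. (w $ j) *\<^sub>R jac M c c' p (0, 0, axis j 1))"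
    by (simp only: linear_sum[OF linear_jac[OF assms]] linear_cmul[OF linear_jac[OF assms]])
  finally show ?thesis
    by (simp add: jac_columns(3)[OF assms] prod_eq_iff fst_sum snd_sum vec_eq_iff)
qed

lemma jac_horizontal:
  assumes "c \<in> jcharts M" "c' \<in> jcharts M" "p \<in> jdom M c \<inter> jdom M c'"
  shows "fst (snd (jac M c c' p (a, b, w))) = (\<chi> k. \<Sum>l\<in>UNIV. b $ l * dx'_dx M c c' p k l)"
proof -
  obtain A where A: "linear A" "\<And>a b w. fst (snd (jac M c c' p (a, b, w))) = A b"
    using jac_blocks[OF assms] by auto
  have "A b = (\<Sum>l\<in>UNIV. (b $ l) *\<^sub>R A (axis l 1))"
    using vec_expand[of b] linear_sum[OF A(1)] linear_cmul[OF A(1)] by (metis (no_types, lifting) sum.cong)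
  then show ?thesis
    by (simp add: A(2) dx'_dx_def vec_eq_iff)
qed

lemma dx_inverse:
  assumes "c \<in> jcharts M" "c' \<in> jcharts M" "p \<in> jdom M c \<inter> jdom M c'"
  shows "(\<Sum>l\<in>UNIV. dx'_dx M c c' p l i * dx'_dx M c' c p m l) = (if m = i then 1 else 0)"
proof -
  have "fst (snd (jac M c' c p (jac M c c' p (0, axis i 1, 0)))) = axis i 1"
    by (simp add: jac_inverse[OF assms])
  then have "(\<chi> k. \<Sum>l\<in>UNIV. (\<chi> k. dx'_dx M c c' p k i) $ l * dx'_dx M c' c p k l) = axis i 1"
    using assms by (simp only: jac_columns(2)[OF assms] jac_horizontal Int_commute)
  from arg_cong[OF this, of "\<lambda>w. w $ m"] show ?thesis by (simp add: axis_def)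
qed

end

locale jet_nonlinear_connection = jets M for M :: "('a, 'n::finite) manifold" +
  fixes \<Gamma> :: "('a, 'n) nlconn"
  assumes nonlinear: "nonlinear_connection M \<Gamma>"
begin

text \<open>The three families of the adapted basis as one family indexed by kind and index value; at the
  contravariant slots the value is a dummy.\<close>

definition frame_coords :: "('a, 'n) jchart \<Rightarrow> slot \<Rightarrow> 'n option \<Rightarrow> 'a jet \<Rightarrow> 'n jcoords" where
  "frame_coords c s a p = (case s of
      Time_down \<Rightarrow> (1, 0, - (\<chi> j. fst \<Gamma> c p j))
    | Space_down \<Rightarrow> (0, axis (the a) 1, - (\<chi> j. snd \<Gamma> c p j (the a)))
    | Vert_down \<Rightarrow> (0, 0, axis (the a) 1)
    | _ \<Rightarrow> 0)"

definition frame :: "('a, 'n) jchart \<Rightarrow> slot \<Rightarrow> 'n option \<Rightarrow> ('a, 'n) vfield" where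
  "frame c s a = (\<lambda>p. tvec_of M c p (frame_coords c s a p))"

text \<open>The dual basis \<open>dt\<close>, \<open>dx\<^sup>i\<close>, \<open>\<delta>y\<^sup>i = dy\<^sup>i + M\<^sup>i dt + N\<^sup>i\<^sub>l dx\<^sup>l\<close>, as functions of the components in the
  natural basis.\<close>

definition coframe :: "('a, 'n) jchart \<Rightarrow> slot \<Rightarrow> 'n option \<Rightarrow> 'a jet \<Rightarrow> 'n jcoords \<Rightarrow> real" where
  "coframe c s a p w = (case s of
      Time_down \<Rightarrow> fst w
    | Space_down \<Rightarrow> fst (snd w) $ the a
    | Vert_down \<Rightarrow> snd (snd w) $ the a + fst \<Gamma> c p (the a) * fst w
        + (\<Sum>l\<in>UNIV. snd \<Gamma> c p (the a) l * fst (snd w) $ l)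
    | _ \<Rightarrow> 0)"

lemma frame_simps:
  "frame c Time_down a = delta_t M \<Gamma> c" "frame c Space_down a = delta_x M \<Gamma> c (the a)"
  "frame c Vert_down a = partial_y M c (the a)"
  by (simp_all add: frame_def frame_coords_def delta_t_def delta_x_def partial_y_def)

lemma frame_self: "c \<in> charts_at M p \<Longrightarrow> frame c s a p c = frame_coords c s a p"
  by (simp add: frame_def tvec_of_self)

lemma frame_tangent: "c \<in> charts_at M p \<Longrightarrow> frame c s a p \<in> tangent_space M p"
  by (simp add: frame_def tvec_of_tangent)

lemma coframe_add: "coframe c s a p (v + w) = coframe c s a p v + coframe c s a p w"
  by (cases s) (simp_all add: coframe_def algebra_simps sum.distrib)

lemma coframe_scale: "coframe c s a p (r *\<^sub>R v) = r * coframe c s a p v"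
  by (cases s) (simp_all add: coframe_def algebra_simps sum_distrib_left)

lemma coframe_zero: "coframe c s a p 0 = 0"
  using coframe_scale[of c s a p 0 0] by simp

lemma coframe_sum: "coframe c s a p (\<Sum>i\<in>I. r i *\<^sub>R v i) = (\<Sum>i\<in>I. r i * coframe c s a p (v i))"
  by (induction I rule: infinite_finite_induct) (simp_all add: coframe_zero coframe_add coframe_scale)

lemma coframe_frame_coords:
  assumes "s \<in> kinds" "s' \<in> kinds" "a \<in> slot_range s" "b \<in> slot_range s'"
  shows "coframe c s' b p (frame_coords c s a p) = (if s = s' \<and> a = b then 1 else 0)"
  using assms by (auto simp: kinds_def coframe_def frame_coords_def axis_def mult_delta_right)

lemma coords_expansion:
  "w = (\<Sum>s\<in>kinds. \<Sum>a\<in>slot_range s. coframe c s a p w *\<^sub>R frame_coords c s a p)"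
proof -
  obtain t x y where w: "w = (t, x, y)" by (metis prod.exhaust)
  have "(\<Sum>s\<in>kinds. \<Sum>a\<in>slot_range s. coframe c s a p w *\<^sub>R frame_coords c s a p)
     = t *\<^sub>R (1, 0, - (\<chi> j. fst \<Gamma> c p j)) + (\<Sum>i\<in>UNIV. x $ i *\<^sub>R (0, axis i 1, - (\<chi> j. snd \<Gamma> c p j i)))
      + (\<Sum>i\<in>UNIV. (y $ i + fst \<Gamma> c p i * t + (\<Sum>l\<in>UNIV. snd \<Gamma> c p i l * x $ l)) *\<^sub>R (0, 0, axis i 1))"
    unfolding kinds_def by (simp add: sum_slot_range coframe_def frame_coords_def w del: slot_range.simps)
  also have "\<dots> = w"
    by (simp add: w prod_eq_iff fst_sum snd_sum vec_eq_iff axis_def mult_delta_right sum_negf)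
       (simp add: mult.commute)
  finally show ?thesis by simp
qed

lemma frame_expansion:
  assumes c: "c \<in> charts_at M p" and v: "v \<in> tangent_space M p"
  shows "v = (\<lambda>d. \<Sum>x\<in>Sigma kinds slot_range. coframe c (fst x) (snd x) p (v c) *\<^sub>R frame c (fst x) (snd x) p d)"
proof (rule tangent_eqI[OF v _ c])
  show "(\<lambda>d. \<Sum>x\<in>Sigma kinds slot_range. coframe c (fst x) (snd x) p (v c) *\<^sub>R frame c (fst x) (snd x) p d) \<in> tangent_space M p"
    by (intro tangent_sum tangent_scale frame_tangent[OF c])
  have "(\<Sum>x\<in>Sigma kinds slot_range. coframe c (fst x) (snd x) p (v c) *\<^sub>R frame c (fst x) (snd x) p c)
     = (\<Sum>s\<in>kinds. \<Sum>a\<in>slot_range s. coframe c s a p (v c) *\<^sub>R frame_coords c s a p)"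
    by (subst sum.Sigma) (simp_all add: kinds_def finite_slot_range case_prod_unfold frame_self[OF c] del: slot_range.simps)
  then show "v c = (\<Sum>x\<in>Sigma kinds slot_range. coframe c (fst x) (snd x) p (v c) *\<^sub>R frame c (fst x) (snd x) p c)"
    using coords_expansion[of "v c" c p] by simp
qed

lemma nonlinear_transform:
  assumes "c \<in> charts_at M p" "c' \<in> charts_at M p"
  shows "fst \<Gamma> c' p k = (\<Sum>j\<in>UNIV. fst \<Gamma> c p j * (dt'_dt M c' c p)\<^sup>2 * dx'_dx M c c' p k j)
          - dt'_dt M c' c p * dy'_dt M c c' p k"
    and "snd \<Gamma> c' p k l = (\<Sum>i\<in>UNIV. \<Sum>j\<in>UNIV. snd \<Gamma> c p j i * dt'_dt M c' c p
              * dx'_dx M c' c p i l * dx'_dx M c c' p k j)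
          - (\<Sum>i\<in>UNIV. dx'_dx M c' c p i l * dy'_dx M c c' p k i)"
  using nonlinear assms unfolding nonlinear_connection_def charts_at_iff by blast+

text \<open>Here the transformation laws of the nonlinear connection are used: they are exactly what makes
  the inhomogeneous terms, the derivatives of the new velocities with respect to \<open>t\<close> and \<open>x\<close>,
  disappear.\<close>

lemma frame_transform:
  assumes ch: "c \<in> charts_at M p" "c' \<in> charts_at M p" and s: "s \<in> kinds" and a: "a \<in> slot_range s"
  shows "frame c s a p = (\<lambda>d. \<Sum>b\<in>slot_range s. slot_factor M c c' p s a b *\<^sub>R frame c' s b p d)"
proof (rule tangent_eqI[OF frame_tangent[OF ch(1)] _ ch(2)])
  show "(\<lambda>d. \<Sum>b\<in>slot_range s. slot_factor M c c' p s a b *\<^sub>R frame c' s b p d) \<in> tangent_space M p"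
    by (intro tangent_sum tangent_scale frame_tangent[OF ch(2)])
  have c: "c \<in> jcharts M" "c' \<in> jcharts M" and p: "p \<in> jdom M c \<inter> jdom M c'" using ch by (auto simp: charts_at_iff)
  note J = jac_columns[OF c p] and lin = linear_jac[OF c p] and Jv = jac_vertical[OF c p]
  let ?d = "dt'_dt M c' c p" and ?d' = "dt'_dt M c c' p" and ?x = "dx'_dx M c c' p" and ?x' = "dx'_dx M c' c p"
  have "frame c s a p c' = jac M c c' p (frame_coords c s a p)"
    using ch(2) by (simp add: frame_def tvec_of_def)
  also have "\<dots> = (\<Sum>b\<in>slot_range s. slot_factor M c c' p s a b *\<^sub>R frame_coords c' s b p)"
  proof -
    consider "s = Time_down" | "s = Space_down" | "s = Vert_down" using s by (auto simp: kinds_def)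
    then show ?thesis
    proof cases
      case 1
      have "frame_coords c s a p = (1, 0, 0) + (0, 0, - (\<chi> j. fst \<Gamma> c p j))"
        by (simp add: 1 frame_coords_def)
      then have "jac M c c' p (frame_coords c s a p) = (?d', 0, \<chi> k. dy'_dt M c c' p k - (\<Sum>j\<in>UNIV. fst \<Gamma> c p j * (?x k j * ?d)))"
        by (simp only: linear_add[OF lin] J Jv) (simp add: vec_eq_iff sum_negf)
      moreover have "?d' * fst \<Gamma> c' p k = (\<Sum>j\<in>UNIV. fst \<Gamma> c p j * (?x k j * ?d)) - dy'_dt M c c' p k" for k
      proof -
        have "?d' * fst \<Gamma> c' p k = (\<Sum>j\<in>UNIV. (?d * ?d') * (fst \<Gamma> c p j * (?x k j * ?d))) - (?d * ?d') * dy'_dt M c c' p k"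
          unfolding nonlinear_transform(1)[OF ch]
          by (simp add: right_diff_distrib sum_distrib_left power2_eq_square mult_ac)
        then show ?thesis by (simp add: J(4))
      qed
      ultimately show ?thesis
        unfolding 1 sum_slot_range by (simp add: frame_coords_def vec_eq_iff)
    next
      case 2
      obtain i where i: "a = Some i" using a 2 by auto
      have "frame_coords c s a p = (0, axis i 1, 0) + (0, 0, - (\<chi> j. snd \<Gamma> c p j i))"
        by (simp add: 2 i frame_coords_def)
      then have 1: "jac M c c' p (frame_coords c s a p)
          = (0, \<chi> k. ?x k i, \<chi> k. dy'_dx M c c' p k i - (\<Sum>j\<in>UNIV. snd \<Gamma> c p j i * (?x k j * ?d)))"
        by (simp only: linear_add[OF lin] J Jv) (simp add: vec_eq_iff sum_negf)
      (* the Jacobian of x contracted with its inverse collapses the sum over m to m = i *)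
      have 3: "(\<Sum>l\<in>UNIV. ?x l i * snd \<Gamma> c' p k l) = (\<Sum>j\<in>UNIV. snd \<Gamma> c p j i * (?x k j * ?d)) - dy'_dx M c c' p k i" for k
      proof -
        have "(\<Sum>l\<in>UNIV. ?x l i * snd \<Gamma> c' p k l)
          = (\<Sum>l\<in>UNIV. \<Sum>m\<in>UNIV. (?x l i * ?x' m l) * ((\<Sum>j\<in>UNIV. snd \<Gamma> c p j m * (?x k j * ?d)) - dy'_dx M c c' p k m))"
          unfolding nonlinear_transform(2)[OF ch]
          by (simp add: right_diff_distrib sum_distrib_left sum_subtractf mult_ac)
        also have "\<dots> = (\<Sum>m\<in>UNIV. (\<Sum>l\<in>UNIV. ?x l i * ?x' m l) * ((\<Sum>j\<in>UNIV. snd \<Gamma> c p j m * (?x k j * ?d)) - dy'_dx M c c' p k m))"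
          by (subst sum.swap) (simp add: sum_distrib_right)
        also have "\<dots> = (\<Sum>j\<in>UNIV. snd \<Gamma> c p j i * (?x k j * ?d)) - dy'_dx M c c' p k i"
          unfolding dx_inverse[OF c p] by (simp add: if_distrib[of "\<lambda>r. r * _"] cong: if_cong)
        finally show ?thesis .
      qed
      have "(\<Sum>b\<in>slot_range s. slot_factor M c c' p s a b *\<^sub>R frame_coords c' s b p)
          = (\<Sum>l\<in>UNIV. ?x l i *\<^sub>R (0, axis l 1, - (\<chi> j. snd \<Gamma> c' p j l)))"
        unfolding 2 sum_slot_range by (simp add: i frame_coords_def)
      also have "\<dots> = (0, \<chi> k. ?x k i, \<chi> k. - (\<Sum>l\<in>UNIV. ?x l i * snd \<Gamma> c' p k l))"
        by (simp add: prod_eq_iff fst_sum snd_sum vec_eq_iff axis_def mult_delta_right sum_negf)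
      finally show ?thesis by (simp add: 1 3)
    next
      case 3
      obtain i where i: "a = Some i" using a 3 by auto
      have "(\<Sum>b\<in>slot_range s. slot_factor M c c' p s a b *\<^sub>R frame_coords c' s b p)
          = (\<Sum>l\<in>UNIV. (?x l i * ?d) *\<^sub>R (0, 0, axis l 1))"
        unfolding 3 sum_slot_range by (simp add: i frame_coords_def)
      also have "\<dots> = (0, 0, \<chi> k. ?x k i * ?d)"
        by (simp add: prod_eq_iff fst_sum snd_sum vec_eq_iff axis_def mult_delta_right)
      finally show ?thesis by (simp add: 3 i frame_coords_def J(3))
    qed
  qed
  finally show "frame c s a p c' = (\<Sum>b\<in>slot_range s. slot_factor M c c' p s a b *\<^sub>R frame c' s b p c')"
    by (simp add: frame_self[OF ch(2)])
qed

lemma coframe_frame: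
  assumes "c \<in> charts_at M p" "s \<in> kinds" "s' \<in> kinds" "a \<in> slot_range s" "b \<in> slot_range s'"
  shows "coframe c s' b p (frame c s a p c) = (if s = s' \<and> a = b then 1 else 0)"
  by (simp add: frame_self[OF assms(1)] coframe_frame_coords[OF assms(2-5)])

lemma coframe_transform:
  assumes ch: "c \<in> charts_at M p" "c' \<in> charts_at M p" and s: "s \<in> kinds" and a: "a \<in> slot_range s"
    and v: "v \<in> tangent_space M p"
  shows "coframe c s a p (v c) = (\<Sum>b\<in>slot_range s. slot_factor M c c' p (contravariant s) a b * coframe c' s b p (v c'))"
proof -
  have 1: "coframe c s a p (frame c' r b p c) = (if r = s then slot_factor M c' c p s b a else 0)"
    if r: "r \<in> kinds" and b: "b \<in> slot_range r" for r b
  proof -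
    have "frame c' r b p c = (\<Sum>b'\<in>slot_range r. slot_factor M c' c p r b b' *\<^sub>R frame c r b' p c)"
      using frame_transform[OF ch(2,1) r b] by (rule fun_cong)
    then have "coframe c s a p (frame c' r b p c)
        = (\<Sum>b'\<in>slot_range r. slot_factor M c' c p r b b' * coframe c s a p (frame c r b' p c))"
      by (simp add: coframe_sum)
    also have "\<dots> = (\<Sum>b'\<in>slot_range r. if r = s \<and> b' = a then slot_factor M c' c p r b b' else 0)"
      by (rule sum.cong) (simp_all add: coframe_frame[OF ch(1) r s _ a])
    also have "\<dots> = (if r = s then slot_factor M c' c p s b a else 0)"
      using a by (simp add: finite_slot_range)
    finally show ?thesis .
  qed
  have "v c = (\<Sum>x\<in>Sigma kinds slot_range. coframe c' (fst x) (snd x) p (v c') *\<^sub>R frame c' (fst x) (snd x) p c)"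
    using frame_expansion[OF ch(2) v] by (rule fun_cong)
  then have "coframe c s a p (v c)
      = (\<Sum>x\<in>Sigma kinds slot_range. coframe c' (fst x) (snd x) p (v c') * coframe c s a p (frame c' (fst x) (snd x) p c))"
    by (simp add: coframe_sum)
  also have "\<dots> = (\<Sum>r\<in>kinds. \<Sum>b\<in>slot_range r. coframe c' r b p (v c') * coframe c s a p (frame c' r b p c))"
    by (subst sum.Sigma) (simp_all add: kinds_def finite_slot_range case_prod_unfold del: slot_range.simps)
  also have "\<dots> = (\<Sum>r\<in>kinds. if r = s then \<Sum>b\<in>slot_range r. coframe c' r b p (v c') * slot_factor M c' c p s b a else 0)"
    by (intro sum.cong refl) (simp add: 1)
  also have "\<dots> = (\<Sum>b\<in>slot_range s. coframe c' s b p (v c') * slot_factor M c' c p s b a)"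
    using s by (simp add: kinds_def del: slot_range.simps)
  finally show ?thesis
    by (simp add: slot_factor_contravariant[OF s] mult.commute)
qed

lemma coframe_smooth:
  assumes c: "c \<in> jcharts M" and w: "smooth_on w (jcoord c ` jdom M c)"
  shows "smooth_on (\<lambda>z. coframe c s a (jinv M c z) (w z)) (jcoord c ` jdom M c)"
proof -
  note D = open_jcoord_image[OF c]
  have G: "smooth_on (\<lambda>z. fst \<Gamma> c (jinv M c z) k) (jcoord c ` jdom M c)"
    "smooth_on (\<lambda>z. snd \<Gamma> c (jinv M c z) k l) (jcoord c ` jdom M c)" for k l
    using nonlinear c unfolding nonlinear_connection_def smooth_fun_def comp_def by fastforce+
  show ?thesis
    by (cases s; simp add: coframe_def)
       (intro smooth_on_add smooth_on_sum smooth_on_mult smooth_on_nth smooth_on_fst smooth_on_snd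
         smooth_on_const G w D)+
qed

lemma frame_local_field:
  assumes c: "c \<in> jcharts M"
  shows "local_field c (frame c s a)"
  unfolding frame_def
proof (rule local_field_tvec_of[OF c])
  note D = open_jcoord_image[OF c]
  have G: "smooth_on (\<lambda>z. fst \<Gamma> c (jinv M c z) k) (jcoord c ` jdom M c)"
    "smooth_on (\<lambda>z. snd \<Gamma> c (jinv M c z) k l) (jcoord c ` jdom M c)" for k l
    using nonlinear c unfolding nonlinear_connection_def smooth_fun_def comp_def by fastforce+
  show "smooth_on (\<lambda>z. frame_coords c s a (jinv M c z)) (jcoord c ` jdom M c)"
    by (cases s; simp add: frame_coords_def)
       (intro smooth_on_Pair smooth_on_minus smooth_on_vec_lambda smooth_on_const G D)+
qed

definition projection :: "slot \<Rightarrow> ('a, 'n) vfield \<Rightarrow> ('a, 'n) vfield" where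
  "projection s = (case s of Time_down \<Rightarrow> proj_R M \<Gamma> | Space_down \<Rightarrow> proj_M M \<Gamma> | _ \<Rightarrow> proj_v M \<Gamma>)"

text \<open>For the vertical kind this is the expansion in the adapted frame, minus its two horizontal
  parts.\<close>

lemma projection_eq:
  assumes c: "c \<in> charts_at M p" and s: "s \<in> kinds"
  shows "projection s X p c = (\<Sum>a\<in>slot_range s. coframe c s a p (X p c) *\<^sub>R frame c s a p c)"
proof -
  have R: "proj_R M \<Gamma> X p c = (\<Sum>a\<in>slot_range Time_down. coframe c Time_down a p (X p c) *\<^sub>R frame c Time_down a p c)"
    unfolding sum_slot_range by (simp add: proj_R_def coframe_def frame_simps)
  have N: "proj_M M \<Gamma> X p c = (\<Sum>a\<in>slot_range Space_down. coframe c Space_down a p (X p c) *\<^sub>R frame c Space_down a p c)"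
    unfolding sum_slot_range by (simp add: proj_M_def coframe_def frame_simps)
  have K: "(\<Sum>s\<in>kinds. g s) = g Time_down + (g Space_down + g Vert_down)" for g :: "slot \<Rightarrow> 'n jcoords"
    by (simp add: kinds_def)
  have "X p c = (\<Sum>s\<in>kinds. \<Sum>a\<in>slot_range s. coframe c s a p (X p c) *\<^sub>R frame c s a p c)"
    unfolding frame_self[OF c] by (rule coords_expansion)
  then have E: "X p c = proj_R M \<Gamma> X p c + (proj_M M \<Gamma> X p c
      + (\<Sum>a\<in>slot_range Vert_down. coframe c Vert_down a p (X p c) *\<^sub>R frame c Vert_down a p c))"
    unfolding K R[symmetric] N[symmetric] .
  have "x - r - n = v" if "x = r + (n + v)" for x r n v :: "'n jcoords"
    using that by simp
  from this[OF E]
  have V: "proj_v M \<Gamma> X p c = (\<Sum>a\<in>slot_range Vert_down. coframe c Vert_down a p (X p c) *\<^sub>R frame c Vert_down a p c)"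
    unfolding proj_v_def .
  show ?thesis using s R N V by (auto simp: kinds_def projection_def)
qed

lemma projection_diff:
  "projection s (\<lambda>p c. X p c - Y p c - Z p c) p c = projection s X p c - projection s Y p c - projection s Z p c"
  by (cases s) (simp_all add: projection_def proj_v_def proj_R_def proj_M_def algebra_simps sum.distrib sum_subtractf)

lemma projection_outside: "X p c = 0 \<Longrightarrow> projection s X p c = 0"
  by (cases s) (simp_all add: projection_def proj_v_def proj_R_def proj_M_def)

text \<open>The projection is computed in every chart with the frame of that chart, so this needs that the
  frame of another chart is a combination of frame vectors of the same kind.\<close>

lemma projection_cutoff_frame:
  assumes c: "c \<in> jcharts M" and s: "s \<in> kinds" and a: "a \<in> slot_range s" and Z: "cutoff c f (frame c s a) \<in> vector_fields M"
  shows "projection s (cutoff c f (frame c s a)) = cutoff c f (frame c s a)"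
proof (intro ext)
  fix q d
  let ?Z = "cutoff c f (frame c s a)"
  show "projection s ?Z q d = ?Z q d"
  proof (cases "d \<in> charts_at M q \<and> q \<in> jdom M c")
    case False
    then have "?Z q d = 0" using vector_field_zero[OF Z, of d q] by (auto simp: cutoff_def)
    then show ?thesis by (simp add: projection_outside)
  next
    case True
    then have d: "d \<in> charts_at M q" and cq: "c \<in> charts_at M q" using c by (auto simp: charts_at_iff)
    have F: "frame c s a q d = (\<Sum>b\<in>slot_range s. slot_factor M c d q s a b *\<^sub>R frame d s b q d)"
      using frame_transform[OF cq d s a] by (rule fun_cong)
    have co: "coframe d s b q (frame c s a q d) = slot_factor M c d q s a b" if b: "b \<in> slot_range s" for b
    proof -
      have "coframe d s b q (frame c s a q d) = (\<Sum>b'\<in>slot_range s. slot_factor M c d q s a b' * coframe d s b q (frame d s b' q d))"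
        unfolding F by (rule coframe_sum)
      also have "\<dots> = (\<Sum>b'\<in>slot_range s. if b' = b then slot_factor M c d q s a b' else 0)"
        by (rule sum.cong) (simp_all add: coframe_frame[OF d s s _ b])
      finally show ?thesis using b by (simp add: finite_slot_range)
    qed
    have Zq: "?Z q d = f q *\<^sub>R frame c s a q d" using True by (simp add: cutoff_def)
    have "projection s ?Z q d = (\<Sum>b\<in>slot_range s. (f q * slot_factor M c d q s a b) *\<^sub>R frame d s b q d)"
      unfolding projection_eq[OF d s] Zq coframe_scale by (rule sum.cong) (simp_all add: co)
    also have "\<dots> = f q *\<^sub>R (\<Sum>b\<in>slot_range s. slot_factor M c d q s a b *\<^sub>R frame d s b q d)"
      by (simp add: scaleR_sum_right)
    finally show ?thesis unfolding Zq F[symmetric] .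
  qed
qed

end


section \<open>The adapted components of the curvature\<close>

locale adapted_connection =
  jet_nonlinear_connection M \<Gamma> + jet_connection M nab
  for M :: "('a, 'n::finite) manifold" and \<Gamma> nab +
  assumes adapted: "Gamma_linear_connection M \<Gamma> nab"
begin

lemma nab_projection:
  assumes "X \<in> vector_fields M" "Y \<in> vector_fields M"
  shows "nab X (projection s Y) = projection s (nab X Y)"
proof -
  have "projection s \<in> {proj_R M \<Gamma>, proj_M M \<Gamma>, proj_v M \<Gamma>}"
    by (cases s) (simp_all add: projection_def)
  then show ?thesis using adapted assms unfolding Gamma_linear_connection_def by blast
qed

lemma curv_projection:
  assumes "X \<in> vector_fields M" "Y \<in> vector_fields M" "Z \<in> vector_fields M" and Z: "projection s Z = Z"
  shows "curv X Y Z p c = projection s (curv X Y Z) p c"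
proof -
  have 1: "projection s (nab U Z) = nab U Z" if "U \<in> vector_fields M" for U
    using nab_projection[OF that assms(3), of s] Z by simp
  have 2: "projection s (nab U (nab V Z)) = nab U (nab V Z)" if "U \<in> vector_fields M" "V \<in> vector_fields M" for U V
    using nab_projection[OF that(1) nab_vf[OF that(2) assms(3)], of s] 1[OF that(2)] by simp
  show ?thesis
    unfolding curvature_def projection_diff
    using 1[OF lie_bracket_vf[OF assms(1,2)]] 2[OF assms(1,2)] 2[OF assms(2,1)] by simp
qed

text \<open>The frame vector is the value of a global field \<open>Z\<close> that a projection leaves fixed. Since the
  connection commutes with the projection, so does the curvature, and \<open>R(X, Y) Z\<close> is fixed as well.\<close>

lemma curv_at_frame_block:
  assumes ch: "c \<in> charts_at M p" and u: "u \<in> tangent_space M p" and v: "v \<in> tangent_space M p"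
    and s: "s \<in> kinds" and a: "a \<in> slot_range s"
  shows "curv_at p u v (frame c s a p)
    = (\<lambda>d. \<Sum>b\<in>slot_range s. coframe c s b p (curv_at p u v (frame c s a p) c) *\<^sub>R frame c s b p d)"
proof -
  have c: "c \<in> jcharts M" "p \<in> jdom M c" using ch by (auto simp: charts_at_iff)
  have p: "p \<in> jet_space M" by (rule jdom_in_jet_space[OF c(2)])
  obtain f W V where f: "smooth_function f" "p \<in> W" "\<And>q. q \<in> W \<Longrightarrow> f q = 1" "jet_open M V"
    "jet_space M \<subseteq> V \<union> jdom M c" "\<And>q. q \<in> V \<Longrightarrow> f q = 0"
    by (rule bump_function[OF ch jet_open_jdom[OF c(1)] c(2)]) auto
  define Z where "Z = cutoff c f (frame c s a)"
  have Z: "Z \<in> vector_fields M"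
    unfolding Z_def by (rule cutoff_vf[OF frame_local_field[OF c(1)] c(1) f(1,4-6)])
  have Zp: "Z p = frame c s a p" using c f(3)[OF f(2)] by (simp add: Z_def cutoff_def)
  note x = extend[OF p u] and y = extend[OF p v]
  have R: "curv_at p u v (frame c s a p) = curv (extend p u) (extend p v) Z p"
    using curv_at_eq[OF p x(1) y(1) Z] by (simp add: x y Zp)
  show ?thesis
  proof (rule tangent_eqI[OF curv_at_tangent[OF p u v frame_tangent[OF ch]] _ ch])
    show "(\<lambda>d. \<Sum>b\<in>slot_range s. coframe c s b p (curv_at p u v (frame c s a p) c) *\<^sub>R frame c s b p d) \<in> tangent_space M p"
      by (intro tangent_sum tangent_scale frame_tangent[OF ch])
    have "projection s Z = Z" unfolding Z_def by (rule projection_cutoff_frame[OF c(1) s a Z[unfolded Z_def]])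
    from curv_projection[OF x(1) y(1) Z this, of p c]
    show "curv_at p u v (frame c s a p) c
      = (\<Sum>b\<in>slot_range s. coframe c s b p (curv_at p u v (frame c s a p) c) *\<^sub>R frame c s b p c)"
      unfolding R projection_eq[OF ch s] .
  qed
qed

text \<open>The arguments are the kind of the vector that the curvature acts on, then the kinds of the second
  and of the first argument of the curvature: index lists put the index of the first argument last.\<close>

definition curv_component :: "slot \<Rightarrow> slot \<Rightarrow> slot \<Rightarrow> ('a, 'n) local_comps" where
  "curv_component s s2 s3 c p l = coframe c s (l ! 0) p
     (curv_at p (frame c s3 (l ! 3) p) (frame c s2 (l ! 2) p) (frame c s (l ! 1) p) c)"

lemma curvature_of_frame:
  assumes ch: "c \<in> charts_at M p"
  shows "curvature M (localize M nab) (frame c s3 k) (frame c s2 j) (frame c s i) p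
    = curv_at p (frame c s3 k p) (frame c s2 j p) (frame c s i p)"
proof -
  have c: "c \<in> jcharts M" "p \<in> jdom M c" using ch by (auto simp: charts_at_iff)
  note ext = local_field_extension[OF frame_local_field[OF c(1)] ch]
  obtain X where X: "X \<in> vector_fields M" "eq_near M p X (frame c s3 k)" by (rule ext)
  obtain Y where Y: "Y \<in> vector_fields M" "eq_near M p Y (frame c s2 j)" by (rule ext)
  obtain Z where Z: "Z \<in> vector_fields M" "eq_near M p Z (frame c s i)" by (rule ext)
  show ?thesis
    using curvature_localize[OF X Y Z] curv_at_eq[OF jdom_in_jet_space[OF c(2)] X(1) Y(1) Z(1)]
      eq_near_at[OF X(2)] eq_near_at[OF Y(2)] eq_near_at[OF Z(2)] by simp
qed

text \<open>Near each point the frame fields extend to global fields, whose curvature is a smooth field.\<close>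

lemma curv_component_smooth:
  assumes c: "c \<in> jcharts M"
  shows "smooth_fun M (jdom M c) (\<lambda>p. curv_component s s2 s3 c p l)"
proof (rule smooth_fun_local)
  fix p assume p: "p \<in> jdom M c"
  have ch: "c \<in> charts_at M p" using c p by (simp add: charts_at_iff)
  note ext = local_field_extension[OF frame_local_field[OF c] ch]
  obtain X where X: "X \<in> vector_fields M" "eq_near M p X (frame c s3 (l ! 3))" by (rule ext)
  obtain Y where Y: "Y \<in> vector_fields M" "eq_near M p Y (frame c s2 (l ! 2))" by (rule ext)
  obtain Z where Z: "Z \<in> vector_fields M" "eq_near M p Z (frame c s (l ! 1))" by (rule ext)
  obtain U V W where U: "jet_open M U" "p \<in> U" "\<And>q. q \<in> U \<Longrightarrow> X q = frame c s3 (l ! 3) q"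
    and V: "jet_open M V" "p \<in> V" "\<And>q. q \<in> V \<Longrightarrow> Y q = frame c s2 (l ! 2) q"
    and W: "jet_open M W" "p \<in> W" "\<And>q. q \<in> W \<Longrightarrow> Z q = frame c s (l ! 1) q"
    using X(2) Y(2) Z(2) unfolding eq_near_def by blast
  let ?N = "U \<inter> (V \<inter> (W \<inter> jdom M c))"
  have N: "jet_open M ?N" by (intro jet_open_Int U V W jet_open_jdom c)
  have Nc: "?N \<subseteq> jdom M c" by blast
  have "smooth_on (\<lambda>z. coframe c s (l ! 0) (jinv M c z) (curv X Y Z (jinv M c z) c)) (jcoord c ` ?N)"
    by (rule smooth_on_subset[OF coframe_smooth[OF c vector_field_smooth[OF curv_vf[OF X(1) Y(1) Z(1)] c]]]) blast
  then have "smooth_on (\<lambda>z. curv_component s s2 s3 c (jinv M c z) l) (jcoord c ` ?N)"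
  proof (rule smooth_on_cong[OF open_jcoord_jet_open[OF N c Nc], rotated])
    fix z assume "z \<in> jcoord c ` ?N"
    then obtain q where q: "q \<in> U" "q \<in> V" "q \<in> W" "q \<in> jdom M c" "z = jcoord c q" by blast
    have "jinv M c z = q" using q c by simp
    then show "coframe c s (l ! 0) (jinv M c z) (curv X Y Z (jinv M c z) c) = curv_component s s2 s3 c (jinv M c z) l"
      using curv_at_eq[OF jdom_in_jet_space[OF q(4)] X(1) Y(1) Z(1)] U(3)[OF q(1)] V(3)[OF q(2)] W(3)[OF q(3)]
      by (simp add: curv_component_def)
  qed
  then show "\<exists>c' V. c' \<in> jcharts M \<and> jet_open M V \<and> p \<in> V \<and> V \<subseteq> jdom M c' \<and>
      smooth_on (\<lambda>z. curv_component s s2 s3 c (jinv M c' z) l) (jcoord c' ` V)"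
    using N Nc c p U(2) V(2) W(2) by blast
qed

lemma curv_at_frame_transform:
  assumes ch: "c \<in> charts_at M p" "c' \<in> charts_at M p"
    and s: "s \<in> kinds" "s2 \<in> kinds" "s3 \<in> kinds"
    and a: "i \<in> slot_range s" "j \<in> slot_range s2" "k \<in> slot_range s3"
  shows "curv_at p (frame c s3 k p) (frame c s2 j p) (frame c s i p) d
    = (\<Sum>i'\<in>slot_range s. \<Sum>j'\<in>slot_range s2. \<Sum>k'\<in>slot_range s3.
        (slot_factor M c c' p s i i' * slot_factor M c c' p s2 j j' * slot_factor M c c' p s3 k k') *\<^sub>R
        curv_at p (frame c' s3 k' p) (frame c' s2 j' p) (frame c' s i' p) d)"
proof -
  have p: "p \<in> jet_space M" using ch(1) unfolding charts_at_iff by (blast intro: jdom_in_jet_space)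
  note T = frame_tangent[OF ch(1)] and T' = frame_tangent[OF ch(2)]
  have 3: "curv_at p u v (frame c s i p) d
      = (\<Sum>i'\<in>slot_range s. slot_factor M c c' p s i i' *\<^sub>R curv_at p u v (frame c' s i' p) d)"
    if "u \<in> tangent_space M p" "v \<in> tangent_space M p" for u v
    unfolding frame_transform[OF ch s(1) a(1)]
    using tangent_linear_sum[OF curv_at_linear(3)[OF p that] finite_slot_range T'] by (rule fun_cong)
  have 2: "curv_at p u (frame c s2 j p) w d
      = (\<Sum>j'\<in>slot_range s2. slot_factor M c c' p s2 j j' *\<^sub>R curv_at p u (frame c' s2 j' p) w d)"
    if "u \<in> tangent_space M p" "w \<in> tangent_space M p" for u w
    unfolding frame_transform[OF ch s(2) a(2)]
    using tangent_linear_sum[OF curv_at_linear(2)[OF p that] finite_slot_range T'] by (rule fun_cong)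
  have 1: "curv_at p (frame c s3 k p) v w d
      = (\<Sum>k'\<in>slot_range s3. slot_factor M c c' p s3 k k' *\<^sub>R curv_at p (frame c' s3 k' p) v w d)"
    if "v \<in> tangent_space M p" "w \<in> tangent_space M p" for v w
    unfolding frame_transform[OF ch s(3) a(3)]
    using tangent_linear_sum[OF curv_at_linear(1)[OF p that] finite_slot_range T'] by (rule fun_cong)
  show ?thesis
    unfolding 3[OF T T] 2[OF T T'] 1[OF T' T'] by (simp add: scaleR_sum_right mult.assoc)
qed

text \<open>The frame vectors contribute the factors of the three lower indices by trilinearity, the coframe
  that of the upper index.\<close>

lemma curv_component_d_tensor:
  assumes s: "s \<in> kinds" "s2 \<in> kinds" "s3 \<in> kinds"
  shows "d_tensor M [contravariant s, s, s2, s3] (curv_component s s2 s3)"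
  unfolding d_tensor_def
proof (intro conjI ballI)
  show "smooth_fun M (jdom M c) (\<lambda>p. curv_component s s2 s3 c p a)" if "c \<in> jcharts M" for c a
    by (rule curv_component_smooth[OF that])
  fix c c' p and a :: "'n option list"
  assume "c \<in> jcharts M" "c' \<in> jcharts M" "p \<in> jdom M c \<inter> jdom M c'"
    and "a \<in> index_set [contravariant s, s, s2, s3]"
  then have ch: "c \<in> charts_at M p" "c' \<in> charts_at M p" and p: "p \<in> jet_space M"
    by (auto simp: charts_at_iff intro: jdom_in_jet_space)
  obtain l i j k where a: "a = [l, i, j, k]" "l \<in> slot_range s" "i \<in> slot_range s" "j \<in> slot_range s2" "k \<in> slot_range s3"
    using \<open>a \<in> index_set _\<close> by (rule index_set4E) (simp add: slot_range_contravariant[OF s(1)])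
  let ?R = "\<lambda>c k j i. curv_at p (frame c s3 k p) (frame c s2 j p) (frame c s i p)"
  have T: "?R c k j i \<in> tangent_space M p"
    by (intro curv_at_tangent p frame_tangent ch)
  have "curv_component s s2 s3 c p a = (\<Sum>l'\<in>slot_range s. slot_factor M c c' p (contravariant s) l l' * coframe c' s l' p (?R c k j i c'))"
    using coframe_transform[OF ch s(1) a(2) T] by (simp add: curv_component_def a(1))
  also have "\<dots> = (\<Sum>l'\<in>slot_range s. \<Sum>i'\<in>slot_range s. \<Sum>j'\<in>slot_range s2. \<Sum>k'\<in>slot_range s3.
      coframe c' s l' p (?R c' k' j' i' c') * (slot_factor M c c' p (contravariant s) l l' *
       (slot_factor M c c' p s i i' * (slot_factor M c c' p s2 j j' * slot_factor M c c' p s3 k k'))))"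
    unfolding curv_at_frame_transform[OF ch s a(3-5)]
    by (simp add: coframe_sum[where r = "\<lambda>_. 1", simplified] coframe_scale sum_distrib_left mult_ac)
  also have "\<dots> = (\<Sum>b\<in>index_set [contravariant s, s, s2, s3]. curv_component s s2 s3 c' p b *
      (\<Prod>m<length [contravariant s, s, s2, s3]. slot_factor M c c' p ([contravariant s, s, s2, s3] ! m) (a ! m) (b ! m)))"
    unfolding sum_index_set4 slot_range_contravariant[OF s(1)]
    by (simp add: curv_component_def a(1) prod.lessThan_Suc numeral_eq_Suc mult_ac)
  finally show "curv_component s s2 s3 c p a = (\<Sum>b\<in>index_set [contravariant s, s, s2, s3]. curv_component s s2 s3 c' p b *
      (\<Prod>m<length [contravariant s, s, s2, s3]. slot_factor M c c' p ([contravariant s, s, s2, s3] ! m) (a ! m) (b ! m)))" .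
qed

text \<open>Indexing by kinds makes the fifteen nonzero groups of curvature relations instances of one
  (\<open>curvature_relations_iff\<close>).\<close>

definition relation :: "slot \<Rightarrow> slot \<Rightarrow> slot \<Rightarrow> ('a, 'n) local_comps \<Rightarrow> bool" where
  "relation s s2 s3 D \<longleftrightarrow> (\<forall>c\<in>jcharts M. \<forall>p\<in>jdom M c. \<forall>i\<in>slot_range s. \<forall>j\<in>slot_range s2. \<forall>k\<in>slot_range s3.
     curvature M (localize M nab) (frame c s3 k) (frame c s2 j) (frame c s i) p
       = (\<lambda>d. \<Sum>l\<in>slot_range s. D c p [l, i, j, k] *\<^sub>R frame c s l p d))"

lemma relation_curv_at:
  assumes "relation s s2 s3 D" "c \<in> charts_at M p" "i \<in> slot_range s" "j \<in> slot_range s2" "k \<in> slot_range s3"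
  shows "curv_at p (frame c s3 k p) (frame c s2 j p) (frame c s i p)
    = (\<lambda>d. \<Sum>l\<in>slot_range s. D c p [l, i, j, k] *\<^sub>R frame c s l p d)"
  unfolding curvature_of_frame[OF assms(2), symmetric]
  using assms unfolding relation_def charts_at_iff by blast

text \<open>Apply the coframe to the relation: the frame is linearly independent.\<close>

lemma relation_unique:
  assumes "relation s s2 s3 D" "s \<in> kinds" "c \<in> charts_at M p"
    "l \<in> slot_range s" "i \<in> slot_range s" "j \<in> slot_range s2" "k \<in> slot_range s3"
  shows "D c p [l, i, j, k] = curv_component s s2 s3 c p [l, i, j, k]"
proof -
  have "curv_component s s2 s3 c p [l, i, j, k] = (\<Sum>l'\<in>slot_range s. D c p [l', i, j, k] * coframe c s l p (frame c s l' p c))"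
    unfolding curv_component_def
    by (simp add: numeral_3_eq_3 numeral_2_eq_2 relation_curv_at[OF assms(1,3,5-7)] coframe_sum)
  also have "\<dots> = (\<Sum>l'\<in>slot_range s. if l' = l then D c p [l', i, j, k] else 0)"
    by (rule sum.cong) (simp_all add: coframe_frame[OF assms(3,2,2) _ assms(4)])
  also have "\<dots> = D c p [l, i, j, k]" using assms(4) by (simp add: finite_slot_range)
  finally show ?thesis by simp
qed

lemma relation_curv_component:
  assumes s: "s \<in> kinds"
  shows "relation s s2 s3 (curv_component s s2 s3)"
  unfolding relation_def
proof (intro ballI)
  fix c p and i j k :: "'n option" assume "c \<in> jcharts M" "p \<in> jdom M c" and i: "i \<in> slot_range s"
  then have ch: "c \<in> charts_at M p" by (simp add: charts_at_iff)
  show "curvature M (localize M nab) (frame c s3 k) (frame c s2 j) (frame c s i) p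
       = (\<lambda>d. \<Sum>l\<in>slot_range s. curv_component s s2 s3 c p [l, i, j, k] *\<^sub>R frame c s l p d)"
    unfolding curvature_of_frame[OF ch]
    using curv_at_frame_block[OF ch frame_tangent[OF ch] frame_tangent[OF ch] s i, of s3 k s2 j]
    by (simp add: curv_component_def numeral_3_eq_3 numeral_2_eq_2)
qed

lemma curvature_time_time:
  assumes "c \<in> jcharts M" "p \<in> jdom M c"
  shows "curvature M (localize M nab) (delta_t M \<Gamma> c) (delta_t M \<Gamma> c) (frame c s a) p = (\<lambda>_. 0)"
proof -
  have ch: "c \<in> charts_at M p" using assms by (simp add: charts_at_iff)
  show ?thesis
    using curvature_of_frame[OF ch, of Time_down None Time_down None s a]
      curv_at_same[OF jdom_in_jet_space[OF assms(2)] frame_tangent[OF ch, of Time_down None] frame_tangent[OF ch, of s a]]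
    by (simp add: frame_simps)
qed

lemma curvature_relations_iff:
  "curvature_relations M \<Gamma> nab K \<longleftrightarrow>
     relation Time_down Time_down Space_down (Rt_bar K) \<and>
     relation Space_down Time_down Space_down (Rt_x K) \<and>
     relation Vert_down Time_down Space_down (Rt_y K) \<and>
     relation Time_down Space_down Space_down (Rx_bar K) \<and>
     relation Space_down Space_down Space_down (Rx_x K) \<and>
     relation Vert_down Space_down Space_down (Rx_y K) \<and>
     relation Time_down Time_down Vert_down (Pt_bar K) \<and>
     relation Space_down Time_down Vert_down (Pt_x K) \<and>
     relation Vert_down Time_down Vert_down (Pt_y K) \<and>
     relation Time_down Space_down Vert_down (Px_bar K) \<and>
     relation Space_down Space_down Vert_down (Px_x K) \<and>
     relation Vert_down Space_down Vert_down (Px_y K) \<and>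
     relation Time_down Vert_down Vert_down (S_bar K) \<and>
     relation Space_down Vert_down Vert_down (S_x K) \<and>
     relation Vert_down Vert_down Vert_down (S_y K)"
proof -
  have Z: "curvature M (localize M nab) (delta_t M \<Gamma> c) (delta_t M \<Gamma> c) (delta_t M \<Gamma> c) p = (\<lambda>_. 0)"
    "curvature M (localize M nab) (delta_t M \<Gamma> c) (delta_t M \<Gamma> c) (delta_x M \<Gamma> c i) p = (\<lambda>_. 0)"
    "curvature M (localize M nab) (delta_t M \<Gamma> c) (delta_t M \<Gamma> c) (partial_y M c i) p = (\<lambda>_. 0)"
    if "c \<in> jcharts M" "p \<in> jdom M c" for c p i
    using curvature_time_time[OF that, of Time_down None] curvature_time_time[OF that, of Space_down "Some i"]
      curvature_time_time[OF that, of Vert_down "Some i"]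
    by (simp_all add: frame_simps)
  show ?thesis
    unfolding curvature_relations_def Let_def relation_def
    by (simp add: Z sum.reindex comp_def frame_simps all_conj_distrib ball_conj_distrib)
qed

end

context jet_nonlinear_connection
begin

lemma tangent_linear_agree:
  assumes F: "tangent_linear p F" and G: "tangent_linear p G" and c: "c \<in> charts_at M p" and v: "v \<in> tangent_space M p"
    and eq: "\<And>s a. s \<in> kinds \<Longrightarrow> a \<in> slot_range s \<Longrightarrow> F (frame c s a p) = G (frame c s a p)"
  shows "F v = G v"
proof -
  have fin: "finite (Sigma kinds slot_range :: (slot \<times> 'n option) set)"
    by (intro finite_SigmaI finite_slot_range) (simp add: kinds_def)
  have E: "H v = (\<lambda>d. \<Sum>x\<in>Sigma kinds slot_range. coframe c (fst x) (snd x) p (v c) *\<^sub>R H (frame c (fst x) (snd x) p) d)"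
    if "tangent_linear p H" for H
  proof -
    have "H v = H (\<lambda>d. \<Sum>x\<in>Sigma kinds slot_range. coframe c (fst x) (snd x) p (v c) *\<^sub>R frame c (fst x) (snd x) p d)"
      by (rule arg_cong[OF frame_expansion[OF c v]])
    also have "\<dots> = (\<lambda>d. \<Sum>x\<in>Sigma kinds slot_range. coframe c (fst x) (snd x) p (v c) *\<^sub>R H (frame c (fst x) (snd x) p) d)"
      by (rule tangent_linear_sum[OF that fin frame_tangent[OF c]])
    finally show ?thesis .
  qed
  show ?thesis
    unfolding E[OF F] E[OF G] by (intro ext sum.cong refl) (auto simp: eq)
qed

end

lemma adapted_connectionI:
  assumes "smooth_manifold M" "nonlinear_connection M \<Gamma>" "Gamma_linear_connection M \<Gamma> nab"
  shows "adapted_connection M \<Gamma> nab"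
  by unfold_locales (use assms in \<open>auto simp: Gamma_linear_connection_def\<close>)

text \<open>The relations fix both curvatures on frame vectors for the five pairs of kinds that occur in them;
  antisymmetry gives the pairs in the opposite order and the pair of two time vectors. Trilinearity
  then extends the equality from the frame to all tangent vectors.\<close>

lemma curvature_determined:
  fixes M :: "('a, 'n::finite) manifold"
  assumes A: "adapted_connection M \<Gamma> nab" and B: "adapted_connection M \<Gamma> nab'"
    and relA: "curvature_relations M \<Gamma> nab K" and relB: "curvature_relations M \<Gamma> nab' K"
    and X: "X \<in> vector_fields M" and Y: "Y \<in> vector_fields M" and Z: "Z \<in> vector_fields M"
  shows "curvature M nab' X Y Z = curvature M nab X Y Z"
proof -
  interpret A: adapted_connection M \<Gamma> nab by (rule A)
  interpret B: adapted_connection M \<Gamma> nab' by (rule B)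
  note relA = relA[unfolded A.curvature_relations_iff] and relB = relB[unfolded B.curvature_relations_iff]
  show ?thesis
  proof
    fix p
    show "curvature M nab' X Y Z p = curvature M nab X Y Z p"
    proof (cases "p \<in> jet_space M")
      case False
      then show ?thesis
        using A.vector_field_outside[OF A.curv_vf[OF X Y Z]] A.vector_field_outside[OF B.curv_vf[OF X Y Z]] by simp
    next
      case p: True
      obtain c where ch: "c \<in> charts_at M p" using A.charts_at_nonempty[OF p] .
      let ?e = "\<lambda>s a. A.frame c s a p"
      note T = A.frame_tangent[OF ch]
      (* the pairs list the kinds of the second and of the first argument *)
      have ordered: "B.curv_at p (?e s3 k) (?e s2 j) (?e s i) = A.curv_at p (?e s3 k) (?e s2 j) (?e s i)"
        if "(s2, s3) \<in> {(Time_down, Space_down), (Space_down, Space_down), (Time_down, Vert_down),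
            (Space_down, Vert_down), (Vert_down, Vert_down)}"
          and s: "s \<in> kinds" and i: "i \<in> slot_range s" "j \<in> slot_range s2" "k \<in> slot_range s3" for s s2 s3 i j k
      proof -
        have "\<exists>D. A.relation s s2 s3 D \<and> B.relation s s2 s3 D"
          using that(1) s relA relB unfolding kinds_def by (elim insertE emptyE) (simp_all, blast+)
        then obtain D where D: "A.relation s s2 s3 D" "B.relation s s2 s3 D" by blast
        show ?thesis
          unfolding A.relation_curv_at[OF D(1) ch i] B.relation_curv_at[OF D(2) ch i] ..
      qed
      have frames: "B.curv_at p (?e s3 k) (?e s2 j) (?e s i) = A.curv_at p (?e s3 k) (?e s2 j) (?e s i)"
        if s: "s \<in> kinds" "s2 \<in> kinds" "s3 \<in> kinds" and i: "i \<in> slot_range s" "j \<in> slot_range s2" "k \<in> slot_range s3" for s s2 s3 i j k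
      proof -
        have swap: "B.curv_at p (?e s3 k) (?e s2 j) (?e s i) = A.curv_at p (?e s3 k) (?e s2 j) (?e s i)"
          if "B.curv_at p (?e s2 j) (?e s3 k) (?e s i) = A.curv_at p (?e s2 j) (?e s3 k) (?e s i)"
          using that A.curv_at_antisym[OF p T T T, of s3 k s2 j s i] B.curv_at_antisym[OF p T T T, of s3 k s2 j s i] by simp
        consider "s2 = Time_down" "s3 = Time_down"
          | "(s2, s3) \<in> {(Time_down, Space_down), (Space_down, Space_down), (Time_down, Vert_down),
            (Space_down, Vert_down), (Vert_down, Vert_down)}"
          | "(s3, s2) \<in> {(Time_down, Space_down), (Space_down, Space_down), (Time_down, Vert_down),
            (Space_down, Vert_down), (Vert_down, Vert_down)}"
          using s(2,3) unfolding kinds_def by blast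
        then show ?thesis
        proof cases
          case 1
          then have "j = k" using i by auto
          then show ?thesis using 1 A.curv_at_same[OF p T T] B.curv_at_same[OF p T T] by simp
        next
          case 2
          then show ?thesis by (rule ordered[OF _ s(1) i])
        next
          case 3
          then show ?thesis by (intro swap ordered[OF _ s(1) i(1,3,2)])
        qed
      qed
      note VT = A.vector_field_tangent[OF _ p]
      note agree = A.tangent_linear_agree[OF B.curv_at_linear(1)[OF p] A.curv_at_linear(1)[OF p] ch]
        A.tangent_linear_agree[OF B.curv_at_linear(2)[OF p] A.curv_at_linear(2)[OF p] ch]
        A.tangent_linear_agree[OF B.curv_at_linear(3)[OF p] A.curv_at_linear(3)[OF p] ch]
      have "B.curv_at p (X p) (Y p) (Z p) = A.curv_at p (X p) (Y p) (Z p)"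
      proof (rule agree(3)[OF VT[OF X] VT[OF Y] VT[OF X] VT[OF Y] VT[OF Z]])
        fix s and i :: "'n option" assume s: "s \<in> kinds" "i \<in> slot_range s"
        show "B.curv_at p (X p) (Y p) (?e s i) = A.curv_at p (X p) (Y p) (?e s i)"
        proof (rule agree(2)[OF VT[OF X] T VT[OF X] T VT[OF Y]])
          fix s2 and j :: "'n option" assume s2: "s2 \<in> kinds" "j \<in> slot_range s2"
          show "B.curv_at p (X p) (?e s2 j) (?e s i) = A.curv_at p (X p) (?e s2 j) (?e s i)"
            by (rule agree(1)[OF T T T T VT[OF X]]) (rule frames[OF s(1) s2(1) _ s(2) s2(2)])
        qed
      qed
      then show ?thesis
        unfolding A.curv_at_eq[OF p X Y Z] B.curv_at_eq[OF p X Y Z] .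
    qed
  qed
qed

theorem theorem3p5:
  fixes M :: "('a, 'n::finite) manifold"
    and \<Gamma> :: "('a, 'n) nlconn"
    and nab :: "('a, 'n) vfield \<Rightarrow> ('a, 'n) vfield \<Rightarrow> ('a, 'n) vfield"
  assumes "smooth_manifold M"
    and "nonlinear_connection M \<Gamma>"
    and "Gamma_linear_connection M \<Gamma> nab"
  shows "\<exists>K :: ('a, 'n) curv_comps.
    curvature_relations M \<Gamma> nab K \<and>
    (\<forall>(ks, D) \<in> set (typed_comps K). d_tensor M ks D) \<and>
    (\<forall>K'. curvature_relations M \<Gamma> nab K' \<longrightarrow> same_comps M K K') \<and>
    (\<forall>nab'. Gamma_linear_connection M \<Gamma> nab' \<and> curvature_relations M \<Gamma> nab' K \<longrightarrow>
       (\<forall>X\<in>vector_fields M. \<forall>Y\<in>vector_fields M. \<forall>Z\<in>vector_fields M.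
          curvature M nab' X Y Z = curvature M nab X Y Z))"
proof -
  interpret A: adapted_connection M \<Gamma> nab by (rule adapted_connectionI[OF assms])
  let ?C = A.curv_component
  let ?K = "\<lparr>Rt_bar = ?C Time_down Time_down Space_down, Rt_x = ?C Space_down Time_down Space_down,
      Rt_y = ?C Vert_down Time_down Space_down, Rx_bar = ?C Time_down Space_down Space_down,
      Rx_x = ?C Space_down Space_down Space_down, Rx_y = ?C Vert_down Space_down Space_down,
      Pt_bar = ?C Time_down Time_down Vert_down, Pt_x = ?C Space_down Time_down Vert_down,
      Pt_y = ?C Vert_down Time_down Vert_down, Px_bar = ?C Time_down Space_down Vert_down,
      Px_x = ?C Space_down Space_down Vert_down, Px_y = ?C Vert_down Space_down Vert_down,
      S_bar = ?C Time_down Vert_down Vert_down, S_x = ?C Space_down Vert_down Vert_down,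
      S_y = ?C Vert_down Vert_down Vert_down\<rparr>"
  have k: "Time_down \<in> kinds" "Space_down \<in> kinds" "Vert_down \<in> kinds" by (simp_all add: kinds_def)
  have rel: "curvature_relations M \<Gamma> nab ?K"
    unfolding A.curvature_relations_iff by (simp add: A.relation_curv_component k)
  have "d_tensor M ks D" if "(ks, D) \<in> set (typed_comps ?K)" for ks D
  proof -
    have d: "d_tensor M [contravariant s, s, s2, s3] (?C s s2 s3)"
      if "s \<in> kinds" "s2 \<in> kinds" "s3 \<in> kinds" for s s2 s3
      by (rule A.curv_component_d_tensor[OF that])
    show ?thesis
      using that d[OF k(1) k(1) k(2)] d[OF k(2) k(1) k(2)] d[OF k(3) k(1) k(2)]
        d[OF k(1) k(2) k(2)] d[OF k(2) k(2) k(2)] d[OF k(3) k(2) k(2)]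
        d[OF k(1) k(1) k(3)] d[OF k(2) k(1) k(3)] d[OF k(3) k(1) k(3)]
        d[OF k(1) k(2) k(3)] d[OF k(2) k(2) k(3)] d[OF k(3) k(2) k(3)]
        d[OF k(1) k(3) k(3)] d[OF k(2) k(3) k(3)] d[OF k(3) k(3) k(3)]
      unfolding typed_comps_def by auto
  qed
  moreover have "same_comps M ?K K'" if K': "curvature_relations M \<Gamma> nab K'" for K'
  proof -
    let ?same = "\<lambda>x y. \<forall>c\<in>jcharts M. \<forall>p\<in>jdom M c. \<forall>a\<in>index_set (fst x). snd x c p a = snd y c p a"
    have u: "\<forall>c\<in>jcharts M. \<forall>p\<in>jdom M c. \<forall>a\<in>index_set [contravariant s, s, s2, s3]. ?C s s2 s3 c p a = D c p a"
      if D: "A.relation s s2 s3 D" and s: "s \<in> kinds" for s s2 s3 D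
    proof (intro ballI)
      fix c p and a :: "'n option list"
      assume "c \<in> jcharts M" "p \<in> jdom M c" and a: "a \<in> index_set [contravariant s, s, s2, s3]"
      then have ch: "c \<in> charts_at M p" by (simp add: A.charts_at_iff)
      from a show "?C s s2 s3 c p a = D c p a"
        by (rule index_set4E) (simp add: slot_range_contravariant[OF s] A.relation_unique[OF D s ch])
    qed
    note K' = K'[unfolded A.curvature_relations_iff]
    have "list_all2 ?same (typed_comps ?K) (typed_comps K')"
      using K' u[OF _ k(1)] u[OF _ k(2)] u[OF _ k(3)]
      unfolding typed_comps_def by simp
    then show ?thesis
      unfolding same_comps_def list_all2_conv_all_nth by blast
  qed
  moreover have "curvature M nab' X Y Z = curvature M nab X Y Z"
    if "Gamma_linear_connection M \<Gamma> nab'" "curvature_relations M \<Gamma> nab' ?K"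
      "X \<in> vector_fields M" "Y \<in> vector_fields M" "Z \<in> vector_fields M" for nab' X Y Z
    by (rule curvature_determined[OF A.adapted_connection_axioms adapted_connectionI[OF assms(1,2) that(1)] rel that(2-5)])
  ultimately show ?thesis
    using rel by (intro exI[of _ ?K] conjI) blast+
qed

end
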